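(* There is a constant $K>0$ such that the following holds for all holomorphic functions $u:\mathbb{D}\to\mathbb{C}$ and $\varphi:\mathbb{D}\to\mathbb{D}$ for which the operator $W_{u,\varphi}:\mathcal{B}^{v_{\log}}\to\mathcal{B}^{v_{\log}}$ is continuous. Put $$M(u,\varphi)=\max\left\{\limsup_{n\to\infty}\frac{(n+1)\,\|J_u(\varphi^n)\|_{\mathcal{B}^{v_{\log}}}}{\|g_{n+1}\|_{\mathcal{B}^{w_{\log}}}},\ \limsup_{n\to\infty}\frac{\|I_u(\varphi^n)\|_{\mathcal{B}^{v_{\log}}}}{\|g_n\|_{\mathcal{B}^{v_{\log}}}}\right\}.$$ Then $$\frac1K\, M(u,\varphi)\ \le\ \|W_{u,\varphi}\|_{e}^{\mathcal{B}^{v_{\log}}\to\mathcal{B}^{v_{\log}}}\ \le\ K\, M(u,\varphi).$$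
   Context: $\mathbb{D}$ is the open unit disk of $\mathbb{C}$ and $H(\mathbb{D})$ is the space of holomorphic functions on $\mathbb{D}$. A weight is a bounded, continuous, positive function $v:\mathbb{D}\to(0,\infty)$. For a weight $v$, $H_v^\infty$ is the Banach space of all $f\in H(\mathbb{D})$ with $\|f\|_{H_v^\infty}=\sup_{z\in\mathbb{D}}v(z)|f(z)|<\infty$, and $\mathcal{B}^v$ is the Banach space of all $f\in H(\mathbb{D})$ with $f'\in H_v^\infty$, normed by $\|f\|_{\mathcal{B}^v}=|f(0)|+\sup_{z\in\mathbb{D}}v(z)|f'(z)|$. The weights used are $v_{\log}(z)=(1-|z|)\log\left(\frac{2}{1-|z|}\right)$ and $w_{\log}(z)=\left[\log\log\left(\frac{4}{1-|z|^2}\right)\right]^{-1}$, $z\in\mathbb{D}$. For holomorphic $u:\mathbb{D}\to\mathbb{C}$ and $\varphi:\mathbb{D}\to\mathbb{D}$, the weighted composition operator is $W_{u,\varphi}(f)=u\cdot(f\circ\varphi)$. For $f\in H(\mathbb{D})$, $I_u(f)$ and $J_u(f)$ are the holomorphic functions $I_u(f)(z)=\int_0^z f'(s)u(s)\,ds$ and $J_u(f)(z)=\int_0^z f(s)u'(s)\,ds$. $\varphi^n$ is the pointwise $n$-th power of $\varphi$; $g_0\equiv1$ and $g_n(z)=z^n$ for $n\ge1$. The essential norm of a continuous linear operator $T:X\to Y$ between Banach spaces is $\|T\|_e^{X\to Y}=\inf\{\|T-K\|^{X\to Y}: K:X\to Y \text{ compact linear operator}\}$, where $\|\cdot\|^{X\to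 Y}$ is the operator norm. *)

theory Defs
  imports "HOL-Complex_Analysis.Complex_Analysis"
begin

abbreviation unit_disk :: "complex set" where
  "unit_disk \<equiv> ball 0 1"

text \<open>
  A function on the disk is represented by the total function that agrees with it on the disk
  and is \<open>0\<close> elsewhere. With this convention, equality in HOL of elements of \<open>hol_disk\<close>
  is equality of functions on the disk.
\<close>

definition on_disk :: "(complex \<Rightarrow> complex) \<Rightarrow> complex \<Rightarrow> complex" where
  "on_disk f = (\<lambda>z. if z \<in> unit_disk then f z else 0)"

definition hol_disk :: "(complex \<Rightarrow> complex) set" where
  "hol_disk = {f. f holomorphic_on unit_disk \<and> (\<forall>z. z \<notin> unit_disk \<longrightarrow> f z = 0)}"

definition is_weight :: "(complex \<Rightarrow> real) \<Rightarrow> bool" where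
  "is_weight v \<longleftrightarrow>
     bounded (v ` unit_disk) \<and> continuous_on unit_disk v \<and> (\<forall>z\<in>unit_disk. 0 < v z)"

definition Hinf :: "(complex \<Rightarrow> real) \<Rightarrow> (complex \<Rightarrow> complex) set" where
  "Hinf v = {f \<in> hol_disk. bdd_above ((\<lambda>z. v z * cmod (f z)) ` unit_disk)}"

text \<open>
  The supremum below is taken in the reals, so that \<open>Hinf_norm v f\<close> is meaningful only for
  \<open>f \<in> Hinf v\<close>, and \<open>bloch_norm v f\<close> only for \<open>f \<in> bloch v\<close>.
\<close>

definition Hinf_norm :: "(complex \<Rightarrow> real) \<Rightarrow> (complex \<Rightarrow> complex) \<Rightarrow> real" where
  "Hinf_norm v f = (SUP z\<in>unit_disk. v z * cmod (f z))"

definition bloch :: "(complex \<Rightarrow> real) \<Rightarrow> (complex \<Rightarrow> complex) set" where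
  "bloch v = {f \<in> hol_disk. on_disk (deriv f) \<in> Hinf v}"

definition bloch_norm :: "(complex \<Rightarrow> real) \<Rightarrow> (complex \<Rightarrow> complex) \<Rightarrow> real" where
  "bloch_norm v f = cmod (f 0) + Hinf_norm v (on_disk (deriv f))"

text \<open>
  The locale \<open>Metric_space\<close> asks for symmetry and nonnegativity of the distance also outside
  of the carrier, which is why the distance is set to \<open>0\<close> there.
\<close>

definition bloch_dist ::
    "(complex \<Rightarrow> real) \<Rightarrow> (complex \<Rightarrow> complex) \<Rightarrow> (complex \<Rightarrow> complex) \<Rightarrow> real" where
  "bloch_dist v f g =
     (if f \<in> bloch v \<and> g \<in> bloch v then bloch_norm v (\<lambda>z. f z - g z) else 0)"

definition bloch_topology :: "(complex \<Rightarrow> real) \<Rightarrow> (complex \<Rightarrow> complex) topology" where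
  "bloch_topology v = Metric_space.mtopology (bloch v) (bloch_dist v)"

definition v_log :: "complex \<Rightarrow> real" where
  "v_log z = (1 - cmod z) * ln (2 / (1 - cmod z))"

definition w_log :: "complex \<Rightarrow> real" where
  "w_log z = inverse (ln (ln (4 / (1 - (cmod z)\<^sup>2))))"

text \<open>
  An operator is a map on all of \<open>complex \<Rightarrow> complex\<close> of which only the values on the
  domain \<open>bloch v\<close> matter.
\<close>

type_synonym operator = "(complex \<Rightarrow> complex) \<Rightarrow> (complex \<Rightarrow> complex)"

definition linear_operator :: "(complex \<Rightarrow> real) \<Rightarrow> (complex \<Rightarrow> real) \<Rightarrow> operator \<Rightarrow> bool" where
  "linear_operator v w T \<longleftrightarrow>
     (\<forall>f\<in>bloch v. T f \<in> bloch w) \<and>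
     (\<forall>f\<in>bloch v. \<forall>g\<in>bloch v. T (\<lambda>z. f z + g z) = (\<lambda>z. T f z + T g z)) \<and>
     (\<forall>c. \<forall>f\<in>bloch v. T (\<lambda>z. c * f z) = (\<lambda>z. c * T f z))"

definition continuous_linear_operator ::
    "(complex \<Rightarrow> real) \<Rightarrow> (complex \<Rightarrow> real) \<Rightarrow> operator \<Rightarrow> bool" where
  "continuous_linear_operator v w T \<longleftrightarrow>
     linear_operator v w T \<and> continuous_map (bloch_topology v) (bloch_topology w) T"

definition bloch_unit_ball :: "(complex \<Rightarrow> real) \<Rightarrow> (complex \<Rightarrow> complex) set" where
  "bloch_unit_ball v = {f \<in> bloch v. bloch_norm v f \<le> 1}"

definition compact_linear_operator ::
    "(complex \<Rightarrow> real) \<Rightarrow> (complex \<Rightarrow> real) \<Rightarrow> operator \<Rightarrow> bool" where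
  "compact_linear_operator v w T \<longleftrightarrow>
     linear_operator v w T \<and>
     compactin (bloch_topology w) (bloch_topology w closure_of (T ` bloch_unit_ball v))"

definition operator_norm ::
    "(complex \<Rightarrow> real) \<Rightarrow> (complex \<Rightarrow> real) \<Rightarrow> operator \<Rightarrow> real" where
  "operator_norm v w T = (SUP f\<in>bloch_unit_ball v. bloch_norm w (T f))"

definition essential_norm ::
    "(complex \<Rightarrow> real) \<Rightarrow> (complex \<Rightarrow> real) \<Rightarrow> operator \<Rightarrow> real" where
  "essential_norm v w T =
     Inf {operator_norm v w (\<lambda>f z. T f z - K f z) | K. compact_linear_operator v w K}"

definition W_op :: "(complex \<Rightarrow> complex) \<Rightarrow> (complex \<Rightarrow> complex) \<Rightarrow> operator" where
  "W_op u \<phi> f = on_disk (\<lambda>z. u z * f (\<phi> z))"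

definition I_op :: "(complex \<Rightarrow> complex) \<Rightarrow> operator" where
  "I_op u f = on_disk (\<lambda>z. contour_integral (linepath 0 z) (\<lambda>s. deriv f s * u s))"

definition J_op :: "(complex \<Rightarrow> complex) \<Rightarrow> operator" where
  "J_op u f = on_disk (\<lambda>z. contour_integral (linepath 0 z) (\<lambda>s. f s * deriv u s))"

definition monomial :: "nat \<Rightarrow> complex \<Rightarrow> complex" where
  "monomial n = on_disk (\<lambda>z. z ^ n)"

text \<open>
  If \<open>W_op u \<phi>\<close> maps \<open>bloch v_log\<close> into itself, then \<open>u\<close> and \<open>u \<cdot> \<phi>\<^sup>n\<close> lie in that space, hence
  so do \<open>J_op u (\<phi>\<^sup>n)\<close> and \<open>I_op u (\<phi>\<^sup>n)\<close>, and the norms below are meaningful. The limits superior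
  are taken in the extended reals.
\<close>

definition M_log :: "(complex \<Rightarrow> complex) \<Rightarrow> (complex \<Rightarrow> complex) \<Rightarrow> ereal" where
  "M_log u \<phi> = max
     (limsup (\<lambda>n. ereal (real (n + 1) * bloch_norm v_log (J_op u (\<lambda>z. \<phi> z ^ n))
                         / bloch_norm w_log (monomial (n + 1)))))
     (limsup (\<lambda>n. ereal (bloch_norm v_log (I_op u (\<lambda>z. \<phi> z ^ n))
                         / bloch_norm v_log (monomial n))))"

lemma is_weight_v_log: "is_weight v_log"
  unfolding is_weight_def
proof (intro conjI ballI)
  have rng: "0 < v_log z \<and> v_log z \<le> 2" if "z \<in> unit_disk" for z
  proof -
    define x where "x = 1 - cmod z"
    have x: "0 < x" "x \<le> 1"
      using that by (auto simp: x_def)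
    have "0 < ln (2 / x)"
      using x by (intro ln_gt_zero) (auto simp: field_simps)
    moreover have "ln (2 / x) \<le> 2 / x - 1"
      using x by (intro ln_le_minus_one) auto
    then have "x * ln (2 / x) \<le> x * (2 / x - 1)"
      using x by (intro mult_left_mono) auto
    moreover have "x * (2 / x - 1) = 2 - x"
      using x by (simp add: field_simps)
    ultimately show ?thesis
      using x by (auto simp: v_log_def x_def[symmetric])
  qed
  then show "bounded (v_log ` unit_disk)"
    unfolding bounded_iff by (intro exI[of _ 2]) fastforce
  show "0 < v_log z" if "z \<in> unit_disk" for z
    using rng[OF that] by simp
  show "continuous_on unit_disk v_log"
    unfolding v_log_def by (intro continuous_intros) auto
qed

lemma is_weight_w_log: "is_weight w_log"
  unfolding is_weight_def
proof (intro conjI ballI)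
  have e: "1 < ln (4::real)"
    using exp_le by (smt (verit) exp_less_cancel_iff exp_ln)
  have lower: "ln 4 \<le> ln (4 / (1 - (cmod z)\<^sup>2)) \<and> 0 < 1 - (cmod z)\<^sup>2" if "z \<in> unit_disk" for z
  proof -
    have "(cmod z)\<^sup>2 < 1"
      using that by (simp add: power_less_one_iff abs_square_less_1)
    then show ?thesis
      by (auto simp: field_simps)
  qed
  have low2: "0 < ln (ln (4::real)) \<and> ln (ln 4) \<le> ln (ln (4 / (1 - (cmod z)\<^sup>2)))"
    if "z \<in> unit_disk" for z
  proof
    show "0 < ln (ln (4::real))"
      using e by simp
    show "ln (ln 4) \<le> ln (ln (4 / (1 - (cmod z)\<^sup>2)))"
      using lower[OF that] e
      by (subst ln_le_cancel_iff) (linarith | blast)+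
  qed
  show pos: "0 < w_log z" if "z \<in> unit_disk" for z
    unfolding w_log_def using low2[OF that]
    by (intro positive_imp_inverse_positive) linarith
  have "w_log z \<le> inverse (ln (ln 4))" if "z \<in> unit_disk" for z
    using low2[OF that] unfolding w_log_def by (intro le_imp_inverse_le) blast+
  with pos show "bounded (w_log ` unit_disk)"
    unfolding bounded_iff by (intro exI[of _ "inverse (ln (ln 4))"]) fastforce
  show "continuous_on unit_disk w_log"
    unfolding w_log_def
  proof (intro continuous_intros ballI; (simp; fail)?)
    fix z assume z: "z \<in> unit_disk"
    show "1 - (cmod z)\<^sup>2 \<noteq> 0"
      using lower[OF z] by linarith
    show "4 / (1 - (cmod z)\<^sup>2) \<noteq> 0"
      using lower[OF z] by simp
    show "ln (4 / (1 - (cmod z)\<^sup>2)) \<noteq> 0"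
      using lower[OF z] e by linarith
    show "ln (ln (4 / (1 - (cmod z)\<^sup>2))) \<noteq> 0"
      using low2[OF z] by linarith
  qed
qed

lemma Metric_space_bloch:
  assumes "is_weight v"
  shows "Metric_space (bloch v) (bloch_dist v)"
proof -
  have vpos: "0 < v z" if "z \<in> unit_disk" for z
    using assms that by (simp add: is_weight_def)
  have dd: "deriv (\<lambda>z. f z - g z) z = deriv f z - deriv g z"
    if "f \<in> bloch v" "g \<in> bloch v" "z \<in> unit_disk" for f g z
    using that by (intro deriv_diff)
      (auto simp: bloch_def hol_disk_def intro: holomorphic_on_imp_differentiable_at[OF _ open_ball])
  define N where "N f g z = v z * cmod (deriv f z - deriv g z)" for f g z
  have bd: "bdd_above (N f g ` unit_disk)" if "f \<in> bloch v" "g \<in> bloch v" for f g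
  proof -
    from that obtain A B where
      A: "\<And>z. z \<in> unit_disk \<Longrightarrow> v z * cmod (deriv f z) \<le> A" and
      B: "\<And>z. z \<in> unit_disk \<Longrightarrow> v z * cmod (deriv g z) \<le> B"
      unfolding bloch_def Hinf_def bdd_above_def on_disk_def by fastforce
    have "N f g z \<le> A + B" if "z \<in> unit_disk" for z
    proof -
      have "N f g z \<le> v z * (cmod (deriv f z) + cmod (deriv g z))"
        unfolding N_def using vpos[OF that] by (intro mult_left_mono norm_triangle_ineq4) auto
      then show ?thesis
        using A[OF that] B[OF that] by (simp add: distrib_left)
    qed
    then show ?thesis
      by (intro bdd_aboveI2)
  qed
  have eq: "bloch_dist v f g = cmod (f 0 - g 0) + (SUP z\<in>unit_disk. N f g z)"
    if "f \<in> bloch v" "g \<in> bloch v" for f g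
    using that unfolding bloch_dist_def bloch_norm_def Hinf_norm_def N_def
    by (auto simp: on_disk_def dd intro!: SUP_cong)
  have N0: "0 \<le> N f g z" if "z \<in> unit_disk" for f g z
    using vpos[OF that] by (simp add: N_def)
  have S0: "0 \<le> (SUP z\<in>unit_disk. N f g z)" if "f \<in> bloch v" "g \<in> bloch v" for f g
    using N0[of 0] by (intro cSUP_upper2[OF bd[OF that], of 0]) auto
  show ?thesis
  proof
    show "0 \<le> bloch_dist v f g" for f g
    proof (cases "f \<in> bloch v \<and> g \<in> bloch v")
      case True
      then show ?thesis
        using eq S0 by auto
    qed (auto simp: bloch_dist_def)
    show "bloch_dist v f g = bloch_dist v g f" for f g
    proof (cases "f \<in> bloch v \<and> g \<in> bloch v")
      case True
      then show ?thesis
        by (simp add: eq N_def norm_minus_commute)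
    qed (auto simp: bloch_dist_def)
    show "bloch_dist v f g = 0 \<longleftrightarrow> f = g" if fg: "f \<in> bloch v" "g \<in> bloch v" for f g
    proof
      assume "bloch_dist v f g = 0"
      then have 0: "cmod (f 0 - g 0) = 0" and S: "(SUP z\<in>unit_disk. N f g z) = 0"
        using eq[OF fg] S0[OF fg] norm_ge_zero[of "f 0 - g 0"] by linarith+
      have dfg: "deriv f z = deriv g z" if z: "z \<in> unit_disk" for z
      proof -
        have "N f g z \<le> 0"
          using cSUP_upper[OF z bd[OF fg]] S by simp
        then show ?thesis
          using vpos[OF z] by (simp add: N_def mult_le_0_iff)
      qed
      have hd: "(h has_field_derivative deriv h z) (at z)"
        if "z \<in> unit_disk" "h \<in> bloch v" for h z
        using that by (auto simp: bloch_def hol_disk_def intro!: holomorphic_derivI[OF _ open_ball])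
      have "((\<lambda>z. f z - g z) has_field_derivative 0) (at z)"
        if "z \<in> unit_disk" for z
        using DERIV_diff[OF hd[OF that fg(1)] hd[OF that fg(2)]] dfg[OF that] by simp
      then have "(\<lambda>z. f z - g z) constant_on unit_disk"
        by (auto intro!: has_field_derivative_0_imp_constant_on)
      then have "f z = g z" if "z \<in> unit_disk" for z
        using that 0 unfolding constant_on_def by (metis centre_in_ball eq_iff_diff_eq_0 norm_eq_zero zero_less_one)
      then show "f = g"
        using fg by (intro ext) (metis (mono_tags, lifting) bloch_def hol_disk_def mem_Collect_eq)
    next
      assume "f = g"
      then show "bloch_dist v f g = 0"
        using eq[OF fg] by (simp add: N_def)
    qed
    show "bloch_dist v f h \<le> bloch_dist v f g + bloch_dist v g h"
      if fgh: "f \<in> bloch v" "g \<in> bloch v" "h \<in> bloch v" for f g h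
    proof -
      have "(SUP z\<in>unit_disk. N f h z) \<le> (SUP z\<in>unit_disk. N f g z) + (SUP z\<in>unit_disk. N g h z)"
      proof (rule cSUP_least)
        fix z :: complex assume z: "z \<in> unit_disk"
        have "N f h z \<le> v z * (cmod (deriv f z - deriv g z) + cmod (deriv g z - deriv h z))"
          unfolding N_def using vpos[OF z]
          by (intro mult_left_mono norm_diff_triangle_le[OF order_refl order_refl]) auto
        also have "\<dots> = N f g z + N g h z"
          by (simp add: N_def distrib_left)
        also have "\<dots> \<le> (SUP z\<in>unit_disk. N f g z) + (SUP z\<in>unit_disk. N g h z)"
          using fgh z by (intro add_mono cSUP_upper bd) auto
        finally show "N f h z \<le> (SUP z\<in>unit_disk. N f g z) + (SUP z\<in>unit_disk. N g h z)" .
      qed auto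
      moreover have "cmod (f 0 - h 0) \<le> cmod (f 0 - g 0) + cmod (g 0 - h 0)"
        by (metis dist_norm dist_triangle)
      ultimately show ?thesis
        using fgh by (simp add: eq)
    qed
  qed
qed

end

theory Submission
  imports Defs "HOL-Real_Asymp.Real_Asymp"
begin

text \<open>
Write \<open>v\<close> for the weight \<open>v_log\<close>, which is radial with profile \<open>log_weight\<close>, and \<open>\<Lambda>\<close> for the profile
\<open>loglog\<close>, so that \<open>w_log = 1/\<Lambda>\<close>. Since \<open>(u \<cdot> f \<circ> \<phi>)' = u' \<cdot> f \<circ> \<phi> + u \<cdot> \<phi>' \<cdot> f' \<circ> \<phi>\<close> and a function
of norm at most \<open>1\<close> satisfies \<open>|f| \<le> c \<Lambda>\<close> (integrate \<open>1/v\<close> along a radius) and \<open>|f'| \<le> 1/v\<close>, the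
operator is governed by the two quantities

  \<open>A(z) \<Lambda>(\<phi>(z))\<close> with \<open>A = v|u'|\<close>,  and  \<open>B(z) / v(\<phi>(z))\<close> with \<open>B = v|u \<phi>'|\<close>,

as \<open>|\<phi>(z)|\<close> tends to \<open>1\<close>. Both limits superior are compared with \<open>M_log\<close> and with the essential norm.

Link to \<open>M_log\<close>. The norms of \<open>J_u(\<phi>\<^sup>n)\<close> and \<open>I_u(\<phi>\<^sup>n)\<close> are the suprema of \<open>A |\<phi>|\<^sup>n\<close> and of
\<open>B n |\<phi>|\<^sup>n\<^sup>-\<^sup>1\<close>. A point with \<open>|\<phi>(z)| = a\<close> close to \<open>1\<close> is seen by the index \<open>n\<close> of size
\<open>1/(2(1-a))\<close>: there \<open>a\<^sup>n \<ge> 1/2\<close> and the norms of the monomials have the size of \<open>n/\<Lambda>(a)\<close>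
and \<open>n v(a)\<close> (lemmas \<open>boundary_J\<close> and \<open>boundary_I\<close>).

Upper bound. The operator \<open>f \<mapsto> W(f(r \<cdot>))\<close> with \<open>r < 1\<close> is compact by Montel's theorem. When \<open>r\<close> tends
to \<open>1\<close>, \<open>f - f(r \<cdot>)\<close> and its derivative tend to \<open>0\<close> uniformly on smaller disks, uniformly in the unit
ball, so only the points with \<open>|\<phi>(z)|\<close> near \<open>1\<close> contribute to the norm of the difference
(lemma \<open>essential_norm_upper\<close>).

Lower bound. A compact operator \<open>K\<close> is small on functions of the unit ball whose derivative is small on
a large disk and whose weighted derivative vanishes at the boundary (lemma \<open>compact_operator_small\<close>).
This is weak convergence to \<open>0\<close>, but it is obtained by hand: if it failed, sums of \<open>N\<close> such functions,
each living further out than the preceding ones, would stay bounded in norm while their images under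
\<open>K\<close> grow like \<open>N\<close>. So on such functions \<open>W\<close> is at most \<open>\<parallel>W - K\<parallel>\<close>, up to a small error. The normalised
monomials give the bound for \<open>I_u\<close>, because their values are negligible, and then
\<open>B \<le> c \<parallel>W - K\<parallel> v(\<phi>)\<close> near the boundary. With the second term under control, the bound for
\<open>A \<Lambda>(\<phi>)\<close> needs functions of bounded norm with a value of size \<open>\<Lambda>(a)\<close> at a given point \<open>a\<close>; squares of
the polynomials \<open>\<Sum>k\<le>N. z\<^sup>k / (k ln (k+1))\<close>, divided by their value at \<open>1\<close>, do this
(lemma \<open>test_functions\<close>), and nonnegative coefficients reduce all estimates to the real axis.
\<close>

section \<open>Weighted Bloch spaces and their operators\<close>

lemma weight_pos: "is_weight v \<Longrightarrow> z \<in> unit_disk \<Longrightarrow> 0 < v z"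
  by (simp add: is_weight_def)

lemma hol_disk_DERIV:
  "f \<in> hol_disk \<Longrightarrow> z \<in> unit_disk \<Longrightarrow> (f has_field_derivative deriv f z) (at z)"
  by (auto simp: hol_disk_def intro!: holomorphic_derivI[OF _ open_ball])

lemma bloch_imp_hol_disk: "f \<in> bloch v \<Longrightarrow> f \<in> hol_disk"
  by (simp add: bloch_def)

lemma on_disk_DERIV:
  assumes "z \<in> unit_disk" "(g has_field_derivative d) (at z)"
  shows "(on_disk g has_field_derivative d) (at z)"
  by (rule has_field_derivative_transform_within_open[OF assms(2) open_ball assms(1)])
     (simp add: on_disk_def)

lemma on_disk_hol_disk:
  assumes "g holomorphic_on unit_disk"
  shows "on_disk g \<in> hol_disk"
proof -
  have "on_disk g holomorphic_on unit_disk"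
    using assms by (rule holomorphic_transform) (simp add: on_disk_def)
  then show ?thesis
    by (auto simp: hol_disk_def on_disk_def)
qed

lemma hol_disk_diff: "f \<in> hol_disk \<Longrightarrow> g \<in> hol_disk \<Longrightarrow> (\<lambda>z. f z - g z) \<in> hol_disk"
  by (auto simp: hol_disk_def intro: holomorphic_intros)

lemma hol_disk_add: "f \<in> hol_disk \<Longrightarrow> g \<in> hol_disk \<Longrightarrow> (\<lambda>z. f z + g z) \<in> hol_disk"
  by (auto simp: hol_disk_def intro: holomorphic_intros)

lemma hol_disk_cmul: "f \<in> hol_disk \<Longrightarrow> (\<lambda>z. c * f z) \<in> hol_disk"
  by (auto simp: hol_disk_def intro: holomorphic_intros)

text \<open>
The supremum that defines the norm is handled only through the three facts \<open>blochI\<close>, \<open>bloch_norm_le\<close>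
and \<open>bloch_norm_ge\<close>: a pointwise bound gives membership and a norm bound, and conversely.
\<close>

lemma blochI:
  assumes "f \<in> hol_disk" "\<And>z. z \<in> unit_disk \<Longrightarrow> v z * cmod (deriv f z) \<le> B"
  shows "f \<in> bloch v"
proof -
  have "on_disk (deriv f) \<in> hol_disk"
    using assms(1) by (intro on_disk_hol_disk holomorphic_deriv) (auto simp: hol_disk_def)
  moreover have "bdd_above ((\<lambda>z. v z * cmod (on_disk (deriv f) z)) ` unit_disk)"
    using assms(2) by (intro bdd_aboveI2[of _ _ B]) (simp add: on_disk_def)
  ultimately show ?thesis
    using assms(1) by (simp add: bloch_def Hinf_def)
qed

lemma bloch_norm_le:
  assumes "\<And>z. z \<in> unit_disk \<Longrightarrow> v z * cmod (deriv f z) \<le> B"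
  shows "bloch_norm v f \<le> cmod (f 0) + B"
  unfolding bloch_norm_def Hinf_norm_def
  using assms by (intro add_left_mono cSUP_least) (auto simp: on_disk_def)

lemma bloch_norm_ge:
  assumes "f \<in> bloch v" "z \<in> unit_disk"
  shows "cmod (f 0) + v z * cmod (deriv f z) \<le> bloch_norm v f"
proof -
  have "v z * cmod (on_disk (deriv f) z) \<le> Hinf_norm v (on_disk (deriv f))"
    unfolding Hinf_norm_def using assms
    by (intro cSUP_upper) (auto simp: bloch_def Hinf_def)
  then show ?thesis
    using assms(2) by (simp add: bloch_norm_def on_disk_def)
qed

lemma bloch_norm_nonneg:
  assumes "is_weight v" "f \<in> bloch v"
  shows "0 \<le> bloch_norm v f"
proof -
  have "0 \<le> cmod (f 0) + v 0 * cmod (deriv f 0)"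
    using weight_pos[OF assms(1), of 0] by simp
  then show ?thesis
    using bloch_norm_ge[OF assms(2), of 0] by simp
qed

lemma bloch_norm_ge_deriv:
  assumes "f \<in> bloch v" "z \<in> unit_disk"
  shows "v z * cmod (deriv f z) \<le> bloch_norm v f"
  using bloch_norm_ge[OF assms] norm_ge_zero[of "f 0"] by linarith

lemma bloch_norm_ge_0:
  assumes "is_weight v" "f \<in> bloch v"
  shows "cmod (f 0) \<le> bloch_norm v f"
  using bloch_norm_ge[OF assms(2), of 0] weight_pos[OF assms(1), of 0]
  by (smt (verit) centre_in_ball mult_nonneg_nonneg norm_ge_zero)

lemma bloch_add:
  assumes "is_weight v" "f \<in> bloch v" "g \<in> bloch v"
  shows "(\<lambda>z. f z + g z) \<in> bloch v"
    and "bloch_norm v (\<lambda>z. f z + g z) \<le> bloch_norm v f + bloch_norm v g"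
proof -
  have *: "v z * cmod (deriv (\<lambda>z. f z + g z) z)
      \<le> (bloch_norm v f - cmod (f 0)) + (bloch_norm v g - cmod (g 0))" if z: "z \<in> unit_disk" for z
  proof -
    have "deriv (\<lambda>z. f z + g z) z = deriv f z + deriv g z"
      using assms z by (intro DERIV_imp_deriv DERIV_add hol_disk_DERIV bloch_imp_hol_disk)
    then have "v z * cmod (deriv (\<lambda>z. f z + g z) z) \<le> v z * (cmod (deriv f z) + cmod (deriv g z))"
      using weight_pos[OF assms(1) z] by (simp add: norm_triangle_ineq)
    then show ?thesis
      using bloch_norm_ge[OF assms(2) z] bloch_norm_ge[OF assms(3) z] by (simp add: distrib_left)
  qed
  show "(\<lambda>z. f z + g z) \<in> bloch v"
    using assms * by (intro blochI[OF _ *] hol_disk_add bloch_imp_hol_disk)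
  show "bloch_norm v (\<lambda>z. f z + g z) \<le> bloch_norm v f + bloch_norm v g"
    using bloch_norm_le[OF *] norm_triangle_ineq[of "f 0" "g 0"] by simp
qed

lemma bloch_cmul:
  assumes "is_weight v" "f \<in> bloch v"
  shows "(\<lambda>z. c * f z) \<in> bloch v"
    and "bloch_norm v (\<lambda>z. c * f z) = cmod c * bloch_norm v f"
proof -
  have d: "deriv (\<lambda>z. c * f z) z = c * deriv f z" if f: "f \<in> bloch v" and z: "z \<in> unit_disk" for z c f
    using f z by (intro DERIV_imp_deriv DERIV_cmult hol_disk_DERIV bloch_imp_hol_disk)
  have *: "v z * cmod (deriv (\<lambda>z. c * f z) z) \<le> cmod c * (bloch_norm v f - cmod (f 0))"
    if z: "z \<in> unit_disk" and f: "f \<in> bloch v" for z c f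
  proof -
    have "cmod c * (cmod (f 0) + v z * cmod (deriv f z)) \<le> cmod c * bloch_norm v f"
      by (intro mult_left_mono bloch_norm_ge f z) auto
    then show ?thesis
      by (simp add: d[OF f z] norm_mult algebra_simps)
  qed
  have mem: "(\<lambda>z. c * f z) \<in> bloch v" if "f \<in> bloch v" for c f
    using assms that by (intro blochI[OF _ *] hol_disk_cmul bloch_imp_hol_disk)
  then show "(\<lambda>z. c * f z) \<in> bloch v"
    using assms by blast
  have le: "bloch_norm v (\<lambda>z. c * f z) \<le> cmod c * bloch_norm v f" if "f \<in> bloch v" for c f
    using bloch_norm_le[of v "\<lambda>z. c * f z", OF *[OF _ that]] by (simp add: norm_mult algebra_simps)
  show "bloch_norm v (\<lambda>z. c * f z) = cmod c * bloch_norm v f"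
  proof (cases "c = 0")
    case True
    then show ?thesis
      using le[OF assms(2), of c] bloch_norm_nonneg[OF assms(1) mem[OF assms(2), of c]] by simp
  next
    case False
    have "bloch_norm v (\<lambda>z. inverse c * (c * f z)) \<le> cmod (inverse c) * bloch_norm v (\<lambda>z. c * f z)"
      by (rule le[OF mem[OF assms(2)]])
    moreover have "(\<lambda>z. inverse c * (c * f z)) = f"
      using False by auto
    ultimately have "cmod c * bloch_norm v f \<le> bloch_norm v (\<lambda>z. c * f z)"
      using False by (simp add: norm_inverse norm_divide field_simps)
    then show ?thesis
      using le[OF assms(2), of c] by linarith
  qed
qed

lemma bloch_diff:
  assumes "is_weight v" "f \<in> bloch v" "g \<in> bloch v"
  shows "(\<lambda>z. f z - g z) \<in> bloch v"
    and "bloch_norm v (\<lambda>z. f z - g z) \<le> bloch_norm v f + bloch_norm v g"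
proof -
  have "(\<lambda>z. f z + (-1) * g z) \<in> bloch v"
    using assms by (intro bloch_add bloch_cmul)
  then show "(\<lambda>z. f z - g z) \<in> bloch v"
    by simp
  have "bloch_norm v (\<lambda>z. f z + (-1) * g z) \<le> bloch_norm v f + bloch_norm v (\<lambda>z. (-1) * g z)"
    using assms by (intro bloch_add bloch_cmul)
  then show "bloch_norm v (\<lambda>z. f z - g z) \<le> bloch_norm v f + bloch_norm v g"
    using bloch_cmul(2)[OF assms(1,3), of "-1"] by simp
qed

lemma bloch_zero:
  assumes "is_weight v"
  shows "(\<lambda>z. 0) \<in> bloch v" "bloch_norm v (\<lambda>z. 0) = 0"
proof -
  have "(\<lambda>z. 0) \<in> bloch v"
    by (rule blochI[where B=0]) (auto simp: hol_disk_def)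
  then show "(\<lambda>z. 0) \<in> bloch v" "bloch_norm v (\<lambda>z. 0) = 0"
    using bloch_cmul(2)[OF assms, of "\<lambda>z. 0" 0] by auto
qed

lemma bloch_dist_eq: "f \<in> bloch v \<Longrightarrow> g \<in> bloch v \<Longrightarrow> bloch_dist v f g = bloch_norm v (\<lambda>z. f z - g z)"
  by (simp add: bloch_dist_def)

lemma bloch_topology_limitin:
  assumes "is_weight v" "f \<in> bloch v" "\<And>n. F n \<in> bloch v"
    and "\<And>\<epsilon>. \<epsilon> > 0 \<Longrightarrow> \<exists>N. \<forall>n\<ge>N. bloch_norm v (\<lambda>z. F n z - f z) < \<epsilon>"
  shows "limitin (bloch_topology v) F f sequentially"
  using assms unfolding bloch_topology_def
  by (simp add: Metric_space.limit_metric_sequentially[OF Metric_space_bloch] bloch_dist_eq)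

text \<open>
\<open>operator_norm\<close> is a supremum in the reals and means nothing unless the set is bounded. Continuity
and compactness each imply this condition.
\<close>

definition bounded_operator :: "(complex \<Rightarrow> real) \<Rightarrow> operator \<Rightarrow> bool" where
  "bounded_operator v T \<longleftrightarrow> linear_operator v v T \<and>
     (\<exists>C. \<forall>f\<in>bloch_unit_ball v. bloch_norm v (T f) \<le> C)"

lemma linear_operator_zero:
  assumes "is_weight v" "linear_operator v v T"
  shows "T (\<lambda>z. 0) = (\<lambda>z. 0)"
proof -
  have "T (\<lambda>z. 0 * 0) = (\<lambda>z. 0 * T (\<lambda>z. 0) z)"
    using assms(2) bloch_zero(1)[OF assms(1)] unfolding linear_operator_def
    by (elim conjE allE[of _ 0] ballE[of _ _ "\<lambda>z. 0"]) auto
  then show ?thesis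
    by simp
qed

lemma linear_operator_sub:
  assumes "is_weight v" "linear_operator v v T" "linear_operator v v K"
  shows "linear_operator v v (\<lambda>f z. T f z - K f z)"
  using assms bloch_diff(1)[OF assms(1)]
  unfolding linear_operator_def by (auto simp: algebra_simps fun_eq_iff)

text \<open>
Continuity at \<open>0\<close> with tolerance \<open>1\<close> gives a radius \<open>\<delta>\<close>; rescaling the unit ball by \<open>\<delta>/2\<close> gives the
bound \<open>2/\<delta>\<close>.
\<close>

lemma continuous_imp_bounded_operator:
  assumes v: "is_weight v" and T: "continuous_linear_operator v v T"
  shows "bounded_operator v T"
proof -
  have lin: "linear_operator v v T"
    using T by (simp add: continuous_linear_operator_def)
  have z0: "(\<lambda>z. 0) \<in> bloch v"
    by (rule bloch_zero(1)[OF v])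
  have "\<forall>a\<in>bloch v. \<forall>\<epsilon>>0. \<exists>\<delta>>0. \<forall>x. x \<in> bloch v \<and> bloch_dist v a x < \<delta> \<longrightarrow> bloch_dist v (T a) (T x) < \<epsilon>"
    using T Metric_space.metric_continuous_map[OF Metric_space_bloch[OF v] Metric_space_bloch[OF v], of T]
    unfolding continuous_linear_operator_def bloch_topology_def by blast
  then obtain \<delta> where \<delta>: "\<delta> > 0" and
    *: "\<And>x. x \<in> bloch v \<Longrightarrow> bloch_dist v (\<lambda>z. 0) x < \<delta> \<Longrightarrow> bloch_dist v (T (\<lambda>z. 0)) (T x) < 1"
    using z0 zero_less_one by blast
  have "bloch_norm v (T f) \<le> 2 / \<delta>" if f: "f \<in> bloch_unit_ball v" for f
  proof -
    have fb: "f \<in> bloch v" "bloch_norm v f \<le> 1"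
      using f by (auto simp: bloch_unit_ball_def)
    define c :: complex where "c = of_real (\<delta> / 2)"
    have c: "cmod c = \<delta> / 2"
      using \<delta> by (simp add: c_def norm_of_real)
    have cf: "(\<lambda>z. c * f z) \<in> bloch v" "bloch_norm v (\<lambda>z. c * f z) = \<delta> / 2 * bloch_norm v f"
      using bloch_cmul[OF v fb(1), of c] by (auto simp: c)
    have Tf: "T f \<in> bloch v" and Tcf: "T (\<lambda>z. c * f z) = (\<lambda>z. c * T f z)"
      using lin fb unfolding linear_operator_def by auto
    have neg: "bloch_norm v (\<lambda>z. - g z) = bloch_norm v g" if "g \<in> bloch v" for g
      using bloch_cmul(2)[OF v that, of "-1"] by simp
    have "bloch_dist v (\<lambda>z. 0) (\<lambda>z. c * f z) = \<delta> / 2 * bloch_norm v f"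
      using cf z0 neg[OF cf(1)] by (simp add: bloch_dist_eq)
    also have "\<dots> \<le> \<delta> / 2 * 1"
      using fb \<delta> by (intro mult_left_mono) auto
    finally have "bloch_dist v (\<lambda>z. 0) (\<lambda>z. c * f z) < \<delta>"
      using \<delta> by simp
    from *[OF cf(1) this] have "bloch_dist v (\<lambda>z. 0) (\<lambda>z. c * T f z) < 1"
      by (simp add: Tcf linear_operator_zero[OF v lin])
    moreover have "bloch_dist v (\<lambda>z. 0) (\<lambda>z. c * T f z) = \<delta> / 2 * bloch_norm v (T f)"
      using z0 bloch_cmul[OF v Tf, of c] neg[of "\<lambda>z. c * T f z"] by (simp add: bloch_dist_eq c)
    ultimately show ?thesis
      using \<delta> by (simp add: field_simps)
  qed
  then show ?thesis
    using lin unfolding bounded_operator_def by blast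
qed

lemma compact_imp_bounded_operator:
  assumes v: "is_weight v" and K: "compact_linear_operator v v K"
  shows "bounded_operator v K"
proof -
  interpret Metric_space "bloch v" "bloch_dist v"
    by (rule Metric_space_bloch[OF v])
  have lin: "linear_operator v v K"
    using K by (simp add: compact_linear_operator_def)
  have KM: "K ` bloch_unit_ball v \<subseteq> bloch v"
    using lin by (auto simp: linear_operator_def bloch_unit_ball_def)
  have "compactin mtopology (mtopology closure_of (K ` bloch_unit_ball v))"
    using K by (simp add: compact_linear_operator_def bloch_topology_def)
  then have "mbounded (mtopology closure_of (K ` bloch_unit_ball v))"
    by (rule compactin_imp_mbounded)
  then have "mbounded (K ` bloch_unit_ball v)"
    by (rule mbounded_subset) (simp add: KM closure_of_subset)
  then obtain B where B: "\<And>x y. x \<in> K ` bloch_unit_ball v \<Longrightarrow> y \<in> K ` bloch_unit_ball v \<Longrightarrow> bloch_dist v x y \<le> B"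
    unfolding mbounded_alt by blast
  have "K (\<lambda>z. 0) \<in> K ` bloch_unit_ball v"
    using bloch_zero[OF v] by (simp add: bloch_unit_ball_def)
  then have B0: "bloch_dist v (\<lambda>z. 0) (K f) \<le> B" if "f \<in> bloch_unit_ball v" for f
    using B that linear_operator_zero[OF v lin] by auto
  have "bloch_norm v (K f) \<le> B" if "f \<in> bloch_unit_ball v" for f
  proof -
    have "K f \<in> bloch v"
      using that KM by blast
    then have "bloch_dist v (K f) (\<lambda>z. 0) = bloch_norm v (K f)"
      using bloch_zero[OF v] by (simp add: bloch_dist_eq)
    then show ?thesis
      using B0[OF that] by (simp add: commute)
  qed
  then show ?thesis
    using lin unfolding bounded_operator_def by blast
qed

lemma bounded_operator_sub:
  assumes v: "is_weight v" and T: "bounded_operator v T" and K: "bounded_operator v K"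
  shows "bounded_operator v (\<lambda>f z. T f z - K f z)"
proof -
  obtain C D where CD: "\<And>f. f\<in>bloch_unit_ball v \<Longrightarrow> bloch_norm v (T f) \<le> C"
      "\<And>f. f\<in>bloch_unit_ball v \<Longrightarrow> bloch_norm v (K f) \<le> D"
    using T K by (auto simp: bounded_operator_def)
  have "bloch_norm v (\<lambda>z. T f z - K f z) \<le> C + D" if "f \<in> bloch_unit_ball v" for f
  proof -
    have "T f \<in> bloch v" "K f \<in> bloch v"
      using that T K by (auto simp: bounded_operator_def linear_operator_def bloch_unit_ball_def)
    then show ?thesis
      using bloch_diff(2)[OF v, of "T f" "K f"] CD[OF that] by linarith
  qed
  then show ?thesis
    using T K linear_operator_sub[OF v] unfolding bounded_operator_def by blast
qed

lemma operator_norm_upper: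
  assumes v: "is_weight v" and T: "bounded_operator v T" and f: "f \<in> bloch v"
  shows "bloch_norm v (T f) \<le> operator_norm v v T * bloch_norm v f"
proof (cases "bloch_norm v f = 0")
  case True
  have "bloch_dist v f (\<lambda>z. 0) = 0"
    using True f bloch_zero[OF v] by (simp add: bloch_dist_eq)
  then have "f = (\<lambda>z. 0)"
    using Metric_space.zero[OF Metric_space_bloch[OF v] f bloch_zero(1)[OF v]] by simp
  then have "T f = (\<lambda>z. 0)"
    using T linear_operator_zero[OF v] by (simp add: bounded_operator_def)
  then show ?thesis
    using True bloch_zero[OF v] by simp
next
  case False
  then have n: "bloch_norm v f > 0"
    using bloch_norm_nonneg[OF v f] by simp
  define c :: complex where "c = of_real (inverse (bloch_norm v f))"
  have c: "cmod c = inverse (bloch_norm v f)"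
    using n by (simp add: c_def norm_of_real del: of_real_inverse)
  have "(\<lambda>z. c * f z) \<in> bloch_unit_ball v"
    using bloch_cmul[OF v f, of c] n by (simp add: bloch_unit_ball_def c)
  then have "bloch_norm v (T (\<lambda>z. c * f z)) \<le> operator_norm v v T"
    unfolding operator_norm_def using T
    by (intro cSUP_upper) (auto simp: bounded_operator_def bdd_above_def)
  moreover have "T (\<lambda>z. c * f z) = (\<lambda>z. c * T f z)" "T f \<in> bloch v"
    using T f by (auto simp: bounded_operator_def linear_operator_def)
  ultimately have "inverse (bloch_norm v f) * bloch_norm v (T f) \<le> operator_norm v v T"
    using bloch_cmul(2)[OF v, of "T f" c] by (simp add: c)
  then show ?thesis
    using n by (simp add: field_simps)
qed

lemma operator_norm_nonneg:
  assumes v: "is_weight v" and T: "bounded_operator v T"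
  shows "0 \<le> operator_norm v v T"
proof -
  have "bloch_norm v (T (\<lambda>z. 0)) \<le> operator_norm v v T"
    unfolding operator_norm_def using T bloch_zero[OF v]
    by (intro cSUP_upper) (auto simp: bounded_operator_def bdd_above_def bloch_unit_ball_def)
  then show ?thesis
    using linear_operator_zero[OF v] T bloch_zero[OF v] by (simp add: bounded_operator_def)
qed

lemma operator_norm_le:
  assumes v: "is_weight v" and "\<And>f. f \<in> bloch_unit_ball v \<Longrightarrow> bloch_norm v (T f) \<le> C"
  shows "operator_norm v v T \<le> C"
proof -
  have "bloch_unit_ball v \<noteq> {}"
    using bloch_zero[OF v] by (auto simp: bloch_unit_ball_def)
  then show ?thesis
    unfolding operator_norm_def using assms(2) by (intro cSUP_least) auto
qed

text \<open>
Boundedness of \<open>T\<close> enters because the infimum in the reals needs a lower bound: it makes all the norms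
\<open>\<parallel>T - K\<parallel>\<close> genuine suprema, hence nonnegative.
\<close>

lemma essential_norm_le:
  assumes v: "is_weight v" and T: "bounded_operator v T" and K: "compact_linear_operator v v K"
  shows "essential_norm v v T \<le> operator_norm v v (\<lambda>f z. T f z - K f z)"
  unfolding essential_norm_def
proof (rule cInf_lower)
  show "bdd_below {operator_norm v v (\<lambda>f z. T f z - K f z) |K. compact_linear_operator v v K}"
    using operator_norm_nonneg[OF v] bounded_operator_sub[OF v T] compact_imp_bounded_operator[OF v]
    by (intro bdd_belowI[of _ 0]) auto
qed (use K in auto)

section \<open>The logarithmic weights\<close>

definition log_weight :: "real \<Rightarrow> real" where
  "log_weight r = (1 - r) * ln (2 / (1 - r))"

definition loglog :: "real \<Rightarrow> real" where
  "loglog r = ln (ln (4 / (1 - r\<^sup>2)))"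

lemma v_log_eq: "v_log z = log_weight (cmod z)"
  by (simp add: v_log_def log_weight_def)

lemma w_log_eq: "w_log z = inverse (loglog (cmod z))"
  by (simp add: w_log_def loglog_def)

lemma ln4_gt_1: "1 < ln (4::real)"
  using exp_le by (smt (verit) exp_less_cancel_iff exp_ln)

lemma loglog_mono:
  assumes "0 \<le> r" "r \<le> s" "s < 1"
  shows "loglog r \<le> loglog s"
proof -
  have r2: "r\<^sup>2 \<le> s\<^sup>2" "s\<^sup>2 < 1"
    using assms by (auto simp: power_mono abs_square_less_1)
  then have "4 \<le> 4 / (1 - r\<^sup>2)" "4 / (1 - r\<^sup>2) \<le> 4 / (1 - s\<^sup>2)"
    by (auto simp: field_simps)
  then have "ln 4 \<le> ln (4 / (1 - r\<^sup>2)) \<and> ln (4 / (1 - r\<^sup>2)) \<le> ln (4 / (1 - s\<^sup>2))"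
    by (intro conjI ln_mono) linarith+
  then show ?thesis
    unfolding loglog_def using ln4_gt_1 by (subst ln_le_cancel_iff) linarith+
qed

lemma lnln4_pos: "0 < ln (ln (4::real))"
  using ln4_gt_1 by simp

lemma loglog_ge:
  assumes "0 \<le> r" "r < 1"
  shows "ln (ln 4) \<le> loglog r"
  using loglog_mono[of 0 r] assms by (simp add: loglog_def)

lemma loglog_pos:
  assumes "0 \<le> r" "r < 1"
  shows "0 < loglog r"
  using loglog_ge[OF assms] lnln4_pos by linarith

lemma log_weight_ge:
  assumes "0 \<le> r" "r < 1"
  shows "(1 - r) / 2 \<le> log_weight r"
proof -
  have "1 / 2 \<le> ln (2::real)"
    using ln2_ge_two_thirds by simp
  also have "ln 2 \<le> ln (2 / (1 - r))"
    using assms by (simp add: field_simps)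
  finally have "(1 - r) * (1 / 2) \<le> (1 - r) * ln (2 / (1 - r))"
    using assms by (intro mult_left_mono) auto
  then show ?thesis
    by (simp add: log_weight_def)
qed

lemma log_weight_pos:
  assumes "0 \<le> r" "r < 1"
  shows "0 < log_weight r"
  using log_weight_ge[OF assms] assms by (smt (verit) half_gt_zero)

text \<open>
\<open>x ln (2/x)\<close> is increasing only up to \<open>x = 2/e < 1\<close>; a constant absorbs the rest. Here \<open>ln (2/x)\<close> is
split as \<open>ln (2/y) + ln (y/x)\<close> with \<open>y = 1 - s\<close>, and \<open>x ln (y/x) \<le> y - x\<close>.
\<close>

lemma log_weight_almost_decreasing:
  assumes "0 \<le> s" "s \<le> r" "r < 1"
  shows "log_weight r \<le> 3 * log_weight s"
proof -
  have "ln (2 / (1 - r)) = ln (2 / (1 - s)) + ln ((1 - s) / (1 - r))"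
    using assms by (simp add: ln_div)
  also have "ln ((1 - s) / (1 - r)) \<le> (1 - s) / (1 - r) - 1"
    using assms by (intro ln_le_minus_one) auto
  finally have "(1 - r) * ln (2 / (1 - r)) \<le> (1 - r) * (ln (2 / (1 - s)) + ((1 - s) / (1 - r) - 1))"
    using assms by (intro mult_left_mono) auto
  also have "\<dots> = (1 - r) * ln (2 / (1 - s)) + ((1 - s) - (1 - r))"
    using assms by (simp add: field_simps)
  also have "\<dots> \<le> (1 - s) * ln (2 / (1 - s)) + (1 - s)"
    using assms by (intro add_mono mult_right_mono) (auto simp: field_simps)
  also have "\<dots> \<le> 3 * log_weight s"
    using log_weight_ge[of s] assms by (simp add: log_weight_def)
  finally show ?thesis
    by (simp add: log_weight_def)
qed

lemma ln_le_2_sqrt: "0 < x \<Longrightarrow> ln x \<le> 2 * sqrt (x::real)"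
  using ln_le_minus_one[of "sqrt x"] by (simp add: ln_sqrt)

lemma log_weight_le_sqrt:
  assumes "r < 1"
  shows "log_weight r \<le> 4 * sqrt (1 - r)"
proof -
  have "log_weight r \<le> (1 - r) * (2 * sqrt (2 / (1 - r)))"
    unfolding log_weight_def using assms by (intro mult_left_mono ln_le_2_sqrt) auto
  also have "\<dots> = 2 * sqrt 2 * ((1 - r) / sqrt (1 - r))"
    by (simp add: real_sqrt_divide)
  also have "(1 - r) / sqrt (1 - r) = sqrt (1 - r)"
    using assms by (intro real_div_sqrt) simp
  also have "2 * sqrt 2 * sqrt (1 - r) \<le> 4 * sqrt (1 - r)"
    using sqrt2_less_2 assms by (intro mult_right_mono) auto
  finally show ?thesis .
qed

lemma log_weight_small:
  assumes "0 < e"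
  obtains s where "0 < s" "s < 1" "\<And>r. s < r \<Longrightarrow> r < 1 \<Longrightarrow> log_weight r \<le> e"
proof
  define d where "d = min (1/2) ((e / 4)\<^sup>2)"
  have d: "0 < d" "d \<le> 1 / 2" "d \<le> (e / 4)\<^sup>2"
    using assms by (auto simp: d_def)
  show "0 < 1 - d" "1 - d < 1"
    using d by auto
  show "log_weight r \<le> e" if "1 - d < r" "r < 1" for r
  proof -
    have "sqrt (1 - r) \<le> sqrt ((e / 4)\<^sup>2)"
      using that d by (intro real_sqrt_le_mono) linarith
    then show ?thesis
      using log_weight_le_sqrt[of r] that assms by simp
  qed
qed

section \<open>Growth of functions in the logarithmic Bloch space\<close>

definition pt_const :: real where
  "pt_const = 1 + (1 - ln (ln 2)) / ln (ln 4)"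

lemma pt_const_ge_1: "1 \<le> pt_const"
proof -
  have "ln (2::real) \<le> 1"
    using ln_le_minus_one[of "2::real"] by simp
  then have "ln (ln (2::real)) \<le> 0"
    by (simp add: ln_le_zero_iff)
  then have "0 \<le> (1 - ln (ln 2)) / ln (ln (4::real))"
    using lnln4_pos by (intro divide_nonneg_nonneg) linarith+
  then show ?thesis
    by (simp add: pt_const_def)
qed

text \<open>
On the radius through \<open>z\<close> the derivative is at most \<open>N / v\<close>, and \<open>ln (ln (2/(1-t)))\<close> is a primitive of
the profile of \<open>1/v\<close>. The additive constants are absorbed by \<open>pt_const\<close>, since \<open>loglog\<close> is at least
\<open>ln (ln 4) > 0\<close>.
\<close>

lemma bloch_point_evaluation:
  assumes f: "f \<in> bloch v_log" and z: "z \<in> unit_disk"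
  shows "cmod (f z) \<le> pt_const * loglog (cmod z) * bloch_norm v_log f"
proof -
  define N where "N = bloch_norm v_log f - cmod (f 0)"
  have N: "v_log w * cmod (deriv f w) \<le> N" if "w \<in> unit_disk" for w
    using bloch_norm_ge[OF f that] by (simp add: N_def)
  have N0: "0 \<le> N" "N \<le> bloch_norm v_log f"
    using bloch_norm_ge_0[OF is_weight_v_log f] by (auto simp: N_def)
  have z1: "cmod z < 1"
    using z by simp
  define \<rho> where "\<rho> = cmod z"
  have \<rho>: "0 \<le> \<rho>" "\<rho> < 1"
    using z1 by (auto simp: \<rho>_def)
  have tD: "of_real t * z \<in> unit_disk" if "0 \<le> t" "t \<le> 1" for t
  proof -
    have "cmod (of_real t * z) \<le> 1 * cmod z"
      using that by (simp add: norm_mult mult_left_le_one_le)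
    then show ?thesis
      using z1 by simp
  qed
  define G where "G t = N * ln (ln (2 / (1 - t * \<rho>)))" for t
  have x: "0 < 1 - t * \<rho>" "0 < ln (2 / (1 - t * \<rho>))" if "0 \<le> t" "t \<le> 1" for t
  proof -
    have "t * \<rho> \<le> \<rho>"
      using that \<rho> by (simp add: mult_left_le_one_le)
    then show "0 < 1 - t * \<rho>"
      using \<rho> by linarith
    moreover have "0 \<le> t * \<rho>"
      using that \<rho> by simp
    ultimately show "0 < ln (2 / (1 - t * \<rho>))"
      by (simp add: field_simps)
  qed
  have "norm (f (of_real 1 * z) - f (of_real 0 * z)) \<le> G 1 - G 0"
  proof (rule differentiable_bound_general[where f = "\<lambda>t. f (of_real t * z)" and \<phi> = G
        and f' = "\<lambda>t. deriv f (of_real t * z) * z"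
        and \<phi>' = "\<lambda>t. N * (\<rho> / (log_weight (t * \<rho>)))"])
    have fd: "((\<lambda>t. f (of_real t * z)) has_vector_derivative deriv f (of_real t * z) * z) (at t)"
      if "0 \<le> t" "t \<le> 1" for t
    proof -
      have "((\<lambda>w. f (w * z)) has_field_derivative deriv f (of_real t * z) * z) (at (of_real t))"
        by (rule DERIV_chain2[where f = f and g = "\<lambda>w. w * z",
              OF hol_disk_DERIV[OF bloch_imp_hol_disk[OF f] tD[OF that]]])
           (auto intro!: derivative_eq_intros)
      then show ?thesis
        by (rule has_vector_derivative_real_field)
    qed
    then show "((\<lambda>t. f (of_real t * z)) has_vector_derivative deriv f (of_real t * z) * z) (at t)"
      if "0 < t" "t < 1" for t
      using that by simp
    show "continuous_on {0..1} (\<lambda>t. f (of_real t * z))"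
      using fd by (intro continuous_at_imp_continuous_on ballI) (auto intro: has_vector_derivative_continuous)
    have Gd: "(G has_vector_derivative N * (\<rho> / (log_weight (t * \<rho>)))) (at t)" if "0 \<le> t" "t \<le> 1" for t
    proof -
      define q where "q = 1 - t * \<rho>"
      have q: "0 < q" "0 < ln (2 / q)"
        using x[OF that] by (auto simp: q_def)
      have "((\<lambda>t. 2 / (1 - t * \<rho>)) has_real_derivative 2 * \<rho> / (q * q)) (at t)"
        using q by (auto intro!: derivative_eq_intros simp: q_def)
      then have "((\<lambda>t. ln (ln (2 / (1 - t * \<rho>)))) has_real_derivative
          inverse (ln (2 / q)) * (inverse (2 / q) * (2 * \<rho> / (q * q)))) (at t)"
        using q unfolding q_def by (intro DERIV_chain2[OF DERIV_ln] DERIV_chain2[of ln]) (auto intro: DERIV_ln)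
      moreover have "inverse (ln (2 / q)) * (inverse (2 / q) * (2 * \<rho> / (q * q))) = \<rho> / log_weight (t * \<rho>)"
        using q unfolding log_weight_def q_def[symmetric] by (simp add: divide_simps)
      ultimately show ?thesis
        unfolding has_real_derivative_iff_has_vector_derivative[symmetric] G_def
        by (intro DERIV_cmult) simp
    qed
    then show "(G has_vector_derivative N * (\<rho> / (log_weight (t * \<rho>)))) (at t)" if "0 < t" "t < 1" for t
      using that by simp
    show "continuous_on {0..1} G"
      using Gd by (intro continuous_at_imp_continuous_on ballI) (auto intro: has_vector_derivative_continuous)
    show "norm (deriv f (of_real t * z) * z) \<le> N * (\<rho> / (log_weight (t * \<rho>)))" if "0 < t" "t < 1" for t
    proof -
      have "log_weight (t * \<rho>) * cmod (deriv f (of_real t * z)) \<le> N"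
        using N[OF tD[of t]] that by (simp add: v_log_eq norm_mult \<rho>_def)
      moreover have "0 < log_weight (t * \<rho>)"
        using x[of t] that \<rho> by (intro log_weight_pos) auto
      ultimately have "cmod (deriv f (of_real t * z)) \<le> N / log_weight (t * \<rho>)"
        by (simp add: field_simps)
      then have "cmod (deriv f (of_real t * z)) * \<rho> \<le> N / log_weight (t * \<rho>) * \<rho>"
        using \<rho> by (intro mult_right_mono) auto
      then show ?thesis
        by (simp add: norm_mult \<rho>_def)
    qed
  qed simp
  then have d: "cmod (f z - f 0) \<le> N * (ln (ln (2 / (1 - \<rho>))) - ln (ln 2))"
    by (simp add: G_def algebra_simps)
  have ll: "ln (ln (2 / (1 - \<rho>))) \<le> loglog \<rho>"
  proof -
    have a: "2 / (1 - \<rho>) \<le> 4 / (1 - \<rho>\<^sup>2)"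
    proof -
      have "1 - \<rho>\<^sup>2 = (1 - \<rho>) * (1 + \<rho>)"
        by (simp add: power2_eq_square algebra_simps)
      then have "4 / (1 - \<rho>\<^sup>2) = 2 / (1 - \<rho>) * (2 / (1 + \<rho>))"
        by simp
      moreover have "1 \<le> 2 / (1 + \<rho>)"
        using \<rho> by (simp add: field_simps)
      then have "2 / (1 - \<rho>) * 1 \<le> 2 / (1 - \<rho>) * (2 / (1 + \<rho>))"
        using \<rho> by (intro mult_left_mono) auto
      ultimately show ?thesis
        by simp
    qed
    then have "ln (2 / (1 - \<rho>)) \<le> ln (4 / (1 - \<rho>\<^sup>2))"
      using \<rho> by (intro ln_mono) auto
    then show ?thesis
      unfolding loglog_def using x(2)[of 1] by (intro ln_mono[of "ln (2 / (1 - \<rho>))"]) auto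
  qed
  have l2: "ln (ln (2::real)) \<le> 0"
    using ln_le_minus_one[of "2::real"] by (simp add: ln_le_zero_iff)
  define X where "X = loglog \<rho>"
  have X: "ln (ln 4) \<le> X"
    using loglog_ge \<rho> by (simp add: X_def)
  have "cmod (f z) \<le> cmod (f 0) + N * (X - ln (ln 2))"
  proof -
    have "N * (ln (ln (2 / (1 - \<rho>))) - ln (ln 2)) \<le> N * (X - ln (ln 2))"
      using ll N0 by (intro mult_left_mono) (auto simp: X_def)
    then show ?thesis
      using d norm_triangle_ineq2[of "f z" "f 0"] by linarith
  qed
  also have "\<dots> \<le> bloch_norm v_log f * 1 + bloch_norm v_log f * (X - ln (ln 2))"
    using N0 X lnln4_pos l2 bloch_norm_ge_0[OF is_weight_v_log f]
    by (intro add_mono mult_right_mono) linarith+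
  also have "\<dots> = bloch_norm v_log f * (X + (1 - ln (ln 2)) * 1)"
    by (simp add: algebra_simps)
  also have "\<dots> \<le> bloch_norm v_log f * (X + (1 - ln (ln 2)) * (X / ln (ln 4)))"
  proof -
    have "1 \<le> X / ln (ln 4)"
      using X lnln4_pos by simp
    then show ?thesis
      using l2 bloch_norm_nonneg[OF is_weight_v_log f]
      by (intro mult_left_mono add_left_mono) linarith+
  qed
  also have "\<dots> = pt_const * X * bloch_norm v_log f"
    by (simp add: pt_const_def algebra_simps)
  finally show ?thesis
    by (simp add: X_def \<rho>_def)
qed

lemma bloch_deriv_bound:
  assumes f: "f \<in> bloch v_log" and z: "z \<in> unit_disk"
  shows "cmod (deriv f z) \<le> bloch_norm v_log f / log_weight (cmod z)"
  using bloch_norm_ge_deriv[OF f z] log_weight_pos[of "cmod z"] z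
  by (simp add: v_log_eq field_simps)

lemma bloch_deriv_bound_simple:
  assumes f: "f \<in> bloch v_log" and z: "cmod z \<le> s" and s: "s < 1"
  shows "cmod (deriv f z) \<le> 2 * bloch_norm v_log f / (1 - s)"
proof -
  have "cmod (deriv f z) \<le> bloch_norm v_log f / log_weight (cmod z)"
    using z s by (intro bloch_deriv_bound[OF f]) auto
  also have "\<dots> \<le> bloch_norm v_log f / ((1 - s) / 2)"
    using log_weight_ge[of "cmod z"] z s bloch_norm_nonneg[OF is_weight_v_log f]
    by (intro divide_left_mono mult_pos_pos log_weight_pos) auto
  finally show ?thesis
    by (simp add: mult.commute)
qed

lemma Cauchy_deriv_bound:
  assumes h: "h \<in> hol_disk" and s: "0 \<le> s" "s < 1"
    and b: "\<And>w. cmod w \<le> (1 + s) / 2 \<Longrightarrow> cmod (h w) \<le> B" and w: "cmod w \<le> s"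
  shows "cmod (deriv h w) \<le> 2 * B / (1 - s)"
proof -
  define r where "r = (1 - s) / 2"
  have r: "0 < r"
    using s by (simp add: r_def)
  have in_D: "cmod x \<le> (1 + s) / 2" if "x \<in> cball w r" for x
  proof -
    have "cmod x \<le> cmod w + cmod (w - x)"
      by (metis norm_minus_commute norm_triangle_sub)
    then show ?thesis
      using that w by (simp add: r_def dist_norm field_simps)
  qed
  have sub: "cball w r \<subseteq> unit_disk"
    using in_D s by fastforce
  have hol: "h holomorphic_on unit_disk"
    using h by (simp add: hol_disk_def)
  have "cmod ((deriv ^^ 1) h w) \<le> fact 1 * B / r ^ 1"
  proof (rule Cauchy_inequality[OF _ _ r])
    show "h holomorphic_on ball w r"
      using hol sub ball_subset_cball by (meson holomorphic_on_subset subset_trans)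
    show "continuous_on (cball w r) h"
      using hol sub by (meson holomorphic_on_imp_continuous_on holomorphic_on_subset)
    show "cmod (h x) \<le> B" if "cmod (w - x) = r" for x
      using that by (intro b in_D) (simp add: dist_norm)
  qed
  then show ?thesis
    by (simp add: r_def field_simps)
qed

section \<open>Derivatives of the operators\<close>

text \<open>
On the convex disk the line integrals in \<open>I_op\<close> and \<open>J_op\<close> are differences of a primitive, so these
functions vanish at \<open>0\<close> and have the integrand as derivative.
\<close>

lemma contour_primitive:
  assumes F: "F holomorphic_on unit_disk"
  defines "P \<equiv> on_disk (\<lambda>z. contour_integral (linepath 0 z) F)"
  shows "P \<in> hol_disk" "P 0 = 0" "z \<in> unit_disk \<Longrightarrow> deriv P z = F z"
proof -
  obtain g where g: "\<And>x. x \<in> unit_disk \<Longrightarrow> (g has_field_derivative F x) (at x within unit_disk)"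
    using holomorphic_convex_primitive'[OF _ _ F] by auto
  have g': "(g has_field_derivative F x) (at x)" if "x \<in> unit_disk" for x
    using g[OF that] by (simp only: at_within_open[OF that open_ball])
  have "contour_integral (linepath 0 z) F = g z - g 0" if z: "z \<in> unit_disk" for z
  proof -
    have "closed_segment 0 z \<subseteq> unit_disk"
      using z by (intro closed_segment_subset) auto
    then show ?thesis
      using contour_integral_unique[OF contour_integral_primitive[OF g, of "linepath 0 z"]] by simp
  qed
  then have P: "P = on_disk (\<lambda>z. g z - g 0)"
    unfolding P_def on_disk_def by (intro ext) (simp del: mem_ball)
  show "P 0 = 0"
    by (simp add: P on_disk_def)
  have "g holomorphic_on unit_disk"
    unfolding holomorphic_on_open[OF open_ball] using g' by blast
  then show "P \<in> hol_disk"
    unfolding P by (intro on_disk_hol_disk holomorphic_intros)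
  show "deriv P z = F z" if "z \<in> unit_disk"
    unfolding P using that
    by (intro DERIV_imp_deriv on_disk_DERIV) (auto intro!: derivative_eq_intros g')
qed

lemma W_op_deriv:
  assumes u: "u holomorphic_on unit_disk" and \<phi>: "\<phi> holomorphic_on unit_disk" "\<phi> ` unit_disk \<subseteq> unit_disk"
    and h: "h \<in> hol_disk"
  shows "W_op u \<phi> h \<in> hol_disk"
    and "z \<in> unit_disk \<Longrightarrow>
      deriv (W_op u \<phi> h) z = deriv u z * h (\<phi> z) + u z * (deriv \<phi> z * deriv h (\<phi> z))"
proof -
  have "(h \<circ> \<phi>) holomorphic_on unit_disk"
    using h \<phi>(2) by (intro holomorphic_on_compose_gen[OF \<phi>(1)]) (auto simp: hol_disk_def)
  then show "W_op u \<phi> h \<in> hol_disk"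
    unfolding W_op_def by (intro on_disk_hol_disk holomorphic_intros u) (simp add: o_def)
  show "deriv (W_op u \<phi> h) z = deriv u z * h (\<phi> z) + u z * (deriv \<phi> z * deriv h (\<phi> z))"
    if z: "z \<in> unit_disk"
  proof -
    have du: "(u has_field_derivative deriv u z) (at z)"
      and dp: "(\<phi> has_field_derivative deriv \<phi> z) (at z)"
      using u \<phi> z by (auto intro!: holomorphic_derivI[OF _ open_ball])
    have "((\<lambda>z. h (\<phi> z)) has_field_derivative deriv h (\<phi> z) * deriv \<phi> z) (at z)"
      using \<phi>(2) z by (intro DERIV_chain2[OF hol_disk_DERIV[OF h] dp]) blast
    from DERIV_mult[OF du this] show ?thesis
      unfolding W_op_def using z
      by (intro DERIV_imp_deriv on_disk_DERIV) (auto simp: algebra_simps)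
  qed
qed

lemma monomial_deriv:
  shows "monomial n \<in> hol_disk" "z \<in> unit_disk \<Longrightarrow> deriv (monomial n) z = of_nat n * z ^ (n - 1)"
  unfolding monomial_def
  by (intro on_disk_hol_disk holomorphic_intros)
     (intro DERIV_imp_deriv on_disk_DERIV, auto intro!: derivative_eq_intros)

section \<open>Norms of the monomials\<close>

text \<open>
\<open>r\<^sup>n\<close> is the least of the powers \<open>r\<^sup>0, \<dots>, r\<^sup>n\<close>, whose sum is at most \<open>1/(1-r)\<close>. This replaces
the calculus of the maximum of \<open>r\<^sup>n (1-r)\<close>.
\<close>

lemma power_mean_le:
  fixes r :: real
  assumes "0 \<le> r" "r \<le> 1"
  shows "real (n + 1) * r ^ n * (1 - r) \<le> 1"
proof -
  have "real (n + 1) * r ^ n = (\<Sum>k<n+1. r ^ n)"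
    by simp
  also have "\<dots> \<le> (\<Sum>k<n+1. r ^ k)"
    using assms by (intro sum_mono power_decreasing) auto
  finally have "real (n + 1) * r ^ n * (1 - r) \<le> (\<Sum>k<n+1. r ^ k) * (1 - r)"
    using assms by (intro mult_right_mono) auto
  also have "\<dots> = 1 - r ^ (n + 1)"
    using one_diff_power_eq[of r "n + 1"] by (simp add: mult.commute)
  also have "\<dots> \<le> 1"
    using assms by simp
  finally show ?thesis .
qed

text \<open>
With \<open>X = 4/(1-r\<^sup>2)\<close> and \<open>y = (n+1)(1-r\<^sup>2)\<close> the argument \<open>8(n+1)\<close> is \<open>2Xy\<close>, so the iterated
logarithm exceeds \<open>ln (ln X)\<close> by at most \<open>2y\<close>, and \<open>r\<^sup>n y\<close> is bounded. This gives the upper bound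
for the \<open>w_log\<close> norm of \<open>z\<^sup>n\<^sup>+\<^sup>1\<close> without locating the maximum.
\<close>

lemma loglog_moment:
  assumes "0 \<le> r" "r < 1"
  shows "r ^ n * ln (ln (8 * real (n + 1))) \<le> (1 + 4 / ln (ln 4)) * loglog r"
proof -
  define X where "X = 4 / (1 - r\<^sup>2)"
  define y where "y = real (n + 1) * (1 - r\<^sup>2)"
  have r2: "0 \<le> r\<^sup>2" "r\<^sup>2 < 1"
    using assms by (auto simp: abs_square_less_1)
  have X: "4 \<le> X"
    using r2 by (auto simp: X_def field_simps)
  have y: "0 < y"
    unfolding y_def using r2 by (intro mult_pos_pos) auto
  have lX: "1 \<le> ln X"
    using X ln4_gt_1 ln_mono[of 4 X] by linarith
  have "8 * real (n + 1) = X * (2 * y)"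
    using r2 by (simp add: X_def y_def)
  then have "ln (8 * real (n + 1)) = ln X + ln (2 * y)"
    using X y by (simp add: ln_mult)
  also have "\<dots> \<le> ln X * (1 + 2 * y)"
  proof -
    have "ln (2 * y) \<le> 2 * y"
      using ln_le_minus_one[of "2 * y"] y by simp
    also have "1 * (2 * y) \<le> ln X * (2 * y)"
      using lX y by (intro mult_right_mono) auto
    finally show ?thesis
      by (simp add: distrib_left)
  qed
  finally have 1: "ln (8 * real (n + 1)) \<le> ln X * (1 + 2 * y)" .
  have "0 < ln (8 * real (n + 1))"
    by (intro ln_gt_zero) simp
  then have "ln (ln (8 * real (n + 1))) \<le> ln (ln X * (1 + 2 * y))"
    using 1 by (intro ln_mono) auto
  also have "\<dots> = ln (ln X) + ln (1 + 2 * y)"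
    using lX y by (simp add: ln_mult)
  also have "\<dots> \<le> loglog r + 2 * y"
    using ln_add_one_self_le_self[of "2 * y"] y by (simp add: loglog_def X_def)
  finally have "r ^ n * ln (ln (8 * real (n + 1))) \<le> r ^ n * (loglog r + 2 * y)"
    using assms by (intro mult_left_mono) auto
  also have "\<dots> = r ^ n * loglog r + 2 * (real (n + 1) * r ^ n * (1 - r)) * (1 + r)"
    by (simp add: y_def power2_eq_square algebra_simps)
  also have "\<dots> \<le> 1 * loglog r + 2 * 1 * 2"
    using assms loglog_pos[OF assms] power_mean_le[of r n]
    by (intro add_mono mult_right_mono mult_mono power_le_one) auto
  also have "\<dots> \<le> (1 + 4 / ln (ln 4)) * loglog r"
    using loglog_ge[OF assms] lnln4_pos by (simp add: field_simps)
  finally show ?thesis .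
qed

text \<open>
The same device for \<open>v_log\<close>: \<open>ln (2/y)\<close> exceeds \<open>ln (4n)\<close> by at most \<open>1/(2ny)\<close>, where \<open>y = 1 - r\<close>.
\<close>

lemma log_weight_moment:
  assumes "0 \<le> r" "r < 1" "1 \<le> n"
  shows "real n * r ^ (n - 1) * log_weight r \<le> 2 * ln (4 * real n)"
proof -
  define y where "y = 1 - r"
  have y: "0 < y" "y \<le> 1"
    using assms by (auto simp: y_def)
  have n: "real n \<ge> 1"
    using assms by simp
  have "ln (2 / y) = ln (4 * real n) + ln (1 / (2 * real n * y))"
  proof -
    have "2 / y = (4 * real n) * (1 / (2 * real n * y))"
      using y n by (simp add: field_simps)
    then show ?thesis
      using ln_mult[of "4 * real n" "1 / (2 * real n * y)"] y n by simp
  qed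
  also have "\<dots> \<le> ln (4 * real n) + 1 / (2 * real n * y)"
    using ln_le_minus_one[of "1 / (2 * real n * y)"] y n by simp
  finally have l: "ln (2 / y) \<le> ln (4 * real n) + 1 / (2 * real n * y)" .
  have l4: "1 \<le> ln (4 * real n)"
    using ln4_gt_1 ln_mono[of 4 "4 * real n"] n by linarith
  have "real n * r ^ (n - 1) * log_weight r
      \<le> real n * r ^ (n - 1) * (y * (ln (4 * real n) + 1 / (2 * real n * y)))"
    unfolding log_weight_def y_def[symmetric] using l y assms by (intro mult_left_mono) auto
  also have "\<dots> = (real n * r ^ (n - 1) * y) * ln (4 * real n) + r ^ (n - 1) * (1 / 2)"
    using y n by (simp add: field_simps)
  also have "\<dots> \<le> 1 * ln (4 * real n) + 1 * (1 / 2)"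
    using power_mean_le[of r "n - 1"] assms l4
    by (intro add_mono mult_right_mono power_le_one) (auto simp: y_def)
  also have "\<dots> \<le> 2 * ln (4 * real n)"
    using l4 by simp
  finally show ?thesis .
qed

text \<open>
The index \<open>n = \<lfloor>1/(2(1-a))\<rfloor>\<close> that sees a point of modulus \<open>a\<close>. The factor \<open>2\<close> makes \<open>a\<^sup>n \<ge> 1/2\<close> an
instance of Bernoulli's inequality.
\<close>

lemma scale_near_1:
  fixes a :: real
  assumes "a < 1" "1 - a \<le> 1 / (2 * real (N + 1))"
  obtains n where "N < n" "2 * real n * (1 - a) \<le> 1" "1 < 2 * real (n + 1) * (1 - a)"
proof
  define n where "n = nat \<lfloor>1 / (2 * (1 - a))\<rfloor>"
  have pos: "0 < 1 / (2 * (1 - a))"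
    using assms by simp
  have n: "real n \<le> 1 / (2 * (1 - a))" "1 / (2 * (1 - a)) < real (n + 1)"
    using pos unfolding n_def by linarith+
  show "2 * real n * (1 - a) \<le> 1" "1 < 2 * real (n + 1) * (1 - a)"
    using n assms by (simp_all add: field_simps)
  have "real (N + 1) \<le> 1 / (2 * (1 - a))"
    using assms by (simp add: field_simps)
  then have "real (N + 1) < real (n + 1)"
    using n by linarith
  then show "N < n"
    by simp
qed

lemma power_ge_half:
  fixes a :: real
  assumes "0 \<le> a" "2 * real n * (1 - a) \<le> 1"
  shows "1 / 2 \<le> a ^ n"
  using Bernoulli_inequality[of "a - 1" n] assms by (simp add: algebra_simps)

lemma loglog_le_scale:
  assumes "0 \<le> a" "a < 1" "1 < 2 * real (n + 1) * (1 - a)"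
  shows "loglog a \<le> ln (ln (8 * real (n + 1)))"
proof -
  have a2: "a\<^sup>2 < 1"
    using assms by (simp add: abs_square_less_1)
  have "(1 - a) * 1 \<le> (1 - a) * (1 + a)"
    using assms by (intro mult_left_mono) auto
  then have "1 - a \<le> 1 - a\<^sup>2"
    by (simp add: power2_eq_square algebra_simps)
  then have "2 * real (n + 1) * (1 - a) \<le> 2 * real (n + 1) * (1 - a\<^sup>2)"
    by (intro mult_left_mono) auto
  then have "1 \<le> 2 * real (n + 1) * (1 - a\<^sup>2)"
    using assms by linarith
  then have "4 / (1 - a\<^sup>2) \<le> 8 * real (n + 1)"
    using a2 by (simp add: field_simps)
  moreover have "4 \<le> 4 / (1 - a\<^sup>2)"
    using a2 by (simp add: field_simps)
  ultimately have "ln 4 \<le> ln (4 / (1 - a\<^sup>2)) \<and> ln (4 / (1 - a\<^sup>2)) \<le> ln (8 * real (n + 1))"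
    by (intro conjI ln_mono) linarith+
  then show ?thesis
    unfolding loglog_def using ln4_gt_1
    by (subst ln_le_cancel_iff) linarith+
qed

lemma log_weight_ge_scale:
  assumes "0 \<le> a" "a < 1" "1 \<le> n" "2 * real n * (1 - a) \<le> 1" "1 < 2 * real (n + 1) * (1 - a)"
  shows "ln (4 * real n) \<le> 4 * real n * log_weight a"
proof -
  have "4 * real n \<le> 2 / (1 - a)"
    using assms by (simp add: field_simps)
  then have l: "ln (4 * real n) \<le> ln (2 / (1 - a))"
    using assms by (intro ln_mono) auto
  have "2 * real (n + 1) * (1 - a) \<le> 4 * real n * (1 - a)"
    using assms by (intro mult_right_mono) auto
  then have "1 \<le> 4 * real n * (1 - a)"
    using assms by linarith
  then have "1 * ln (4 * real n) \<le> 4 * real n * (1 - a) * ln (2 / (1 - a))"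
    using l assms by (intro mult_mono) auto
  then show ?thesis
    by (simp add: log_weight_def mult.assoc)
qed

lemma bloch_v_logI_bounded:
  assumes "f \<in> hol_disk" "\<And>z. z \<in> unit_disk \<Longrightarrow> cmod (deriv f z) \<le> C"
  shows "f \<in> bloch v_log"
proof (rule blochI[OF assms(1)])
  fix z :: complex assume z: "z \<in> unit_disk"
  have "sqrt (1 - cmod z) \<le> 1"
    by simp
  moreover have "log_weight (cmod z) \<le> 4 * sqrt (1 - cmod z)"
    using z by (intro log_weight_le_sqrt) simp
  ultimately have "v_log z \<le> 4"
    unfolding v_log_eq by linarith
  then show "v_log z * cmod (deriv f z) \<le> 4 * C"
    using assms(2)[OF z] weight_pos[OF is_weight_v_log z] by (intro mult_mono) auto
qed

lemma monomial_0: "monomial n 0 = (if n = 0 then 1 else 0)"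
  by (simp add: monomial_def on_disk_def)

lemma norm_monomial_deriv:
  "z \<in> unit_disk \<Longrightarrow> cmod (deriv (monomial n) z) = real n * cmod z ^ (n - 1)"
  by (simp add: monomial_deriv norm_mult norm_power)

lemma monomial_bloch: "monomial n \<in> bloch v_log"
proof (rule bloch_v_logI_bounded[OF monomial_deriv(1)])
  fix z :: complex assume z: "z \<in> unit_disk"
  have "cmod z ^ (n - 1) \<le> 1"
    using z by (intro power_le_one) auto
  then have "real n * cmod z ^ (n - 1) \<le> real n * 1"
    by (intro mult_left_mono) auto
  then show "cmod (deriv (monomial n) z) \<le> real n"
    using norm_monomial_deriv[OF z] by simp
qed

lemma monomial_norm_v_ge:
  assumes "0 \<le> r" "r < 1"
  shows "real n * r ^ (n - 1) * log_weight r \<le> bloch_norm v_log (monomial n)"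
  using bloch_norm_ge_deriv[OF monomial_bloch, of "of_real r" n] assms
  by (simp add: norm_monomial_deriv v_log_eq mult_ac)

lemma monomial_norm_v_le:
  assumes "1 \<le> n"
  shows "bloch_norm v_log (monomial n) \<le> 2 * ln (4 * real n)"
proof -
  have "bloch_norm v_log (monomial n) \<le> cmod (monomial n 0) + 2 * ln (4 * real n)"
  proof (rule bloch_norm_le)
    fix z :: complex assume z: "z \<in> unit_disk"
    show "v_log z * cmod (deriv (monomial n) z) \<le> 2 * ln (4 * real n)"
      using log_weight_moment[of "cmod z" n] z assms
      by (simp add: norm_monomial_deriv v_log_eq mult_ac)
  qed
  then show ?thesis
    using assms by (simp add: monomial_0)
qed

lemma monomial_norm_v_pos:
  assumes "1 \<le> n"
  shows "0 < bloch_norm v_log (monomial n)"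
proof -
  have "0 < real n * (1 / 2) ^ (n - 1) * log_weight (1 / 2)"
    using assms log_weight_pos[of "1 / 2"] by simp
  then show ?thesis
    using monomial_norm_v_ge[of "1 / 2" n] by linarith
qed

text \<open>
Evaluate at \<open>r = 1 - 1/(2n)\<close>. Only the divergence of the norms matters: it makes the values of the
normalised monomials tend to \<open>0\<close> uniformly on the disk.
\<close>

lemma monomial_norm_v_ge_ln:
  assumes "1 \<le> n"
  shows "ln (4 * real n) / 4 \<le> bloch_norm v_log (monomial n)"
proof -
  define r where "r = 1 - 1 / (2 * real n)"
  have r: "0 \<le> r" "r < 1" "2 * real n * (1 - r) = 1"
    using assms by (auto simp: r_def field_simps)
  have "1 / 2 \<le> r ^ n"
    using r by (intro power_ge_half) auto
  also have "r ^ n \<le> r ^ (n - 1)"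
    using r by (intro power_decreasing) auto
  finally have h: "1 / 2 \<le> r ^ (n - 1)" .
  have "ln (4 * real n) / 4 = real n * (1 / 2) * log_weight r"
    using assms by (simp add: log_weight_def r_def field_simps)
  also have "\<dots> \<le> real n * r ^ (n - 1) * log_weight r"
    using h log_weight_pos[OF r(1,2)] by (intro mult_right_mono mult_left_mono) auto
  also have "\<dots> \<le> bloch_norm v_log (monomial n)"
    by (rule monomial_norm_v_ge[OF r(1,2)])
  finally show ?thesis .
qed

lemma monomial_bloch_w: "monomial n \<in> bloch w_log"
proof (rule blochI[OF monomial_deriv(1)])
  fix z :: complex assume z: "z \<in> unit_disk"
  have "cmod z ^ (n - 1) \<le> 1"
    using z by (intro power_le_one) auto
  then have "real n * cmod z ^ (n - 1) \<le> real n * 1"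
    by (intro mult_left_mono) auto
  moreover have "w_log z \<le> inverse (ln (ln 4))"
    unfolding w_log_eq using z lnln4_pos by (intro le_imp_inverse_le loglog_ge) auto
  ultimately show "w_log z * cmod (deriv (monomial n) z) \<le> inverse (ln (ln 4)) * real n"
    using norm_monomial_deriv[OF z] lnln4_pos by (intro mult_mono) auto
qed

lemma monomial_norm_w_ge:
  assumes "0 \<le> r" "r < 1"
  shows "real (n + 1) * r ^ n / loglog r \<le> bloch_norm w_log (monomial (n + 1))"
  using bloch_norm_ge_deriv[OF monomial_bloch_w, of "of_real r" "n + 1"] assms
  by (simp add: norm_monomial_deriv[of _ "Suc n"] w_log_eq divide_inverse mult_ac del: of_nat_Suc)

lemma monomial_norm_w_le:
  shows "bloch_norm w_log (monomial (n + 1))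
    \<le> real (n + 1) * (1 + 4 / ln (ln 4)) / ln (ln (8 * real (n + 1)))"
proof -
  define C :: real where "C = 1 + 4 / ln (ln 4)"
  define l where "l = ln (ln (8 * real (n + 1)))"
  have "ln (4::real) \<le> ln (8 * real (n + 1))"
    by (intro ln_mono) auto
  then have l: "0 < l"
    unfolding l_def using ln4_gt_1 by (intro ln_gt_zero) linarith
  have "bloch_norm w_log (monomial (n + 1)) \<le> cmod (monomial (n + 1) 0) + real (n + 1) * C / l"
  proof (rule bloch_norm_le)
    fix z :: complex assume z: "z \<in> unit_disk"
    have p: "0 < loglog (cmod z)"
      using z by (intro loglog_pos) auto
    have "cmod z ^ n * l \<le> C * loglog (cmod z)"
      unfolding l_def C_def using z by (intro loglog_moment) auto
    then have "cmod z ^ n / loglog (cmod z) \<le> C / l"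
      using p l by (simp add: field_simps)
    then have "real (n + 1) * (cmod z ^ n / loglog (cmod z)) \<le> real (n + 1) * (C / l)"
      by (intro mult_left_mono) auto
    then show "w_log z * cmod (deriv (monomial (n + 1)) z) \<le> real (n + 1) * C / l"
      using z by (simp add: norm_monomial_deriv w_log_eq divide_inverse mult_ac del: of_nat_Suc)
  qed
  then show ?thesis
    by (simp add: monomial_0 C_def l_def)
qed

lemma monomial_norm_w_pos: "0 < bloch_norm w_log (monomial (n + 1))"
proof -
  have "0 < real (n + 1) * (1 / 2) ^ n / loglog (1 / 2)"
    using loglog_pos[of "1 / 2"] by simp
  then show ?thesis
    using monomial_norm_w_ge[of "1 / 2" n] by linarith
qed

section \<open>Boundary behaviour of the symbols\<close>

locale weighted_composition =
  fixes u \<phi> :: "complex \<Rightarrow> complex"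
  assumes u_hol: "u holomorphic_on unit_disk"
    and \<phi>_hol: "\<phi> holomorphic_on unit_disk"
    and \<phi>_img: "\<phi> ` unit_disk \<subseteq> unit_disk"
    and W_bounded: "bounded_operator v_log (W_op u \<phi>)"
begin

text \<open>
In \<open>v |(W f)'|\<close> the coefficient of \<open>f \<circ> \<phi>\<close> is \<open>A\<close> and that of \<open>f' \<circ> \<phi>\<close> is \<open>B\<close>.
\<close>

definition A where "A z = v_log z * cmod (deriv u z)"
definition B where "B z = v_log z * cmod (u z * deriv \<phi> z)"

lemma \<phi>_disk: "z \<in> unit_disk \<Longrightarrow> cmod (\<phi> z) < 1"
  using \<phi>_img by (metis image_subset_iff mem_ball_0)

lemma A_nonneg: "z \<in> unit_disk \<Longrightarrow> 0 \<le> A z" and B_nonneg: "z \<in> unit_disk \<Longrightarrow> 0 \<le> B z"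
  using weight_pos[OF is_weight_v_log, of z] by (simp_all add: A_def B_def)

lemma W_bloch: "f \<in> bloch v_log \<Longrightarrow> W_op u \<phi> f \<in> bloch v_log"
  using W_bounded by (simp add: bounded_operator_def linear_operator_def)

lemmas W_deriv = W_op_deriv[OF u_hol \<phi>_hol \<phi>_img]

text \<open>
Apply the operator to \<open>1\<close> and to \<open>z\<close>: the images \<open>u\<close> and \<open>u \<phi>\<close> lie in the space.
\<close>

lemma AB_bounded: "\<exists>C>0. \<forall>z\<in>unit_disk. A z \<le> C \<and> B z \<le> C"
proof -
  define N where "N k = bloch_norm v_log (W_op u \<phi> (monomial k))" for k
  have N: "v_log z * cmod (deriv (W_op u \<phi> (monomial k)) z) \<le> N k" if "z \<in> unit_disk" for z k
    unfolding N_def by (intro bloch_norm_ge_deriv W_bloch monomial_bloch that)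
  have A: "A z \<le> N 0" if z: "z \<in> unit_disk" for z
    using N[OF z, of 0] \<phi>_disk[OF z] W_deriv(2)[OF monomial_deriv(1) z, of 0]
      monomial_deriv(2)[of "\<phi> z" 0]
    by (simp add: A_def monomial_def on_disk_def)
  have B: "B z \<le> N 1 + N 0" if z: "z \<in> unit_disk" for z
  proof -
    have d: "deriv (W_op u \<phi> (monomial 1)) z = deriv u z * \<phi> z + u z * deriv \<phi> z"
      using \<phi>_disk[OF z] W_deriv(2)[OF monomial_deriv(1) z, of 1] monomial_deriv(2)[of "\<phi> z" 1]
      by (simp add: monomial_def on_disk_def)
    have "cmod (u z * deriv \<phi> z) \<le> cmod (deriv u z * \<phi> z + u z * deriv \<phi> z) + cmod (deriv u z * \<phi> z)"
      by (metis add_diff_cancel_left' norm_triangle_ineq4)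
    also have "cmod (deriv u z * \<phi> z) \<le> cmod (deriv u z)"
      using \<phi>_disk[OF z] by (simp add: norm_mult mult_right_le_one_le)
    finally have "v_log z * cmod (u z * deriv \<phi> z)
        \<le> v_log z * (cmod (deriv u z * \<phi> z + u z * deriv \<phi> z) + cmod (deriv u z))"
      using weight_pos[OF is_weight_v_log z] by simp
    then show ?thesis
      using N[OF z, of 1, unfolded d] A[OF z] by (simp add: A_def B_def distrib_left)
  qed
  have N0: "0 \<le> N k" for k
    unfolding N_def by (intro bloch_norm_nonneg is_weight_v_log W_bloch monomial_bloch)
  show ?thesis
  proof (intro exI[of _ "N 0 + N 1 + 1"] conjI ballI)
    show "0 < N 0 + N 1 + 1"
      using N0[of 0] N0[of 1] by linarith
    fix z assume z: "z \<in> unit_disk"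
    show "A z \<le> N 0 + N 1 + 1" "B z \<le> N 0 + N 1 + 1"
      using A[OF z] B[OF z] N0[of 0] N0[of 1] by linarith+
  qed
qed

lemma W_deriv_le:
  assumes h: "h \<in> hol_disk" and z: "z \<in> unit_disk"
  shows "v_log z * cmod (deriv (W_op u \<phi> h) z) \<le> A z * cmod (h (\<phi> z)) + B z * cmod (deriv h (\<phi> z))"
proof -
  have "cmod (deriv (W_op u \<phi> h) z)
      \<le> cmod (deriv u z) * cmod (h (\<phi> z)) + cmod (u z * deriv \<phi> z) * cmod (deriv h (\<phi> z))"
    unfolding W_deriv(2)[OF h z] using norm_triangle_ineq by (simp add: norm_mult[symmetric] mult.assoc)
  then have "v_log z * cmod (deriv (W_op u \<phi> h) z)
      \<le> v_log z * (cmod (deriv u z) * cmod (h (\<phi> z)) + cmod (u z * deriv \<phi> z) * cmod (deriv h (\<phi> z)))"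
    using weight_pos[OF is_weight_v_log z] by simp
  then show ?thesis
    by (simp add: A_def B_def algebra_simps)
qed

lemma J_norm:
  shows "z \<in> unit_disk \<Longrightarrow> A z * cmod (\<phi> z) ^ n \<le> bloch_norm v_log (J_op u (\<lambda>z. \<phi> z ^ n))"
    and "(\<And>z. z \<in> unit_disk \<Longrightarrow> A z * cmod (\<phi> z) ^ n \<le> c) \<Longrightarrow> bloch_norm v_log (J_op u (\<lambda>z. \<phi> z ^ n)) \<le> c"
proof -
  have hol: "(\<lambda>z. \<phi> z ^ n * deriv u z) holomorphic_on unit_disk"
    using u_hol \<phi>_hol by (intro holomorphic_intros) auto
  note P = contour_primitive[OF hol, folded J_op_def]
  have d: "v_log z * cmod (deriv (J_op u (\<lambda>z. \<phi> z ^ n)) z) = A z * cmod (\<phi> z) ^ n" if "z \<in> unit_disk" for z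
    using P(3)[OF that] by (simp add: A_def norm_mult norm_power)
  obtain C where C: "0 < C" "\<And>z. z \<in> unit_disk \<Longrightarrow> A z \<le> C" "\<And>z. z \<in> unit_disk \<Longrightarrow> B z \<le> C"
    using AB_bounded by blast
  have "J_op u (\<lambda>z. \<phi> z ^ n) \<in> bloch v_log"
  proof (rule blochI[OF P(1)])
    fix z assume z: "z \<in> unit_disk"
    have "A z * cmod (\<phi> z) ^ n \<le> C * 1"
      using C A_nonneg \<phi>_disk[OF z] z by (intro mult_mono power_le_one) auto
    then show "v_log z * cmod (deriv (J_op u (\<lambda>z. \<phi> z ^ n)) z) \<le> C"
      using d[OF z] by simp
  qed
  then show "z \<in> unit_disk \<Longrightarrow> A z * cmod (\<phi> z) ^ n \<le> bloch_norm v_log (J_op u (\<lambda>z. \<phi> z ^ n))"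
    using bloch_norm_ge_deriv d by metis
  show "(\<And>z. z \<in> unit_disk \<Longrightarrow> A z * cmod (\<phi> z) ^ n \<le> c) \<Longrightarrow> bloch_norm v_log (J_op u (\<lambda>z. \<phi> z ^ n)) \<le> c"
    using bloch_norm_le[of v_log "J_op u (\<lambda>z. \<phi> z ^ n)" c] d P(2) by simp
qed

lemma I_norm:
  shows "z \<in> unit_disk \<Longrightarrow> B z * (real n * cmod (\<phi> z) ^ (n - 1)) \<le> bloch_norm v_log (I_op u (\<lambda>z. \<phi> z ^ n))"
    and "(\<And>z. z \<in> unit_disk \<Longrightarrow> B z * (real n * cmod (\<phi> z) ^ (n - 1)) \<le> c)
      \<Longrightarrow> bloch_norm v_log (I_op u (\<lambda>z. \<phi> z ^ n)) \<le> c"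
proof -
  have hol: "(\<lambda>s. deriv (\<lambda>z. \<phi> z ^ n) s * u s) holomorphic_on unit_disk"
    using u_hol \<phi>_hol by (intro holomorphic_intros) auto
  note P = contour_primitive[OF hol, folded I_op_def]
  have pd: "deriv (\<lambda>z. \<phi> z ^ n) z = of_nat n * (deriv \<phi> z * \<phi> z ^ (n - 1))" if "z \<in> unit_disk" for z
    using holomorphic_derivI[OF \<phi>_hol open_ball that]
    by (intro DERIV_imp_deriv) (auto intro!: derivative_eq_intros)
  have d: "v_log z * cmod (deriv (I_op u (\<lambda>z. \<phi> z ^ n)) z) = B z * (real n * cmod (\<phi> z) ^ (n - 1))"
    if "z \<in> unit_disk" for z
    using P(3)[OF that] pd[OF that] by (simp add: B_def norm_mult norm_power)
  obtain C where C: "0 < C" "\<And>z. z \<in> unit_disk \<Longrightarrow> A z \<le> C" "\<And>z. z \<in> unit_disk \<Longrightarrow> B z \<le> C"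
    using AB_bounded by blast
  have "I_op u (\<lambda>z. \<phi> z ^ n) \<in> bloch v_log"
  proof (rule blochI[OF P(1)])
    fix z assume z: "z \<in> unit_disk"
    have "B z * (real n * cmod (\<phi> z) ^ (n - 1)) \<le> C * (real n * 1)"
      using C B_nonneg \<phi>_disk[OF z] z by (intro mult_mono power_le_one) auto
    then show "v_log z * cmod (deriv (I_op u (\<lambda>z. \<phi> z ^ n)) z) \<le> C * real n"
      using d[OF z] by simp
  qed
  then show "z \<in> unit_disk \<Longrightarrow> B z * (real n * cmod (\<phi> z) ^ (n - 1)) \<le> bloch_norm v_log (I_op u (\<lambda>z. \<phi> z ^ n))"
    using bloch_norm_ge_deriv d by metis
  show "(\<And>z. z \<in> unit_disk \<Longrightarrow> B z * (real n * cmod (\<phi> z) ^ (n - 1)) \<le> c)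
      \<Longrightarrow> bloch_norm v_log (I_op u (\<lambda>z. \<phi> z ^ n)) \<le> c"
    using bloch_norm_le[of v_log "I_op u (\<lambda>z. \<phi> z ^ n)" c] d P(2) by simp
qed

text \<open>
At a point where \<open>|\<phi>| = a\<close>, use the hypothesis for the index \<open>n\<close> of \<open>scale_near_1\<close>: the factor
\<open>a\<^sup>n\<close> costs \<open>1/2\<close>, and the norm of \<open>z\<^sup>n\<^sup>+\<^sup>1\<close> is at most of the size of \<open>n / loglog a\<close>.
\<close>

lemma boundary_J:
  assumes "eventually (\<lambda>n. real (n + 1) * bloch_norm v_log (J_op u (\<lambda>z. \<phi> z ^ n))
      / bloch_norm w_log (monomial (n + 1)) \<le> m) sequentially"
  obtains s where "0 < s" "s < 1"
    "\<And>z. z \<in> unit_disk \<Longrightarrow> s < cmod (\<phi> z) \<Longrightarrow> A z * loglog (cmod (\<phi> z)) \<le> 2 * (1 + 4 / ln (ln 4)) * m"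
proof -
  obtain N where N: "\<And>n. N \<le> n \<Longrightarrow> real (n + 1) * bloch_norm v_log (J_op u (\<lambda>z. \<phi> z ^ n))
      / bloch_norm w_log (monomial (n + 1)) \<le> m"
    using assms by (auto simp: eventually_sequentially)
  define C :: real where "C = 1 + 4 / ln (ln 4)"
  have C: "0 < C"
    using lnln4_pos by (simp add: C_def add_pos_pos)
  show thesis
  proof (rule that[of "1 - 1 / (2 * real (N + 1))"])
    show "0 < 1 - 1 / (2 * real (N + 1))" "1 - 1 / (2 * real (N + 1)) < 1"
      by (auto simp: field_simps)
    fix z assume z: "z \<in> unit_disk" and s: "1 - 1 / (2 * real (N + 1)) < cmod (\<phi> z)"
    define a where "a = cmod (\<phi> z)"
    have a: "0 \<le> a" "a < 1"
      using \<phi>_disk[OF z] by (auto simp: a_def)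
    obtain n where n: "N < n" "2 * real n * (1 - a) \<le> 1" "1 < 2 * real (n + 1) * (1 - a)"
      using scale_near_1[of a N] a s by (auto simp: a_def)
    define l where "l = ln (ln (8 * real (n + 1)))"
    define \<nu> where "\<nu> = bloch_norm w_log (monomial (n + 1))"
    have \<nu>: "0 < \<nu>" "\<nu> \<le> real (n + 1) * C / l"
      unfolding \<nu>_def C_def l_def by (rule monomial_norm_w_pos monomial_norm_w_le)+
    have la: "loglog a \<le> l" "0 < loglog a"
      unfolding l_def using loglog_le_scale[OF a n(3)] loglog_pos[OF a] by blast+
    have "A z * a ^ n \<le> bloch_norm v_log (J_op u (\<lambda>z. \<phi> z ^ n))"
      unfolding a_def by (rule J_norm(1)[OF z])
    then have "real (n + 1) * (A z * a ^ n) \<le> real (n + 1) * bloch_norm v_log (J_op u (\<lambda>z. \<phi> z ^ n))"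
      by (intro mult_left_mono) auto
    also have "\<dots> \<le> m * \<nu>"
      using N[of n, folded \<nu>_def] n(1) \<nu>(1) by (simp add: pos_divide_le_eq del: of_nat_add)
    finally have 1: "real (n + 1) * (A z * a ^ n) \<le> m * \<nu>" .
    have Aa: "0 \<le> A z * a ^ n"
      using A_nonneg[OF z] a by simp
    have "0 \<le> m * \<nu>"
      using 1 Aa by (smt (verit) mult_nonneg_nonneg of_nat_0_le_iff)
    then have m: "0 \<le> m"
      using \<nu>(1) by (simp add: zero_le_mult_iff)
    have "real (n + 1) * (A z * a ^ n) \<le> m * (real (n + 1) * C / l)"
      using 1 \<nu> m by (smt (verit) mult_left_mono)
    then have "real (n + 1) * (A z * a ^ n) * l \<le> real (n + 1) * (m * C)"
      using la by (simp add: field_simps)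
    then have 2: "A z * a ^ n * l \<le> m * C"
      by (simp add: mult.assoc del: of_nat_add)
    have "A z * loglog a * (1 / 2) \<le> A z * l * a ^ n"
      using power_ge_half[OF a(1) n(2)] la A_nonneg[OF z] by (intro mult_mono mult_left_mono) auto
    also have "\<dots> \<le> m * C"
      using 2 by (simp add: mult_ac)
    finally show "A z * loglog (cmod (\<phi> z)) \<le> 2 * (1 + 4 / ln (ln 4)) * m"
      by (simp add: C_def[symmetric] a_def mult_ac)
  qed
qed

text \<open>
As for \<open>boundary_J\<close>; the norm of \<open>z\<^sup>n\<close> is at most of the size of \<open>ln (4n)\<close>, hence of \<open>n v(a)\<close>.
\<close>

lemma boundary_I:
  assumes "eventually (\<lambda>n. bloch_norm v_log (I_op u (\<lambda>z. \<phi> z ^ n))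
      / bloch_norm v_log (monomial n) \<le> m) sequentially"
  obtains s where "0 < s" "s < 1"
    "\<And>z. z \<in> unit_disk \<Longrightarrow> s < cmod (\<phi> z) \<Longrightarrow> B z \<le> 16 * m * log_weight (cmod (\<phi> z))"
proof -
  obtain N where N: "\<And>n. N \<le> n \<Longrightarrow> bloch_norm v_log (I_op u (\<lambda>z. \<phi> z ^ n))
      / bloch_norm v_log (monomial n) \<le> m"
    using assms by (auto simp: eventually_sequentially)
  show thesis
  proof (rule that[of "1 - 1 / (2 * real (N + 1))"])
    show "0 < 1 - 1 / (2 * real (N + 1))" "1 - 1 / (2 * real (N + 1)) < 1"
      by (auto simp: field_simps)
    fix z assume z: "z \<in> unit_disk" and s: "1 - 1 / (2 * real (N + 1)) < cmod (\<phi> z)"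
    define a where "a = cmod (\<phi> z)"
    have a: "0 \<le> a" "a < 1"
      using \<phi>_disk[OF z] by (auto simp: a_def)
    obtain n where n: "N < n" "2 * real n * (1 - a) \<le> 1" "1 < 2 * real (n + 1) * (1 - a)"
      using scale_near_1[of a N] a s by (auto simp: a_def)
    have n1: "1 \<le> n"
      using n(1) by simp
    define \<mu> where "\<mu> = bloch_norm v_log (monomial n)"
    have \<mu>: "0 < \<mu>" "\<mu> \<le> 2 * ln (4 * real n)"
      unfolding \<mu>_def by (rule monomial_norm_v_pos[OF n1] monomial_norm_v_le[OF n1])+
    have "1 / 2 \<le> a ^ n"
      by (rule power_ge_half[OF a(1) n(2)])
    also have "\<dots> \<le> a ^ (n - 1)"
      using a by (intro power_decreasing) auto
    finally have h: "1 / 2 \<le> a ^ (n - 1)" .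
    have 0: "0 \<le> B z * (real n * a ^ (n - 1))"
      using B_nonneg[OF z] a by simp
    have "B z * (real n * a ^ (n - 1)) \<le> bloch_norm v_log (I_op u (\<lambda>z. \<phi> z ^ n))"
      unfolding a_def by (rule I_norm(1)[OF z])
    also have "\<dots> \<le> m * \<mu>"
      using N[of n] n(1) \<mu>(1) by (simp add: \<mu>_def[symmetric] field_simps)
    finally have 1: "B z * (real n * a ^ (n - 1)) \<le> m * \<mu>" .
    then have m: "0 \<le> m"
      using \<mu>(1) 0 by (smt (verit) zero_le_mult_iff)
    have "B z * (real n * (1 / 2)) \<le> B z * (real n * a ^ (n - 1))"
      using h B_nonneg[OF z] by (intro mult_left_mono) auto
    also have "\<dots> \<le> m * (2 * ln (4 * real n))"
      using 1 \<mu> m by (smt (verit) mult_left_mono)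
    also have "\<dots> \<le> m * (2 * (4 * real n * log_weight a))"
      using log_weight_ge_scale[OF a n1 n(2,3)] m by (intro mult_left_mono) auto
    finally have "real n * B z \<le> real n * (16 * m * log_weight a)"
      by (simp add: mult_ac)
    then show "B z \<le> 16 * m * log_weight (cmod (\<phi> z))"
      using n1 by (simp add: a_def)
  qed
qed

end

section \<open>Dilations and the upper estimate\<close>

definition dilation :: "real \<Rightarrow> (complex \<Rightarrow> complex) \<Rightarrow> complex \<Rightarrow> complex" where
  "dilation r f = on_disk (\<lambda>w. f (of_real r * w))"

lemma dilation_disk: "0 \<le> r \<Longrightarrow> r \<le> 1 \<Longrightarrow> w \<in> unit_disk \<Longrightarrow> of_real r * w \<in> unit_disk"
  by (simp add: norm_mult mult_left_le_one_le) (meson le_less_trans mult_left_le_one_le norm_ge_zero)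

lemma dilation_deriv:
  assumes r: "0 \<le> r" "r \<le> 1" and f: "f \<in> hol_disk"
  shows "dilation r f \<in> hol_disk"
    and "w \<in> unit_disk \<Longrightarrow> deriv (dilation r f) w = of_real r * deriv f (of_real r * w)"
proof -
  have d: "((\<lambda>w. f (of_real r * w)) has_field_derivative deriv f (of_real r * w) * of_real r) (at w)"
    if "w \<in> unit_disk" for w
    by (rule DERIV_chain2[where f = f and g = "\<lambda>w. of_real r * w",
          OF hol_disk_DERIV[OF f dilation_disk[OF r that]]])
       (auto intro!: derivative_eq_intros)
  have "(\<lambda>w. f (of_real r * w)) holomorphic_on unit_disk"
    unfolding holomorphic_on_open[OF open_ball] using d by blast
  then show "dilation r f \<in> hol_disk"
    unfolding dilation_def by (rule on_disk_hol_disk)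
  show "deriv (dilation r f) w = of_real r * deriv f (of_real r * w)" if "w \<in> unit_disk"
    unfolding dilation_def using on_disk_DERIV[OF that d[OF that]]
    by (simp add: DERIV_imp_deriv mult.commute)
qed

lemma dilation_bloch:
  assumes r: "0 \<le> r" "r < 1" and f: "f \<in> bloch v_log"
  shows "dilation r f \<in> bloch v_log"
proof (rule bloch_v_logI_bounded)
  show "dilation r f \<in> hol_disk"
    using dilation_deriv(1) r f bloch_imp_hol_disk by auto
  fix z :: complex assume z: "z \<in> unit_disk"
  have "cmod (of_real r * z) \<le> r"
    using z r by (simp add: norm_mult mult_left_le)
  then have "cmod (deriv f (of_real r * z)) \<le> 2 * bloch_norm v_log f / (1 - r)"
    using r by (intro bloch_deriv_bound_simple f)
  moreover have "r * cmod (deriv f (of_real r * z)) \<le> 1 * cmod (deriv f (of_real r * z))"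
    using r by (intro mult_right_mono) auto
  ultimately show "cmod (deriv (dilation r f) z) \<le> 2 * bloch_norm v_log f / (1 - r)"
    using dilation_deriv(2)[OF _ _ bloch_imp_hol_disk[OF f] z] r by (simp add: norm_mult)
qed

text \<open>
Cauchy's estimate between the disks of radii \<open>s\<close> and \<open>(1+s)/2\<close> turns uniform convergence of
functions into uniform convergence of derivatives.
\<close>

lemma uniform_limit_deriv:
  assumes F: "\<And>n. F n \<in> hol_disk" and f: "f \<in> hol_disk" and s: "0 \<le> s" "s < 1"
    and lim: "uniform_limit (cball 0 ((1 + s) / 2)) F f sequentially" and e: "0 < e"
  shows "\<exists>N. \<forall>n\<ge>N. \<forall>w. cmod w \<le> s \<longrightarrow> cmod (F n w - f w) \<le> e \<and> cmod (deriv (F n) w - deriv f w) \<le> e"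
proof -
  define d where "d = e * (1 - s) / 2"
  have d: "0 < d" "d \<le> e"
    using e s by (auto simp: d_def mult_le_cancel_left2)
  obtain N where N: "\<And>n w. N \<le> n \<Longrightarrow> cmod w \<le> (1 + s) / 2 \<Longrightarrow> cmod (F n w - f w) < d"
    using uniform_limitD[OF lim d(1)]
    unfolding eventually_sequentially dist_norm mem_cball_0 Ball_def by blast
  have "cmod (F n w - f w) \<le> e \<and> cmod (deriv (F n) w - deriv f w) \<le> e" if "N \<le> n" "cmod w \<le> s" for n w
  proof
    have w: "w \<in> unit_disk"
      using that s by simp
    show "cmod (F n w - f w) \<le> e"
      using N[OF that(1), of w] that s d by fastforce
    have "deriv (\<lambda>w. F n w - f w) w = deriv (F n) w - deriv f w"
      by (intro DERIV_imp_deriv DERIV_diff hol_disk_DERIV F f w)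
    moreover have "cmod (deriv (\<lambda>w. F n w - f w) w) \<le> 2 * d / (1 - s)"
      using N[OF that(1)] that s by (intro Cauchy_deriv_bound hol_disk_diff F f) (auto intro: less_imp_le)
    ultimately show "cmod (deriv (F n) w - deriv f w) \<le> e"
      using s by (simp add: d_def)
  qed
  then show ?thesis
    by blast
qed

text \<open>
The point evaluation bound makes the unit ball a normal family, and the limit stays in the ball
because the derivatives converge pointwise.
\<close>

lemma bloch_unit_ball_Montel:
  assumes F: "\<And>n::nat. F n \<in> bloch_unit_ball v_log"
  shows "\<exists>f\<in>bloch_unit_ball v_log. \<exists>k. strict_mono k \<and>
    (\<forall>s. 0 \<le> s \<longrightarrow> s < 1 \<longrightarrow> uniform_limit (cball 0 s) (\<lambda>n. F (k n)) f sequentially)"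
proof -
  have ball: "h \<in> bloch v_log" "bloch_norm v_log h \<le> 1" if "h \<in> bloch_unit_ball v_log" for h
    using that by (auto simp: bloch_unit_ball_def)
  obtain g k where g: "g holomorphic_on unit_disk" "strict_mono (k :: nat \<Rightarrow> nat)"
    and lim: "\<And>K. compact K \<Longrightarrow> K \<subseteq> unit_disk \<Longrightarrow> uniform_limit K (F \<circ> k) g sequentially"
  proof (rule Montel[of unit_disk "bloch_unit_ball v_log" F])
    show "h holomorphic_on unit_disk" if "h \<in> bloch_unit_ball v_log" for h
      using bloch_imp_hol_disk[OF ball(1)[OF that]] by (simp add: hol_disk_def)
    show "range F \<subseteq> bloch_unit_ball v_log"
      using F by auto
    fix K :: "complex set" assume K: "compact K" "K \<subseteq> unit_disk"
    show "\<exists>B. \<forall>h\<in>bloch_unit_ball v_log. \<forall>z\<in>K. cmod (h z) \<le> B"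
    proof (cases "K = {}")
      case False
      then obtain z0 where z0: "z0 \<in> K" "\<And>z. z \<in> K \<Longrightarrow> cmod z \<le> cmod z0"
        using continuous_attains_sup[of K cmod] K(1) by (auto intro: continuous_intros)
      have "cmod (h z) \<le> pt_const * loglog (cmod z0)" if h: "h \<in> bloch_unit_ball v_log" and z: "z \<in> K" for h z
      proof -
        have z01: "cmod z0 < 1"
          using z0 K(2) by auto
        have "cmod (h z) \<le> pt_const * loglog (cmod z) * bloch_norm v_log h"
          using z K(2) by (intro bloch_point_evaluation ball(1)[OF h]) auto
        also have "\<dots> \<le> pt_const * loglog (cmod z0) * 1"
          using z0(2)[OF z] z01 ball[OF h] pt_const_ge_1 loglog_pos[of "cmod z0"] loglog_pos[of "cmod z"]
          by (intro mult_mono mult_nonneg_nonneg loglog_mono bloch_norm_nonneg is_weight_v_log) auto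
        finally show ?thesis
          by simp
      qed
      then show ?thesis
        by blast
    qed auto
  qed auto
  define f where "f = on_disk g"
  have f: "f \<in> hol_disk"
    unfolding f_def by (rule on_disk_hol_disk[OF g(1)])
  have ul: "uniform_limit (cball 0 s) (\<lambda>n. F (k n)) f sequentially" if s: "0 \<le> s" "s < 1" for s
  proof -
    have "uniform_limit (cball 0 s) (F \<circ> k) g sequentially"
      using s by (intro lim) auto
    then show ?thesis
      using s by (subst uniform_limit_cong'[where g = "F \<circ> k" and i = g]) (auto simp: f_def on_disk_def)
  qed
  have Fh: "F n \<in> hol_disk" for n
    using ball(1)[OF F] by (rule bloch_imp_hol_disk)
  have le: "cmod (f 0) + v_log z * cmod (deriv f z) \<le> 1" if z: "z \<in> unit_disk" for z
  proof -
    define s where "s = cmod z"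
    have s: "0 \<le> s" "s < 1"
      using z by (auto simp: s_def)
    have "uniform_limit (cball 0 ((1 + s) / 2)) (\<lambda>n. F (k n)) f sequentially"
      using s by (intro ul) auto
    note * = uniform_limit_deriv[OF Fh f s this]
    have l1: "(\<lambda>n. F (k n) 0) \<longlonglongrightarrow> f 0"
    proof (rule LIMSEQ_I)
      fix e :: real assume "0 < e"
      then show "\<exists>N. \<forall>n\<ge>N. cmod (F (k n) 0 - f 0) < e"
        using *[of "e / 2"] s by (smt (verit) field_sum_of_halves half_gt_zero norm_zero)
    qed
    have l2: "(\<lambda>n. deriv (F (k n)) z) \<longlonglongrightarrow> deriv f z"
    proof (rule LIMSEQ_I)
      fix e :: real assume "0 < e"
      then show "\<exists>N. \<forall>n\<ge>N. cmod (deriv (F (k n)) z - deriv f z) < e"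
        using *[of "e / 2"] s by (smt (verit) field_sum_of_halves half_gt_zero s_def)
    qed
    have "(\<lambda>n. cmod (F (k n) 0) + v_log z * cmod (deriv (F (k n)) z))
        \<longlonglongrightarrow> cmod (f 0) + v_log z * cmod (deriv f z)"
      by (intro tendsto_intros l1 l2)
    then show ?thesis
    proof (rule LIMSEQ_le_const2, intro exI[of _ 0] allI impI)
      fix n
      show "cmod (F (k n) 0) + v_log z * cmod (deriv (F (k n)) z) \<le> 1"
        using bloch_norm_ge[OF ball(1)[OF F] z, of "k n"] ball(2)[OF F, of "k n"] by linarith
    qed
  qed
  then have "f \<in> bloch v_log"
    by (intro blochI[OF f, where B = "1 - cmod (f 0)"]) (simp add: algebra_simps)
  moreover have "bloch_norm v_log f \<le> cmod (f 0) + (1 - cmod (f 0))"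
    using le by (intro bloch_norm_le) (simp add: algebra_simps)
  ultimately have "f \<in> bloch_unit_ball v_log"
    by (simp add: bloch_unit_ball_def)
  then show ?thesis
    using g(2) ul by blast
qed

context weighted_composition
begin

lemma W_dilation_linear:
  assumes r: "0 \<le> r" "r < 1"
  shows "linear_operator v_log v_log (\<lambda>f. W_op u \<phi> (dilation r f))"
  unfolding linear_operator_def
proof (intro conjI ballI allI)
  show "W_op u \<phi> (dilation r f) \<in> bloch v_log" if "f \<in> bloch v_log" for f
    by (intro W_bloch dilation_bloch r that)
qed (auto simp: W_op_def dilation_def on_disk_def fun_eq_iff algebra_simps)

lemma W_norm_le_uniform:
  obtains D where "0 < D" "\<And>h e. h \<in> hol_disk \<Longrightarrow>
    (\<And>w. w \<in> unit_disk \<Longrightarrow> cmod (h w) \<le> e \<and> cmod (deriv h w) \<le> e) \<Longrightarrow>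
    bloch_norm v_log (W_op u \<phi> h) \<le> D * e"
proof -
  obtain C where C: "0 < C" "\<And>z. z \<in> unit_disk \<Longrightarrow> A z \<le> C" "\<And>z. z \<in> unit_disk \<Longrightarrow> B z \<le> C"
    using AB_bounded by blast
  have "bloch_norm v_log (W_op u \<phi> h) \<le> (cmod (u 0) + 2 * C) * e"
    if h: "h \<in> hol_disk" and e: "\<And>w. w \<in> unit_disk \<Longrightarrow> cmod (h w) \<le> e \<and> cmod (deriv h w) \<le> e" for h e
  proof -
    have \<phi>: "\<phi> z \<in> unit_disk" if "z \<in> unit_disk" for z
      using \<phi>_disk[OF that] by simp
    have "bloch_norm v_log (W_op u \<phi> h) \<le> cmod (W_op u \<phi> h 0) + (C * e + C * e)"
    proof (rule bloch_norm_le)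
      fix z :: complex assume z: "z \<in> unit_disk"
      have "A z * cmod (h (\<phi> z)) + B z * cmod (deriv h (\<phi> z)) \<le> C * e + C * e"
        using C e[OF \<phi>[OF z]] z by (intro add_mono mult_mono) auto
      then show "v_log z * cmod (deriv (W_op u \<phi> h) z) \<le> C * e + C * e"
        using W_deriv_le[OF h z] by linarith
    qed
    also have "cmod (W_op u \<phi> h 0) \<le> cmod (u 0) * e"
      using e[OF \<phi>[of 0]] by (simp add: W_op_def on_disk_def norm_mult mult_left_mono)
    finally show ?thesis
      by (simp add: algebra_simps)
  qed
  moreover have "0 < cmod (u 0) + 2 * C"
    using C by (simp add: add_nonneg_pos)
  ultimately show thesis
    using that by blast
qed

text \<open>
The image of the unit ball is itself sequentially compact: if \<open>f\<^sub>n\<close> converges to \<open>f\<close> locally uniformly,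
then the dilations and their derivatives converge uniformly on the whole disk, and \<open>A\<close> and \<open>B\<close> are
bounded. Being compact it is closed, so passing to the closure changes nothing.
\<close>

lemma W_dilation_compact:
  assumes r: "0 \<le> r" "r < 1"
  shows "compact_linear_operator v_log v_log (\<lambda>f. W_op u \<phi> (dilation r f))"
proof -
  interpret Metric_space "bloch v_log" "bloch_dist v_log"
    by (rule Metric_space_bloch[OF is_weight_v_log])
  define T where "T f = W_op u \<phi> (dilation r f)" for f
  have lin: "linear_operator v_log v_log T"
    unfolding T_def by (rule W_dilation_linear[OF r])
  then have Tb: "T f \<in> bloch v_log" if "f \<in> bloch_unit_ball v_log" for f
    using that by (auto simp: linear_operator_def bloch_unit_ball_def)
  obtain D where D: "0 < D" "\<And>h e. h \<in> hol_disk \<Longrightarrow>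
      (\<And>w. w \<in> unit_disk \<Longrightarrow> cmod (h w) \<le> e \<and> cmod (deriv h w) \<le> e) \<Longrightarrow>
      bloch_norm v_log (W_op u \<phi> h) \<le> D * e"
    using W_norm_le_uniform by blast
  have "compactin mtopology (T ` bloch_unit_ball v_log)"
    unfolding compactin_sequentially
  proof (intro conjI allI impI)
    show "T ` bloch_unit_ball v_log \<subseteq> bloch v_log"
      using Tb by auto
    fix \<sigma> :: "nat \<Rightarrow> complex \<Rightarrow> complex"
    assume "range \<sigma> \<subseteq> T ` bloch_unit_ball v_log"
    then have "\<forall>n. \<exists>f. f \<in> bloch_unit_ball v_log \<and> \<sigma> n = T f"
      by (auto simp: image_subset_iff)
    then obtain F where F: "\<And>n. F n \<in> bloch_unit_ball v_log" "\<And>n. \<sigma> n = T (F n)"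
      by metis
    obtain f k where f: "f \<in> bloch_unit_ball v_log" and k: "strict_mono k"
      and lim: "\<And>s. 0 \<le> s \<Longrightarrow> s < 1 \<Longrightarrow> uniform_limit (cball 0 s) (\<lambda>n. F (k n)) f sequentially"
      using bloch_unit_ball_Montel[of F, OF F(1)] by blast
    have hol: "h \<in> hol_disk" if "h \<in> bloch_unit_ball v_log" for h
      using that by (auto simp: bloch_unit_ball_def bloch_def)
    have "limitin (bloch_topology v_log) (\<sigma> \<circ> k) (T f) sequentially"
    proof (rule bloch_topology_limitin[OF is_weight_v_log Tb[OF f]])
      show "(\<sigma> \<circ> k) n \<in> bloch v_log" for n
        using F Tb by simp
      fix e :: real assume e: "0 < e"
      have "uniform_limit (cball 0 ((1 + r) / 2)) (\<lambda>n. F (k n)) f sequentially"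
        using r by (intro lim) auto
      moreover have "0 < e / (2 * D)"
        using e D by simp
      ultimately obtain N where N: "\<And>n w. N \<le> n \<Longrightarrow> cmod w \<le> r \<Longrightarrow>
          cmod (F (k n) w - f w) \<le> e / (2 * D) \<and> cmod (deriv (F (k n)) w - deriv f w) \<le> e / (2 * D)"
        using uniform_limit_deriv[OF hol[OF F(1)] hol[OF f] r, of k] by meson
      have "bloch_norm v_log (\<lambda>z. (\<sigma> \<circ> k) n z - T f z) < e" if n: "N \<le> n" for n
      proof -
        define h where "h = dilation r (\<lambda>w. F (k n) w - f w)"
        have dh: "(\<lambda>w. F (k n) w - f w) \<in> hol_disk"
          by (intro hol_disk_diff hol F f)
        have h: "h \<in> hol_disk"
          unfolding h_def using r by (intro dilation_deriv(1) dh) auto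
        have "(\<lambda>z. (\<sigma> \<circ> k) n z - T f z) = W_op u \<phi> h"
          unfolding F(2) T_def h_def W_op_def dilation_def
          by (auto simp: on_disk_def fun_eq_iff F(2) T_def W_op_def dilation_def algebra_simps)
        moreover have "bloch_norm v_log (W_op u \<phi> h) \<le> D * (e / (2 * D))"
        proof (rule D(2)[OF h])
          fix w :: complex assume w: "w \<in> unit_disk"
          have rw: "cmod (of_real r * w) \<le> r"
            using w r by (simp add: norm_mult mult_left_le)
          have rwD: "of_real r * w \<in> unit_disk"
            using rw r by simp
          have "deriv h w = of_real r * (deriv (F (k n)) (of_real r * w) - deriv f (of_real r * w))"
          proof -
            have "deriv (\<lambda>w. F (k n) w - f w) (of_real r * w) = deriv (F (k n)) (of_real r * w) - deriv f (of_real r * w)"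
              by (intro DERIV_imp_deriv DERIV_diff hol_disk_DERIV hol F f rwD)
            then show ?thesis
              unfolding h_def using dilation_deriv(2)[OF _ _ dh w] r by simp
          qed
          then have "cmod (deriv h w) \<le> cmod (deriv (F (k n)) (of_real r * w) - deriv f (of_real r * w))"
            using r by (simp add: norm_mult mult_left_le_one_le)
          moreover have "h w = F (k n) (of_real r * w) - f (of_real r * w)"
            using w by (simp add: h_def dilation_def on_disk_def)
          ultimately show "cmod (h w) \<le> e / (2 * D) \<and> cmod (deriv h w) \<le> e / (2 * D)"
            using N[OF n rw] by auto
        qed
        ultimately show ?thesis
          using D(1) e by simp
      qed
      then show "\<exists>N. \<forall>n\<ge>N. bloch_norm v_log (\<lambda>z. (\<sigma> \<circ> k) n z - T f z) < e"
        by blast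
    qed
    then show "\<exists>l r. l \<in> T ` bloch_unit_ball v_log \<and> strict_mono r \<and> limitin mtopology (\<sigma> \<circ> r) l sequentially"
      using f k by (auto simp: bloch_topology_def)
  qed
  moreover from this have "mtopology closure_of (T ` bloch_unit_ball v_log) = T ` bloch_unit_ball v_log"
    by (intro closure_of_closedin compactin_imp_closedin Hausdorff_space_mtopology)
  ultimately show ?thesis
    using lin unfolding compact_linear_operator_def bloch_topology_def T_def[symmetric] by simp
qed

text \<open>
The competitor is \<open>f \<mapsto> W (dilation r f)\<close>. With \<open>h = f - dilation r f\<close> the disk splits at \<open>|\<phi>| = q\<close>:
inside, \<open>h\<close> and \<open>h'\<close> are \<open>O(1-r)\<close> and the coefficients are bounded; outside, \<open>|h| \<le> 2 pt_const \<Lambda>\<close>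
and \<open>|h'| \<le> 4/v\<close>, and the hypothesis applies. The threshold \<open>q\<close> is also at least \<open>|\<phi>(0)|\<close> so that
the value at \<open>0\<close> is among the small terms.
\<close>

lemma essential_norm_upper:
  assumes s: "s < 1" and m: "0 \<le> m"
    and bd: "\<And>z. z \<in> unit_disk \<Longrightarrow> s < cmod (\<phi> z) \<Longrightarrow>
      A z * loglog (cmod (\<phi> z)) \<le> m \<and> B z \<le> m * log_weight (cmod (\<phi> z))"
  shows "essential_norm v_log v_log (W_op u \<phi>) \<le> (2 * pt_const + 4) * m"
proof (rule field_le_epsilon)
  fix e :: real assume e: "0 < e"
  define q where "q = max (max s 0) (cmod (\<phi> 0))"
  have q: "0 \<le> q" "q < 1" "s \<le> q" "cmod (\<phi> 0) \<le> q"
    using s \<phi>_disk[of 0] by (auto simp: q_def)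
  obtain C where C: "0 < C" "\<And>z. z \<in> unit_disk \<Longrightarrow> A z \<le> C" "\<And>z. z \<in> unit_disk \<Longrightarrow> B z \<le> C"
    using AB_bounded by blast
  \<comment> \<open>\<open>\<eta>\<close> bounds \<open>h\<close> on the disk of radius \<open>(1+q)/2\<close>, and \<open>2 \<eta> / (1-q)\<close> bounds \<open>h'\<close> on the
    disk of radius \<open>q\<close>; \<open>D \<eta>\<close> is the resulting total of the small terms.\<close>
  define D where "D = cmod (u 0) + C + C * (2 / (1 - q))"
  have D: "0 < D"
    unfolding D_def using C q by (intro add_nonneg_pos add_pos_pos mult_pos_pos) auto
  define \<eta> where "\<eta> = min (1 / 2) (e / D)"
  define r where "r = 1 - \<eta> * (1 - q) / 4"
  have \<eta>: "0 < \<eta>" "\<eta> \<le> 1 / 2" "D * \<eta> \<le> e"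
    using e D by (auto simp: \<eta>_def min_def field_simps)
  have "0 < \<eta> * (1 - q)" "\<eta> * (1 - q) \<le> 1 * 1"
    using \<eta> q by (auto intro!: mult_le_one)
  then have r: "0 \<le> r" "r < 1" "(1 - r) * (4 / (1 - q)) = \<eta>"
    using q by (auto simp: r_def field_simps)
  define c where "c = (2 * pt_const + 4) * m"
  have c: "0 \<le> c"
    using pt_const_ge_1 m by (simp add: c_def)
  define T where "T f = W_op u \<phi> (dilation r f)" for f
  have comp: "compact_linear_operator v_log v_log T"
    unfolding T_def by (rule W_dilation_compact[OF r(1,2)])
  have "bloch_norm v_log (\<lambda>z. W_op u \<phi> f z - T f z) \<le> c + e" if "f \<in> bloch_unit_ball v_log" for f
  proof -
    have f: "f \<in> bloch v_log" "bloch_norm v_log f \<le> 1"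
      using that by (auto simp: bloch_unit_ball_def)
    note fh = bloch_imp_hol_disk[OF f(1)]
    define h where "h w = f w - dilation r f w" for w
    have h: "h \<in> hol_disk"
      unfolding h_def using r by (intro hol_disk_diff fh dilation_deriv(1)) auto
    have Wh: "(\<lambda>z. W_op u \<phi> f z - T f z) = W_op u \<phi> h"
      by (auto simp: T_def h_def W_op_def on_disk_def fun_eq_iff algebra_simps)
    have h_small: "cmod (h w) \<le> \<eta>" if w: "cmod w \<le> (1 + q) / 2" for w
    proof -
      have rw: "cmod (of_real r * w) \<le> cmod w"
        using r by (simp add: norm_mult mult_left_le_one_le)
      have wD: "w \<in> unit_disk"
        using w q by simp
      have "cmod (f w - f (of_real r * w)) \<le> 2 * 1 / (1 - (1 + q) / 2) * cmod (w - of_real r * w)"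
      proof (rule field_differentiable_bound[of "cball 0 ((1 + q) / 2)" f "deriv f"])
        fix x :: complex assume x: "x \<in> cball 0 ((1 + q) / 2)"
        have xD: "x \<in> unit_disk"
          using x q by simp
        show "(f has_field_derivative deriv f x) (at x within cball 0 ((1 + q) / 2))"
          by (rule has_field_derivative_at_within[OF hol_disk_DERIV[OF fh xD]])
        have "cmod (deriv f x) \<le> 2 * bloch_norm v_log f / (1 - (1 + q) / 2)"
          using x q by (intro bloch_deriv_bound_simple f) auto
        also have "\<dots> \<le> 2 * 1 / (1 - (1 + q) / 2)"
          using f q by (intro divide_right_mono) auto
        finally show "cmod (deriv f x) \<le> 2 * 1 / (1 - (1 + q) / 2)" .
      qed (use w rw in auto)
      also have "cmod (w - of_real r * w) = (1 - r) * cmod w"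
      proof -
        have "w - of_real r * w = of_real (1 - r) * w"
          by (simp add: algebra_simps)
        then show ?thesis
          using r by (simp only: norm_mult norm_of_real)
      qed
      also have "2 * 1 / (1 - (1 + q) / 2) * ((1 - r) * cmod w) = ((1 - r) * (4 / (1 - q))) * cmod w"
        using q by (simp add: field_simps)
      also have "\<dots> \<le> \<eta> * 1"
        unfolding r(3) using \<eta> wD by (intro mult_left_mono) auto
      finally show ?thesis
        using wD by (simp add: h_def dilation_def on_disk_def)
    qed
    have h_small': "cmod (deriv h w) \<le> \<eta> * (2 / (1 - q))" if "cmod w \<le> q" for w
      using Cauchy_deriv_bound[OF h q(1,2) h_small that] by (simp add: mult.commute)
    have far: "A z * cmod (h (\<phi> z)) + B z * cmod (deriv h (\<phi> z)) \<le> c"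
      if z: "z \<in> unit_disk" and qz: "q < cmod (\<phi> z)" for z
    proof -
      define w where "w = \<phi> z"
      define \<rho> where "\<rho> = cmod w"
      have wD: "w \<in> unit_disk" and \<rho>: "0 \<le> \<rho>" "\<rho> < 1"
        using \<phi>_disk[OF z] by (auto simp: w_def \<rho>_def)
      have rwD: "of_real r * w \<in> unit_disk"
        using r wD by (intro dilation_disk) auto
      have r\<rho>: "cmod (of_real r * w) = r * \<rho>" "0 \<le> r * \<rho>" "r * \<rho> \<le> \<rho>"
        using r \<rho> by (auto simp: \<rho>_def norm_mult mult_left_le_one_le)
      have L: "0 < loglog \<rho>" and V: "0 < log_weight \<rho>" "0 < log_weight (r * \<rho>)"
        using r \<rho> r\<rho> by (auto intro!: loglog_pos log_weight_pos)
      have pe: "cmod (f x) \<le> pt_const * loglog \<rho>" if "x \<in> unit_disk" "cmod x \<le> \<rho>" for x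
      proof -
        have "cmod (f x) \<le> pt_const * loglog (cmod x) * bloch_norm v_log f"
          by (rule bloch_point_evaluation[OF f(1) that(1)])
        also have "\<dots> \<le> pt_const * loglog \<rho> * 1"
          using that \<rho> f pt_const_ge_1 L loglog_pos[of "cmod x"]
          by (intro mult_mono mult_nonneg_nonneg loglog_mono bloch_norm_nonneg is_weight_v_log) auto
        finally show ?thesis
          by simp
      qed
      have hw: "h w = f w - f (of_real r * w)"
        using wD by (simp add: h_def dilation_def on_disk_def)
      have "cmod (h w) \<le> 2 * pt_const * loglog \<rho>"
        using pe[OF wD] pe[OF rwD] r\<rho> norm_triangle_ineq4[of "f w" "f (of_real r * w)"]
        unfolding hw by (simp add: \<rho>_def)
      then have "A z * cmod (h w) \<le> A z * (2 * pt_const * loglog \<rho>)"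
        using A_nonneg[OF z] by (intro mult_left_mono)
      also have "\<dots> = 2 * pt_const * (A z * loglog \<rho>)"
        by simp
      also have "\<dots> \<le> 2 * pt_const * m"
        using bd[OF z] qz q pt_const_ge_1 by (intro mult_left_mono) (auto simp: \<rho>_def w_def)
      finally have 1: "A z * cmod (h w) \<le> 2 * pt_const * m" .
      have de: "cmod (deriv f x) \<le> 1 / log_weight (cmod x)" if "x \<in> unit_disk" for x
      proof -
        have "cmod (deriv f x) \<le> bloch_norm v_log f / log_weight (cmod x)"
          by (rule bloch_deriv_bound[OF f(1) that])
        also have "\<dots> \<le> 1 / log_weight (cmod x)"
          using f log_weight_pos[of "cmod x"] that by (intro divide_right_mono) auto
        finally show ?thesis .
      qed
      have dh: "deriv h w = deriv f w - of_real r * deriv f (of_real r * w)"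
      proof -
        have "(dilation r f has_field_derivative of_real r * deriv f (of_real r * w)) (at w)"
          using hol_disk_DERIV[OF dilation_deriv(1)[OF _ _ fh] wD, of r] dilation_deriv(2)[OF _ _ fh wD, of r] r
          by simp
        then show ?thesis
          unfolding h_def by (intro DERIV_imp_deriv DERIV_diff hol_disk_DERIV[OF fh wD])
      qed
      have "cmod (deriv h w) \<le> cmod (deriv f w) + r * cmod (deriv f (of_real r * w))"
        unfolding dh using norm_triangle_ineq4[of "deriv f w" "of_real r * deriv f (of_real r * w)"] r
        by (simp add: norm_mult)
      also have "\<dots> \<le> 1 / log_weight \<rho> + 1 * (1 / log_weight (r * \<rho>))"
        using de[OF wD] de[OF rwD] r\<rho> r by (intro add_mono mult_mono) (auto simp: \<rho>_def)
      also have "1 * (1 / log_weight (r * \<rho>)) \<le> 3 / log_weight \<rho>"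
        using log_weight_almost_decreasing[OF r\<rho>(2,3) \<rho>(2)] V by (simp add: field_simps)
      finally have "cmod (deriv h w) \<le> 4 / log_weight \<rho>"
        by simp
      then have "B z * cmod (deriv h w) \<le> (m * log_weight \<rho>) * (4 / log_weight \<rho>)"
        using bd[OF z] qz q m V by (intro mult_mono) (auto simp: \<rho>_def w_def)
      then have "B z * cmod (deriv h w) \<le> 4 * m"
        using V by simp
      with 1 show ?thesis
        by (simp add: c_def w_def algebra_simps)
    qed
    have near: "A z * cmod (h (\<phi> z)) + B z * cmod (deriv h (\<phi> z)) \<le> C * \<eta> + C * (\<eta> * (2 / (1 - q)))"
      if z: "z \<in> unit_disk" and qz: "cmod (\<phi> z) \<le> q" for z
      using C z h_small[of "\<phi> z"] h_small'[OF qz] q qz by (intro add_mono mult_mono) auto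
    have "bloch_norm v_log (W_op u \<phi> h) \<le> cmod (W_op u \<phi> h 0) + (c + (C * \<eta> + C * (\<eta> * (2 / (1 - q)))))"
    proof (rule bloch_norm_le)
      fix z :: complex assume z: "z \<in> unit_disk"
      have "0 \<le> C * \<eta> + C * (\<eta> * (2 / (1 - q)))"
        using C \<eta> q by (intro add_nonneg_nonneg mult_nonneg_nonneg) auto
      then have "A z * cmod (h (\<phi> z)) + B z * cmod (deriv h (\<phi> z)) \<le> c + (C * \<eta> + C * (\<eta> * (2 / (1 - q))))"
        using far[OF z] near[OF z] c by (cases "cmod (\<phi> z) \<le> q") auto
      then show "v_log z * cmod (deriv (W_op u \<phi> h) z) \<le> c + (C * \<eta> + C * (\<eta> * (2 / (1 - q))))"
        using W_deriv_le[OF h z] by linarith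
    qed
    also have "cmod (W_op u \<phi> h 0) \<le> cmod (u 0) * \<eta>"
      using h_small[of "\<phi> 0"] q by (simp add: W_op_def on_disk_def norm_mult mult_left_mono)
    finally have "bloch_norm v_log (W_op u \<phi> h) \<le> c + D * \<eta>"
      by (simp add: D_def algebra_simps)
    then show ?thesis
      using \<eta> Wh by simp
  qed
  then have "operator_norm v_log v_log (\<lambda>f z. W_op u \<phi> f z - T f z) \<le> c + e"
    by (rule operator_norm_le[OF is_weight_v_log])
  then show "essential_norm v_log v_log (W_op u \<phi>) \<le> (2 * pt_const + 4) * m + e"
    using essential_norm_le[OF is_weight_v_log W_bounded comp] by (simp add: c_def)
qed

end

section \<open>Compact operators on functions that live near the boundary\<close>

definition little_bloch :: "(complex \<Rightarrow> real) \<Rightarrow> (complex \<Rightarrow> complex) set" where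
  "little_bloch v = {f \<in> bloch v. \<forall>e>0. \<exists>s<1. \<forall>z\<in>unit_disk. s < cmod z \<longrightarrow> v z * cmod (deriv f z) \<le> e}"

lemma little_bloch_add:
  assumes v: "is_weight v" and f: "f \<in> little_bloch v" and g: "g \<in> little_bloch v"
  shows "(\<lambda>z. f z + g z) \<in> little_bloch v"
proof -
  have fg: "f \<in> bloch v" "g \<in> bloch v"
    using f g by (auto simp: little_bloch_def)
  have "\<exists>s<1. \<forall>z\<in>unit_disk. s < cmod z \<longrightarrow> v z * cmod (deriv (\<lambda>z. f z + g z) z) \<le> e" if e: "0 < e" for e
  proof -
    have e2: "0 < e / 2"
      using e by simp
    obtain s where s: "s < 1" "\<And>z. z \<in> unit_disk \<Longrightarrow> s < cmod z \<Longrightarrow> v z * cmod (deriv f z) \<le> e / 2"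
      using f e2 unfolding little_bloch_def by blast
    obtain t where t: "t < 1" "\<And>z. z \<in> unit_disk \<Longrightarrow> t < cmod z \<Longrightarrow> v z * cmod (deriv g z) \<le> e / 2"
      using g e2 unfolding little_bloch_def by blast
    have "v z * cmod (deriv (\<lambda>z. f z + g z) z) \<le> e" if z: "z \<in> unit_disk" "max s t < cmod z" for z
    proof -
      have "deriv (\<lambda>z. f z + g z) z = deriv f z + deriv g z"
        using fg z by (intro DERIV_imp_deriv DERIV_add hol_disk_DERIV bloch_imp_hol_disk)
      then have "v z * cmod (deriv (\<lambda>z. f z + g z) z) \<le> v z * (cmod (deriv f z) + cmod (deriv g z))"
        using weight_pos[OF v z(1)] by (simp add: norm_triangle_ineq)
      then show ?thesis
        using s(2)[OF z(1)] t(2)[OF z(1)] z by (simp add: distrib_left)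
    qed
    then show ?thesis
      using s(1) t(1) by (intro exI[of _ "max s t"]) auto
  qed
  then show ?thesis
    using bloch_add(1)[OF v fg] by (simp add: little_bloch_def)
qed

lemma little_bloch_zero:
  assumes "is_weight v"
  shows "(\<lambda>z. 0) \<in> little_bloch v"
  using bloch_zero(1)[OF assms] by (auto simp: little_bloch_def intro: exI[of _ 0])

lemma little_bloch_v_logI:
  assumes f: "f \<in> hol_disk" and b: "\<And>z. z \<in> unit_disk \<Longrightarrow> cmod (deriv f z) \<le> C"
  shows "f \<in> little_bloch v_log"
proof -
  have C: "0 \<le> C"
    using b[of 0] by (smt (verit) centre_in_ball norm_ge_zero zero_less_one)
  have "\<exists>s<1. \<forall>z\<in>unit_disk. s < cmod z \<longrightarrow> v_log z * cmod (deriv f z) \<le> e" if e: "0 < e" for e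
  proof -
    have "0 < e / (C + 1)"
      using e C by simp
    then obtain s where s: "0 < s" "s < 1" "\<And>r. s < r \<Longrightarrow> r < 1 \<Longrightarrow> log_weight r \<le> e / (C + 1)"
      using log_weight_small by blast
    have "v_log z * cmod (deriv f z) \<le> e" if z: "z \<in> unit_disk" "s < cmod z" for z
    proof -
      have "v_log z * cmod (deriv f z) \<le> e / (C + 1) * C"
        unfolding v_log_eq using s z b[OF z(1)] e C by (intro mult_mono) auto
      also have "\<dots> \<le> e"
        using e C by (simp add: field_simps)
      finally show ?thesis .
    qed
    then show ?thesis
      using s by blast
  qed
  then show ?thesis
    using bloch_v_logI_bounded[OF assms] by (auto simp: little_bloch_def)
qed

text \<open>
If this failed, a counterexample \<open>f\<^sub>n\<close> for each \<open>s = 1 - 1/(n+1)\<close>, \<open>\<delta> = 1/(n+1)\<close> would give images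
\<open>K f\<^sub>n\<close> in a compact set; along a subsequence they are close to one function \<open>l \<noteq> 0\<close>. Now add such
functions one at a time. The weighted derivative of a finite sum \<open>S\<close> is small outside a disk, and the
next summand is chosen with small weighted derivative inside this disk, so the norm of the sum is at
most \<open>max \<parallel>S\<parallel> 1\<close> plus an error as small as one likes. After \<open>N\<close> steps the norm is at most \<open>2\<close>, but
the image is within \<open>N e/4\<close> of \<open>N l\<close>, where \<open>\<parallel>l\<parallel> \<ge> 3e/4\<close>, against the boundedness of \<open>K\<close>.
\<close>

lemma compact_operator_small:
  assumes v: "is_weight v" and K: "compact_linear_operator v v K" and e: "0 < e"
  shows "\<exists>s<1. \<exists>\<delta>>0. \<forall>f\<in>little_bloch v. f 0 = 0 \<longrightarrow> bloch_norm v f \<le> 1 \<longrightarrow>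
    (\<forall>z. cmod z \<le> s \<longrightarrow> v z * cmod (deriv f z) \<le> \<delta>) \<longrightarrow> bloch_norm v (K f) \<le> e"
proof (rule ccontr)
  assume neg: "\<not> ?thesis"
  define bad where "bad s \<delta> f \<longleftrightarrow> f \<in> little_bloch v \<and> f 0 = 0 \<and> bloch_norm v f \<le> 1 \<and>
    (\<forall>z. cmod z \<le> s \<longrightarrow> v z * cmod (deriv f z) \<le> \<delta>) \<and> e < bloch_norm v (K f)" for s \<delta> f
  have ex: "\<exists>f. bad s \<delta> f" if "s < 1" "0 < \<delta>" for s \<delta>
    using neg that unfolding bad_def not_le[symmetric] by blast
  interpret Metric_space "bloch v" "bloch_dist v"
    by (rule Metric_space_bloch[OF v])
  have lin: "linear_operator v v K"
    using K by (simp add: compact_linear_operator_def)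
  have Kb: "K f \<in> bloch v" if "f \<in> bloch v" for f
    using lin that by (simp add: linear_operator_def)
  have bb: "f \<in> bloch_unit_ball v" "f \<in> bloch v" if "bad s \<delta> f" for s \<delta> f
    using that by (auto simp: bad_def little_bloch_def bloch_unit_ball_def)
  define Q where "Q = mtopology closure_of (K ` bloch_unit_ball v)"
  have Q: "compactin mtopology Q"
    using K by (simp add: compact_linear_operator_def bloch_topology_def Q_def)
  have KQ: "K f \<in> Q" if "f \<in> bloch_unit_ball v" for f
  proof -
    have "K ` bloch_unit_ball v \<subseteq> topspace mtopology"
      using Kb by (auto simp: bloch_unit_ball_def)
    then show ?thesis
      using closure_of_subset that unfolding Q_def by blast
  qed
  have "\<forall>n::nat. \<exists>f. bad (1 - 1 / real (n + 1)) (1 / real (n + 1)) f"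
    by (intro allI ex) auto
  then obtain f where f: "\<And>n::nat. bad (1 - 1 / real (n + 1)) (1 / real (n + 1)) (f n)"
    by metis
  have "range (\<lambda>n. K (f n)) \<subseteq> Q"
    using KQ bb[OF f] by auto
  then obtain l k where l: "l \<in> Q" and k: "strict_mono (k :: nat \<Rightarrow> nat)"
    and lim: "limitin mtopology ((\<lambda>n. K (f n)) \<circ> k) l sequentially"
    using Q unfolding compactin_sequentially by blast
  have lb: "l \<in> bloch v"
    using l Q by (auto simp: compactin_sequentially)
  have "0 < e / 4"
    using e by simp
  then obtain N0 where N0: "\<And>n. N0 \<le> n \<Longrightarrow> bloch_dist v (K (f (k n))) l < e / 4"
    using lim unfolding limit_metric_sequentially o_def by blast
  have near: "\<exists>g. bad s \<delta> g \<and> bloch_norm v (\<lambda>z. K g z - l z) < e / 4" if s: "s < 1" and \<delta>: "0 < \<delta>" for s \<delta>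
  proof -
    obtain n1 :: nat where n1: "1 / (1 - s) < real n1"
      using reals_Archimedean2 by blast
    obtain n2 :: nat where n2: "1 / \<delta> < real n2"
      using reals_Archimedean2 by blast
    define n where "n = max N0 (max n1 n2)"
    have "n \<le> k n"
      using k by (rule seq_suble)
    then have "1 / (1 - s) < real (k n + 1)" "1 / \<delta> < real (k n + 1)"
      using n1 n2 by (auto simp: n_def)
    then have "1 / real (k n + 1) \<le> 1 - s" "1 / real (k n + 1) \<le> \<delta>"
      using s \<delta> by (auto simp: field_simps)
    then have "bad s \<delta> (f (k n))"
      using f[of "k n"] unfolding bad_def by (smt (verit))
    moreover have "bloch_norm v (\<lambda>z. K (f (k n)) z - l z) < e / 4"
      using N0[of n] bloch_dist_eq[OF Kb[OF bb(2)[OF f]] lb] by (simp add: n_def)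
    ultimately show ?thesis
      by blast
  qed
  have l_large: "3 * e / 4 \<le> bloch_norm v l"
  proof -
    obtain g where g: "bad 0 1 g" "bloch_norm v (\<lambda>z. K g z - l z) < e / 4"
      using near[of 0 1] by auto
    have "K g \<in> bloch v"
      by (rule Kb[OF bb(2)[OF g(1)]])
    then have "bloch_norm v (\<lambda>z. (K g z - l z) + l z) \<le> bloch_norm v (\<lambda>z. K g z - l z) + bloch_norm v l"
      by (intro bloch_add v bloch_diff lb)
    then show ?thesis
      using g by (simp add: bad_def)
  qed
  \<comment> \<open>The errors \<open>1/2, 1/4, \<dots>\<close> keep the norms below \<open>2\<close>.\<close>
  have sums: "\<exists>S\<in>little_bloch v. S 0 = 0 \<and> bloch_norm v S \<le> 2 - 1 / 2 ^ N \<and>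
    bloch_norm v (\<lambda>z. K S z - of_nat N * l z) \<le> real N * (e / 4)" for N
  proof (induction N)
    case 0
    show ?case
      using little_bloch_zero[OF v] bloch_zero[OF v] linear_operator_zero[OF v lin]
      by (intro bexI[of _ "\<lambda>z. 0"]) auto
  next
    case (Suc N)
    then obtain S where S: "S \<in> little_bloch v" "S 0 = 0" "bloch_norm v S \<le> 2 - 1 / 2 ^ N"
      "bloch_norm v (\<lambda>z. K S z - of_nat N * l z) \<le> real N * (e / 4)"
      by blast
    define \<epsilon> :: real where "\<epsilon> = 1 / 2 ^ Suc N"
    have \<epsilon>: "0 < \<epsilon>" "\<epsilon> \<le> 1 / 2" "1 / 2 ^ N = 2 * \<epsilon>"
      using power_le_one[of "1/2::real" N] by (auto simp: \<epsilon>_def field_simps)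
    obtain s where s: "s < 1" "\<And>z. z \<in> unit_disk \<Longrightarrow> s < cmod z \<Longrightarrow> v z * cmod (deriv S z) \<le> \<epsilon>"
      using S(1) \<epsilon>(1) unfolding little_bloch_def by blast
    obtain g where g: "bad s \<epsilon> g" "bloch_norm v (\<lambda>z. K g z - l z) < e / 4"
      using near[OF s(1) \<epsilon>(1)] by blast
    have Sb: "S \<in> bloch v"
      using S by (simp add: little_bloch_def)
    note gb = bb(2)[OF g(1)]
    have "bloch_norm v (\<lambda>z. S z + g z) \<le> cmod (S 0 + g 0) + (2 - \<epsilon>)"
    proof (rule bloch_norm_le)
      fix z :: complex assume z: "z \<in> unit_disk"
      have "deriv (\<lambda>z. S z + g z) z = deriv S z + deriv g z"
        using Sb gb z by (intro DERIV_imp_deriv DERIV_add hol_disk_DERIV bloch_imp_hol_disk)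
      then have "v z * cmod (deriv (\<lambda>z. S z + g z) z) \<le> v z * (cmod (deriv S z) + cmod (deriv g z))"
        using weight_pos[OF v z] by (simp add: norm_triangle_ineq)
      also have "\<dots> = v z * cmod (deriv S z) + v z * cmod (deriv g z)"
        by (simp add: distrib_left)
      also have "\<dots> \<le> 2 - \<epsilon>"
      proof (cases "cmod z \<le> s")
        case True
        then have "v z * cmod (deriv g z) \<le> \<epsilon>"
          using g(1) by (simp add: bad_def)
        then show ?thesis
          using bloch_norm_ge_deriv[OF Sb z] S(3) \<epsilon>(3) by linarith
      next
        case False
        then show ?thesis
          using s(2)[OF z] bloch_norm_ge_deriv[OF gb z] g(1) \<epsilon>(2) by (simp add: bad_def)
      qed
      finally show "v z * cmod (deriv (\<lambda>z. S z + g z) z) \<le> 2 - \<epsilon>" .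
    qed
    moreover have "bloch_norm v (\<lambda>z. K (\<lambda>z. S z + g z) z - of_nat (Suc N) * l z) \<le> real (Suc N) * (e / 4)"
    proof -
      have "K (\<lambda>z. S z + g z) = (\<lambda>z. K S z + K g z)"
        using lin Sb gb by (simp add: linear_operator_def)
      then have "(\<lambda>z. K (\<lambda>z. S z + g z) z - of_nat (Suc N) * l z)
          = (\<lambda>z. (K S z - of_nat N * l z) + (K g z - l z))"
        by (auto simp: algebra_simps)
      moreover have "bloch_norm v (\<lambda>z. (K S z - of_nat N * l z) + (K g z - l z))
          \<le> bloch_norm v (\<lambda>z. K S z - of_nat N * l z) + bloch_norm v (\<lambda>z. K g z - l z)"
        by (intro bloch_add bloch_diff bloch_cmul v Kb Sb gb lb)
      ultimately show ?thesis
        using S(4) g(2) by (simp add: algebra_simps)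
    qed
    moreover have "(\<lambda>z. S z + g z) \<in> little_bloch v"
      using g(1) by (intro little_bloch_add v S) (simp add: bad_def)
    moreover have "S 0 + g 0 = 0"
      using S(2) g(1) by (simp add: bad_def)
    ultimately show ?case
      by (intro bexI[of _ "\<lambda>z. S z + g z"]) (auto simp: \<epsilon>_def)
  qed
  have bK: "bounded_operator v K"
    by (rule compact_imp_bounded_operator[OF v K])
  define k0 where "k0 = operator_norm v v K"
  have k0: "0 \<le> k0"
    unfolding k0_def by (rule operator_norm_nonneg[OF v bK])
  have "real N * (e / 2) \<le> 2 * k0" for N
  proof -
    obtain S where S: "S \<in> little_bloch v" "bloch_norm v S \<le> 2 - 1 / 2 ^ N"
      "bloch_norm v (\<lambda>z. K S z - of_nat N * l z) \<le> real N * (e / 4)"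
      using sums by blast
    have Sb: "S \<in> bloch v"
      using S by (simp add: little_bloch_def)
    have "bloch_norm v (K S) \<le> k0 * bloch_norm v S"
      unfolding k0_def by (rule operator_norm_upper[OF v bK Sb])
    also have "\<dots> \<le> k0 * 2"
      using S(2) k0 by (intro mult_left_mono) (auto intro: order_trans)
    finally have 1: "bloch_norm v (K S) \<le> 2 * k0"
      by simp
    have "bloch_norm v (\<lambda>z. K S z - (K S z - of_nat N * l z))
        \<le> bloch_norm v (K S) + bloch_norm v (\<lambda>z. K S z - of_nat N * l z)"
      by (intro bloch_diff bloch_cmul v Kb Sb lb)
    then have "real N * bloch_norm v l \<le> 2 * k0 + real N * (e / 4)"
      using 1 S(3) bloch_cmul(2)[OF v lb, of "of_nat N"] by simp
    moreover have "real N * (3 * e / 4) \<le> real N * bloch_norm v l"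
      using l_large by (intro mult_left_mono) auto
    ultimately show ?thesis
      by (simp add: algebra_simps)
  qed
  moreover obtain N :: nat where "2 * k0 / (e / 2) < real N"
    using reals_Archimedean2 by blast
  ultimately show False
    using e by (auto simp: field_simps) (smt (verit))
qed

section \<open>Test functions\<close>

text \<open>
The polynomials have nonnegative coefficients, so \<open>|H_test N z| \<le> h_test N |z|\<close>, and likewise for the
derivative with \<open>h_test'\<close>. The coefficients \<open>1/(k ln (k+1))\<close> are those for which the sum at \<open>1\<close> grows
like \<open>ln (ln N)\<close> while the derivative grows no faster than \<open>1/v\<close>.
\<close>

definition H_test :: "nat \<Rightarrow> complex \<Rightarrow> complex" where
  "H_test N z = (\<Sum>k=1..N. z ^ k / of_real (real k * ln (real k + 1)))"

definition h_test :: "nat \<Rightarrow> real \<Rightarrow> real" where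
  "h_test N r = (\<Sum>k=1..N. r ^ k / (real k * ln (real k + 1)))"

definition h_test' :: "nat \<Rightarrow> real \<Rightarrow> real" where
  "h_test' N r = (\<Sum>k=1..N. r ^ (k - 1) / ln (real k + 1))"

lemma ln_Suc_ge: "1 \<le> k \<Longrightarrow> 1 / 2 \<le> ln (real k + 1)"
  using ln2_ge_two_thirds ln_mono[of 2 "real k + 1"] by linarith

lemma norm_H_test: "cmod (H_test N z) \<le> h_test N (cmod z)"
  unfolding H_test_def h_test_def
proof (rule sum_norm_le)
  fix k assume "k \<in> {1..N}"
  then have "0 < real k * ln (real k + 1)"
    by (intro mult_pos_pos) auto
  then show "cmod (z ^ k / of_real (real k * ln (real k + 1))) \<le> cmod z ^ k / (real k * ln (real k + 1))"
    by (simp only: norm_divide norm_power norm_of_real abs_of_pos order_refl)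
qed

lemma H_test_of_real: "H_test N (of_real r) = of_real (h_test N r)"
  by (simp add: H_test_def h_test_def)

lemma H_test_deriv:
  obtains d where "(H_test N has_field_derivative d) (at z)" "cmod d \<le> h_test' N (cmod z)"
proof
  show "(H_test N has_field_derivative (\<Sum>k=1..N. z ^ (k - 1) / of_real (ln (real k + 1)))) (at z)"
    unfolding H_test_def
  proof (rule DERIV_sum)
    fix k assume k: "k \<in> {1..N}"
    have "((\<lambda>z. z ^ k / of_real (real k * ln (real k + 1))) has_field_derivative
        (of_nat k * z ^ (k - 1)) / of_real (real k * ln (real k + 1))) (at z)"
      by (intro DERIV_cdivide) (auto intro!: derivative_eq_intros)
    moreover have "(of_nat k * z ^ (k - 1)) / of_real (real k * ln (real k + 1))
        = z ^ (k - 1) / complex_of_real (ln (real k + 1))"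
      using k by simp
    ultimately show "((\<lambda>z. z ^ k / of_real (real k * ln (real k + 1))) has_field_derivative
        z ^ (k - 1) / of_real (ln (real k + 1))) (at z)"
      by simp
  qed
  show "cmod (\<Sum>k=1..N. z ^ (k - 1) / of_real (ln (real k + 1))) \<le> h_test' N (cmod z)"
    unfolding h_test'_def
  proof (rule sum_norm_le)
    fix k assume "k \<in> {1..N}"
    then have "0 < ln (real k + 1)"
      by auto
    then show "cmod (z ^ (k - 1) / of_real (ln (real k + 1))) \<le> cmod z ^ (k - 1) / ln (real k + 1)"
      by (simp only: norm_divide norm_power norm_of_real abs_of_pos order_refl)
  qed
qed

lemma h_test_nonneg: "0 \<le> r \<Longrightarrow> 0 \<le> h_test N r"
  unfolding h_test_def by (intro sum_nonneg divide_nonneg_nonneg mult_nonneg_nonneg) auto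

lemma h_test'_nonneg: "0 \<le> r \<Longrightarrow> 0 \<le> h_test' N r"
  unfolding h_test'_def by (intro sum_nonneg divide_nonneg_nonneg) auto

lemma h_test_mono: "0 \<le> r \<Longrightarrow> r \<le> s \<Longrightarrow> h_test N r \<le> h_test N s"
  unfolding h_test_def by (intro sum_mono divide_right_mono power_mono mult_nonneg_nonneg) auto

lemma h_test'_mono: "0 \<le> r \<Longrightarrow> r \<le> s \<Longrightarrow> h_test' N r \<le> h_test' N s"
  unfolding h_test'_def by (intro sum_mono divide_right_mono power_mono) auto

lemma sum_power_le:
  fixes s :: real
  assumes "0 \<le> s" "s < 1"
  shows "(\<Sum>k=1..N. s ^ (k - 1)) \<le> 1 / (1 - s)"
proof -
  have "(\<Sum>k=1..N. s ^ (k - 1)) = (\<Sum>k<N. s ^ k)"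
    by (rule sum.reindex_bij_witness[of _ Suc "\<lambda>k. k - 1"]) auto
  also have "\<dots> = (1 - s ^ N) / (1 - s)"
    using one_diff_power_eq[of s N] assms by (simp add: field_simps)
  also have "\<dots> \<le> 1 / (1 - s)"
    using assms by (intro divide_right_mono) auto
  finally show ?thesis .
qed

lemma h_test_le:
  assumes "0 \<le> s" "s < 1"
  shows "h_test N s \<le> 2 / (1 - s)"
proof -
  have "h_test N s \<le> (\<Sum>k=1..N. 2 * s ^ (k - 1))"
    unfolding h_test_def
  proof (rule sum_mono)
    fix k assume k: "k \<in> {1..N}"
    have "1 * (1 / 2) \<le> real k * ln (real k + 1)"
      using k ln_Suc_ge[of k] by (intro mult_mono) auto
    then have "s ^ k / (real k * ln (real k + 1)) \<le> s ^ k / (1 / 2)"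
      using assms by (intro divide_left_mono) auto
    also have "\<dots> \<le> 2 * s ^ (k - 1)"
      using assms by (simp add: power_decreasing)
    finally show "s ^ k / (real k * ln (real k + 1)) \<le> 2 * s ^ (k - 1)" .
  qed
  also have "\<dots> = 2 * (\<Sum>k=1..N. s ^ (k - 1))"
    by (simp add: sum_distrib_left)
  also have "\<dots> \<le> 2 * (1 / (1 - s))"
    by (intro mult_left_mono sum_power_le assms) auto
  finally show ?thesis
    by simp
qed

text \<open>
Let \<open>x = 1 - r\<close>. For \<open>k > 1/\<surd>x\<close> one has \<open>(k+1)\<^sup>4 \<ge> 2/x\<close>, so the logarithm in the denominator is at
least a quarter of \<open>ln (2/x)\<close> and the geometric series gives \<open>4/(x ln (2/x))\<close>. The at most \<open>1/\<surd>x\<close>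
remaining terms are at most \<open>2\<close> each, and \<open>\<surd>x ln (2/x)\<close> is bounded.
\<close>

lemma log_weight_h_test':
  assumes r: "0 \<le> r" "r < 1"
  shows "log_weight r * h_test' N r \<le> 10"
proof -
  define x where "x = 1 - r"
  have x: "0 < x" "x \<le> 1"
    using r by (auto simp: x_def)
  define y where "y = 1 / sqrt x"
  have y: "0 < y" "y * y = 1 / x"
    using x by (auto simp: y_def)
  define l where "l = ln (2 / x)"
  have l: "0 < l"
    using x by (auto simp: l_def field_simps)
  have "h_test' N r \<le> (\<Sum>k=1..N. (if real k \<le> y then 2 else 0) + 4 / l * r ^ (k - 1))"
    unfolding h_test'_def
  proof (rule sum_mono)
    fix k assume k: "k \<in> {1..N}"
    then have lk: "1 / 2 \<le> ln (real k + 1)"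
      by (intro ln_Suc_ge) auto
    show "r ^ (k - 1) / ln (real k + 1) \<le> (if real k \<le> y then 2 else 0) + 4 / l * r ^ (k - 1)"
    proof (cases "real k \<le> y")
      case True
      have "r ^ (k - 1) / ln (real k + 1) \<le> 1 / (1 / 2)"
        using lk r by (intro frac_le power_le_one) auto
      moreover have "0 \<le> 4 / l * r ^ (k - 1)"
        using l r by simp
      ultimately show ?thesis
        using True by simp
    next
      case False
      have k1: "1 \<le> real k"
        using k by simp
      have "4 \<le> (real k + 1) * (real k + 1)"
        using k1 mult_mono[of 2 "real k + 1" 2 "real k + 1"] by simp
      moreover have "1 / x \<le> (real k + 1) * (real k + 1)"
        using False y k1 mult_mono[of y "real k + 1" y "real k + 1"] by simp
      ultimately have "4 * (1 / x) \<le> ((real k + 1) * (real k + 1)) * ((real k + 1) * (real k + 1))"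
        using x by (intro mult_mono) auto
      then have "2 / x \<le> (real k + 1) ^ 4"
        using x by (simp add: power4_eq_xxxx divide_simps mult.assoc split: if_splits)
      then have "l \<le> ln ((real k + 1) ^ 4)"
        unfolding l_def using x by (intro ln_mono) auto
      then have "l \<le> 4 * ln (real k + 1)"
        using ln_realpow[of "real k + 1" 4] by simp
      moreover have "0 < ln (real k + 1)"
        using lk by linarith
      ultimately have "1 / ln (real k + 1) \<le> 4 / l"
        using l by (simp add: field_simps)
      then have "r ^ (k - 1) * (1 / ln (real k + 1)) \<le> r ^ (k - 1) * (4 / l)"
        using r by (intro mult_left_mono) auto
      then show ?thesis
        using False by (simp add: mult.commute)
    qed
  qed
  also have "\<dots> = (\<Sum>k=1..N. if real k \<le> y then 2 else 0) + 4 / l * (\<Sum>k=1..N. r ^ (k - 1))"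
    by (simp add: sum.distrib sum_distrib_left)
  also have "(\<Sum>k=1..N. if real k \<le> y then 2 else 0) \<le> 2 * y"
  proof -
    have "(\<Sum>k=1..N. if real k \<le> y then 2 else (0::real)) = 2 * real (card {k \<in> {1..N}. real k \<le> y})"
      by (subst sum.inter_filter[symmetric]) simp_all
    also have "card {k \<in> {1..N}. real k \<le> y} \<le> card {1..nat \<lfloor>y\<rfloor>}"
      by (intro card_mono subsetI) (simp_all add: le_nat_floor)
    then have "2 * real (card {k \<in> {1..N}. real k \<le> y}) \<le> 2 * real (nat \<lfloor>y\<rfloor>)"
      by simp
    also have "\<dots> \<le> 2 * y"
      using y by simp
    finally show ?thesis .
  qed
  also have "4 / l * (\<Sum>k=1..N. r ^ (k - 1)) \<le> 4 / l * (1 / x)"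
    unfolding x_def using l by (intro mult_left_mono sum_power_le r) auto
  finally have "h_test' N r \<le> 2 * y + 4 / l * (1 / x)"
    by simp
  then have "x * l * h_test' N r \<le> x * l * (2 * y + 4 / l * (1 / x))"
    using x l by (intro mult_left_mono) auto
  also have "\<dots> = 2 * (sqrt x * l) + 4"
  proof -
    have "x * y = sqrt x"
      using x by (simp add: y_def real_div_sqrt)
    then show ?thesis
      using x l by (simp add: field_simps)
  qed
  also have "sqrt x * l \<le> sqrt x * (2 * sqrt (2 / x))"
    unfolding l_def using x by (intro mult_left_mono ln_le_2_sqrt) auto
  also have "\<dots> = 2 * sqrt 2"
    using x by (simp add: real_sqrt_divide)
  also have "2 * (2 * sqrt 2) + 4 \<le> 10"
    using real_le_lsqrt[of "3 / 2" 2] by (simp add: power2_eq_square)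
  finally show ?thesis
    by (simp add: log_weight_def x_def l_def)
qed

text \<open>
The partial sums dominate the telescoping sum of \<open>ln (ln (k+2)) - ln (ln (k+1)) \<le> 1/((k+1) ln (k+1))\<close>.
\<close>

lemma lnln_le_h_test:
  assumes "1 \<le> N"
  shows "ln (ln (8 * real (N + 1))) \<le> 3 * h_test N 1"
proof -
  have tele: "ln (ln (real n + 2)) - ln (ln 2) \<le> h_test n 1" for n
  proof (induction n)
    case 0
    show ?case
      by (simp add: h_test_def)
  next
    case (Suc n)
    define x where "x = real n + 2"
    have x: "2 \<le> x"
      by (simp add: x_def)
    have lx: "0 < ln x"
      using x by simp
    have "ln (x + 1) = ln x + ln (1 + 1 / x)"
    proof -
      have "x + 1 = x * (1 + 1 / x)"
        using x by (simp add: field_simps)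
      moreover have "0 < 1 + 1 / x"
        using x by (simp add: add_pos_pos)
      ultimately show ?thesis
        using x by (simp add: ln_mult)
    qed
    also have "\<dots> \<le> ln x + 1 / x"
      using ln_add_one_self_le_self[of "1 / x"] x by simp
    also have "\<dots> = ln x * (1 + 1 / (x * ln x))"
      using lx x by (simp add: field_simps)
    finally have "ln (x + 1) \<le> ln x * (1 + 1 / (x * ln x))" .
    then have "ln (ln (x + 1)) \<le> ln (ln x * (1 + 1 / (x * ln x)))"
      using x by (intro ln_mono) auto
    also have "\<dots> = ln (ln x) + ln (1 + 1 / (x * ln x))"
    proof -
      have "0 < 1 + 1 / (x * ln x)"
        using lx x by (intro add_pos_pos divide_pos_pos mult_pos_pos) auto
      then show ?thesis
        using lx by (intro ln_mult_pos)
    qed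
    also have "\<dots> \<le> ln (ln x) + 1 / (x * ln x)"
      using ln_add_one_self_le_self[of "1 / (x * ln x)"] x lx by simp
    also have "1 / (x * ln x) \<le> 1 / (real (Suc n) * ln (real (Suc n) + 1))"
      using lx by (intro divide_left_mono mult_mono mult_pos_pos) (auto simp: x_def)
    finally show ?case
      using Suc by (simp add: h_test_def x_def add.commute add.left_commute)
  qed
  have ln2: "0 < ln (2::real)" "ln (2::real) \<le> 1"
    using ln_le_minus_one[of "2::real"] by auto
  have "h_test 1 1 \<le> h_test N 1"
    unfolding h_test_def using assms by (intro sum_mono2) auto
  moreover have "h_test 1 1 = 1 / ln 2"
    by (simp add: h_test_def)
  moreover have "1 \<le> 1 / ln (2::real)"
    using ln2 by simp
  ultimately have h1: "1 \<le> h_test N 1"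
    by linarith
  have "ln (8 * real (N + 1)) \<le> ln (8 * (real N + 2))"
    by (intro ln_mono) auto
  also have "\<dots> = ln (2 ^ 3) + ln (real N + 2)"
    using ln_mult_pos[of 8 "real N + 2"] by simp
  also have "\<dots> = 3 * ln 2 + ln (real N + 2)"
    using ln_realpow[of "2::real" 3] by simp
  also have "\<dots> \<le> 4 * ln (real N + 2)"
    using ln_mono[of 2 "real N + 2"] by simp
  finally have 1: "ln (8 * real (N + 1)) \<le> 4 * ln (real N + 2)" .
  have "0 < ln (real N + 2)" "0 < ln (8 * real (N + 1))"
    by (auto intro!: ln_gt_zero)
  then have "ln (ln (8 * real (N + 1))) \<le> ln 4 + ln (ln (real N + 2))"
    using 1 ln_mono[of "ln (8 * real (N + 1))" "4 * ln (real N + 2)"] by (simp add: ln_mult)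
  also have "\<dots> \<le> 2 + h_test N 1"
  proof -
    have "ln (4::real) = 2 * ln 2"
      using ln_realpow[of "2::real" 2] by simp
    moreover have "ln (ln (2::real)) \<le> 0"
      using ln2 by simp
    ultimately show ?thesis
      using tele[of N] ln2 by linarith
  qed
  finally show ?thesis
    using h1 by linarith
qed

lemma loglog_at_top:
  assumes "0 < X"
  obtains t where "0 < t" "t < 1" "\<And>a. t < a \<Longrightarrow> a < 1 \<Longrightarrow> X \<le> loglog a"
proof
  define t where "t = 1 - exp (- exp X) / 2"
  have "exp (- exp X) < 1"
    by simp
  then have "exp (- exp X) / 2 < 1"
    by linarith
  then show "0 < t" "t < 1"
    by (simp_all add: t_def)
  show "X \<le> loglog a" if a: "t < a" "a < 1" for a
  proof -
    have a0: "0 < a"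
      using a \<open>0 < t\<close> by simp
    have a2: "a\<^sup>2 < 1"
      using a a0 by (simp add: abs_square_less_1)
    have "1 - a\<^sup>2 = (1 - a) * (1 + a)"
      by (simp add: power2_eq_square algebra_simps)
    also have "\<dots> \<le> (1 - a) * 2"
      using a by (intro mult_left_mono) auto
    also have "\<dots> \<le> exp (- exp X)"
      using a by (simp add: t_def)
    finally have "1 - a\<^sup>2 \<le> exp (- exp X)" .
    then have "1 / exp (- exp X) \<le> 4 / (1 - a\<^sup>2)"
      using a2 by (intro frac_le) auto
    then have "exp (exp X) \<le> 4 / (1 - a\<^sup>2)"
      by (simp add: exp_minus field_simps)
    then have "exp X \<le> ln (4 / (1 - a\<^sup>2))"
      using a2 by (simp add: ln_ge_iff)
    then show ?thesis
      unfolding loglog_def by (subst ln_ge_iff) (auto intro: less_le_trans[OF exp_gt_zero])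
  qed
qed

text \<open>
With \<open>\<omega>\<close> the rotation that takes \<open>a\<close> to \<open>|a|\<close>, \<open>N\<close> the index of \<open>scale_near_1\<close> for \<open>|a|\<close> and
\<open>h\<^sub>1 = h_test N 1\<close>, the function is \<open>H_test N (\<omega> z)\<^sup>2 / (20 h\<^sub>1)\<close>. Squaring and dividing by \<open>h\<^sub>1\<close> keeps the
norm bounded and the value at \<open>a\<close> of size \<open>h\<^sub>1\<close>, and on a fixed smaller disk, where \<open>h_test N\<close> is bounded
independently of \<open>N\<close>, it produces the factor \<open>1/h\<^sub>1\<close>, which tends to \<open>0\<close> as \<open>|a|\<close> tends to \<open>1\<close>. The
\<open>20\<close> is twice the bound of \<open>log_weight_h_test'\<close> and makes the norm at most \<open>1\<close>.
\<close>

lemma test_functions: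
  assumes s: "0 \<le> s" "s < 1" and \<delta>: "0 < \<delta>"
  obtains t where "0 < t" "t < 1"
    "\<And>a. t < cmod a \<Longrightarrow> cmod a < 1 \<Longrightarrow> \<exists>f\<in>little_bloch v_log. f 0 = 0 \<and> bloch_norm v_log f \<le> 1 \<and>
      (\<forall>z. cmod z \<le> s \<longrightarrow> v_log z * cmod (deriv f z) \<le> \<delta>) \<and> loglog (cmod a) \<le> 240 * cmod (f a)"
proof -
  define X where "X = 6 / ((1 - s) * \<delta>)"
  have X: "0 < X"
    using s \<delta> by (simp add: X_def)
  obtain t0 where t0: "0 < t0" "t0 < 1" "\<And>a. t0 < a \<Longrightarrow> a < 1 \<Longrightarrow> X \<le> loglog a"
    using loglog_at_top[OF X] by blast
  show thesis
  proof (rule that[of "max t0 (1 / 2)"])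
    show "0 < max t0 (1 / 2)" "max t0 (1 / 2) < 1"
      using t0 by auto
    fix a :: complex assume a: "max t0 (1 / 2) < cmod a" "cmod a < 1"
    define \<rho> where "\<rho> = cmod a"
    have \<rho>: "0 \<le> \<rho>" "\<rho> < 1" "1 / 2 < \<rho>" "X \<le> loglog \<rho>"
      using a t0(3) by (auto simp: \<rho>_def)
    obtain N where N: "0 < N" "2 * real N * (1 - \<rho>) \<le> 1" "1 < 2 * real (N + 1) * (1 - \<rho>)"
      using scale_near_1[of \<rho> 0] \<rho> by auto
    define h1 where "h1 = h_test N 1"
    have "loglog \<rho> \<le> ln (ln (8 * real (N + 1)))"
      by (rule loglog_le_scale[OF \<rho>(1,2) N(3)])
    also have "\<dots> \<le> 3 * h1"
      unfolding h1_def using N by (intro lnln_le_h_test) auto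
    finally have lh: "loglog \<rho> \<le> 3 * h1" .
    have h1: "0 < h1"
      using lh loglog_pos[OF \<rho>(1,2)] by linarith
    define \<omega> where "\<omega> = cnj a / of_real \<rho>"
    have \<omega>: "cmod \<omega> = 1" "\<omega> * a = of_real \<rho>"
    proof -
      show "cmod \<omega> = 1"
        using \<rho> by (simp add: \<omega>_def norm_divide) (simp add: \<rho>_def)
      have "cnj a * a = of_real (\<rho> * \<rho>)"
        using complex_norm_square[of a] by (simp add: \<rho>_def power2_eq_square mult.commute)
      then show "\<omega> * a = of_real \<rho>"
        using \<rho> by (simp add: \<omega>_def)
    qed
    define g where "g z = (H_test N (\<omega> * z))\<^sup>2 / of_real (20 * h1)" for z
    define f where "f = on_disk g"
    have gd: "\<exists>d. (g has_field_derivative d) (at z) \<and> cmod d \<le> h_test N (cmod z) * h_test' N (cmod z) / (10 * h1)" for z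
    proof -
      obtain d where d: "(H_test N has_field_derivative d) (at (\<omega> * z))" "cmod d \<le> h_test' N (cmod (\<omega> * z))"
        by (rule H_test_deriv)
      have "((\<lambda>z. H_test N (\<omega> * z)) has_field_derivative d * \<omega>) (at z)"
        by (rule DERIV_chain2[where f = "H_test N" and g = "\<lambda>z. \<omega> * z", OF d(1)])
           (auto intro!: derivative_eq_intros)
      then have 1: "(g has_field_derivative (2 * (H_test N (\<omega> * z) * (d * \<omega>))) / of_real (20 * h1)) (at z)"
        unfolding g_def by (intro DERIV_cdivide) (auto intro!: derivative_eq_intros)
      have "cmod (2 * (H_test N (\<omega> * z) * (d * \<omega>)) / of_real (20 * h1))
          = cmod (H_test N (\<omega> * z)) * cmod d / (10 * h1)"
        using h1 \<omega> by (simp add: norm_mult norm_divide)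
      also have "\<dots> \<le> h_test N (cmod z) * h_test' N (cmod z) / (10 * h1)"
        using d(2) norm_H_test[of N "\<omega> * z"] h1 \<omega> h_test_nonneg[of "cmod z" N]
        by (intro divide_right_mono mult_mono) (auto simp: norm_mult)
      finally show ?thesis
        using 1 by blast
    qed
    have "g holomorphic_on unit_disk"
      unfolding holomorphic_on_open[OF open_ball] using gd by blast
    then have fh: "f \<in> hol_disk"
      unfolding f_def by (rule on_disk_hol_disk)
    have fd: "cmod (deriv f z) \<le> h_test N (cmod z) * h_test' N (cmod z) / (10 * h1)" if z: "z \<in> unit_disk" for z
    proof -
      obtain d where d: "(g has_field_derivative d) (at z)"
          "cmod d \<le> h_test N (cmod z) * h_test' N (cmod z) / (10 * h1)"
        using gd by blast
      have "deriv f z = d"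
        unfolding f_def by (rule DERIV_imp_deriv[OF on_disk_DERIV[OF z d(1)]])
      then show ?thesis
        using d by simp
    qed
    have vfd: "v_log z * cmod (deriv f z) \<le> h_test N (cmod z) / h1" if z: "z \<in> unit_disk" for z
    proof -
      have "v_log z * cmod (deriv f z) \<le> log_weight (cmod z) * (h_test N (cmod z) * h_test' N (cmod z) / (10 * h1))"
        unfolding v_log_eq using fd[OF z] log_weight_pos[of "cmod z"] z by (intro mult_left_mono) auto
      also have "\<dots> = (log_weight (cmod z) * h_test' N (cmod z)) * (h_test N (cmod z) / (10 * h1))"
        by simp
      also have "\<dots> \<le> 10 * (h_test N (cmod z) / (10 * h1))"
        using z h1 h_test_nonneg[of "cmod z" N] by (intro mult_right_mono log_weight_h_test') auto
      finally show ?thesis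
        by simp
    qed
    have f0: "f 0 = 0"
      by (simp add: f_def on_disk_def g_def H_test_def power_0_left)
    show "\<exists>f\<in>little_bloch v_log. f 0 = 0 \<and> bloch_norm v_log f \<le> 1 \<and>
      (\<forall>z. cmod z \<le> s \<longrightarrow> v_log z * cmod (deriv f z) \<le> \<delta>) \<and> loglog (cmod a) \<le> 240 * cmod (f a)"
    proof (intro bexI[of _ f] conjI allI impI)
      show "f \<in> little_bloch v_log"
      proof (rule little_bloch_v_logI[OF fh])
        fix z :: complex assume z: "z \<in> unit_disk"
        have "h_test N (cmod z) * h_test' N (cmod z) / (10 * h1) \<le> h_test N 1 * h_test' N 1 / (10 * h1)"
          using z h1 by (intro divide_right_mono mult_mono h_test_mono h_test'_mono h_test_nonneg h_test'_nonneg) auto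
        then show "cmod (deriv f z) \<le> h_test N 1 * h_test' N 1 / (10 * h1)"
          using fd[OF z] by linarith
      qed
      show "f 0 = 0"
        by (rule f0)
      have "bloch_norm v_log f \<le> cmod (f 0) + 1"
      proof (rule bloch_norm_le)
        fix z :: complex assume z: "z \<in> unit_disk"
        have "h_test N (cmod z) / h1 \<le> h_test N 1 / h1"
          using z h1 by (intro divide_right_mono h_test_mono) auto
        moreover have "h_test N 1 / h1 = 1"
          using h1 by (simp add: h1_def)
        ultimately show "v_log z * cmod (deriv f z) \<le> 1"
          using vfd[OF z] by linarith
      qed
      then show "bloch_norm v_log f \<le> 1"
        using f0 by simp
      show "v_log z * cmod (deriv f z) \<le> \<delta>" if z: "cmod z \<le> s" for z
      proof -
        have zD: "z \<in> unit_disk"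
          using z s by simp
        have "X \<le> 3 * h1"
          using lh \<rho>(4) by linarith
        then have "6 \<le> 3 * h1 * ((1 - s) * \<delta>)"
          using s \<delta> by (simp add: X_def field_simps)
        then have "2 / (1 - s) \<le> \<delta> * h1"
          using s by (simp add: field_simps)
        moreover have "h_test N (cmod z) \<le> h_test N s"
          using z by (intro h_test_mono) auto
        ultimately have "h_test N (cmod z) \<le> \<delta> * h1"
          using h_test_le[OF s, of N] by linarith
        then have "h_test N (cmod z) / h1 \<le> \<delta>"
          using h1 by (simp add: field_simps)
        then show ?thesis
          using vfd[OF zD] by linarith
      qed
      show "loglog (cmod a) \<le> 240 * cmod (f a)"
      proof -
        have "1 / 2 * h1 \<le> \<rho> ^ N * h1"
          using power_ge_half[OF \<rho>(1) N(2)] h1 by (intro mult_right_mono) auto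
        also have "\<dots> \<le> h_test N \<rho>"
          unfolding h1_def h_test_def sum_distrib_left
        proof (rule sum_mono)
          fix k assume k: "k \<in> {1..N}"
          have "\<rho> ^ N \<le> \<rho> ^ k"
            using \<rho> k by (intro power_decreasing) auto
          then have "\<rho> ^ N / (real k * ln (real k + 1)) \<le> \<rho> ^ k / (real k * ln (real k + 1))"
            by (intro divide_right_mono mult_nonneg_nonneg) auto
          then show "\<rho> ^ N * (1 ^ k / (real k * ln (real k + 1))) \<le> \<rho> ^ k / (real k * ln (real k + 1))"
            by simp
        qed
        finally have "(1 / 2 * h1)\<^sup>2 \<le> (h_test N \<rho>)\<^sup>2"
          using h1 by (intro power_mono) auto
        then have "(1 / 2 * h1)\<^sup>2 / (20 * h1) \<le> (h_test N \<rho>)\<^sup>2 / (20 * h1)"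
          using h1 by (intro divide_right_mono) auto
        moreover have "(1 / 2 * h1)\<^sup>2 / (20 * h1) = h1 / 80"
          using h1 by (simp add: power2_eq_square)
        moreover have "cmod (f a) = (h_test N \<rho>)\<^sup>2 / (20 * h1)"
        proof -
          have "f a = of_real ((h_test N \<rho>)\<^sup>2 / (20 * h1))"
            using a by (simp add: f_def on_disk_def g_def \<omega> H_test_of_real)
          then show ?thesis
            using h1 by (simp only: norm_of_real) simp
        qed
        ultimately have "h1 \<le> 80 * cmod (f a)"
          by linarith
        then show ?thesis
          using lh by (simp add: \<rho>_def)
      qed
    qed
  qed
qed

section \<open>The lower estimate\<close>

context weighted_composition
begin

lemma W_deriv_ge:
  assumes h: "h \<in> hol_disk" and z: "z \<in> unit_disk"
  shows "B z * cmod (deriv h (\<phi> z)) \<le> v_log z * cmod (deriv (W_op u \<phi> h) z) + A z * cmod (h (\<phi> z))"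
    and "A z * cmod (h (\<phi> z)) \<le> v_log z * cmod (deriv (W_op u \<phi> h) z) + B z * cmod (deriv h (\<phi> z))"
proof -
  define p q where "p = deriv u z * h (\<phi> z)" and "q = u z * (deriv \<phi> z * deriv h (\<phi> z))"
  have d: "deriv (W_op u \<phi> h) z = p + q"
    unfolding p_def q_def by (rule W_deriv(2)[OF h z])
  have "cmod q \<le> cmod (p + q) + cmod p" "cmod p \<le> cmod (p + q) + cmod q"
    by (metis add_diff_cancel_left' add_diff_cancel_right' norm_triangle_ineq4)+
  then have "v_log z * cmod q \<le> v_log z * (cmod (p + q) + cmod p)"
    "v_log z * cmod p \<le> v_log z * (cmod (p + q) + cmod q)"
    using weight_pos[OF is_weight_v_log z] by auto
  moreover have "v_log z * cmod p = A z * cmod (h (\<phi> z))" "v_log z * cmod q = B z * cmod (deriv h (\<phi> z))"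
    by (simp_all add: p_def q_def A_def B_def norm_mult)
  ultimately show "B z * cmod (deriv h (\<phi> z)) \<le> v_log z * cmod (deriv (W_op u \<phi> h) z) + A z * cmod (h (\<phi> z))"
    "A z * cmod (h (\<phi> z)) \<le> v_log z * cmod (deriv (W_op u \<phi> h) z) + B z * cmod (deriv h (\<phi> z))"
    by (simp_all add: d distrib_left)
qed

lemma W_small:
  assumes K: "compact_linear_operator v_log v_log K" and e: "0 < e"
  defines "E \<equiv> operator_norm v_log v_log (\<lambda>f z. W_op u \<phi> f z - K f z)"
  obtains s \<delta> where "0 < s" "s < 1" "0 < \<delta>"
    "\<And>f z. f \<in> little_bloch v_log \<Longrightarrow> f 0 = 0 \<Longrightarrow> bloch_norm v_log f \<le> 1 \<Longrightarrow>
      (\<forall>z. cmod z \<le> s \<longrightarrow> v_log z * cmod (deriv f z) \<le> \<delta>) \<Longrightarrow> z \<in> unit_disk \<Longrightarrow>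
      v_log z * cmod (deriv (W_op u \<phi> f) z) \<le> E + e"
proof -
  obtain s \<delta> where s: "s < 1" and \<delta>: "0 < \<delta>" and
    *: "\<And>f. f \<in> little_bloch v_log \<Longrightarrow> f 0 = 0 \<Longrightarrow> bloch_norm v_log f \<le> 1 \<Longrightarrow>
      (\<forall>z. cmod z \<le> s \<longrightarrow> v_log z * cmod (deriv f z) \<le> \<delta>) \<Longrightarrow> bloch_norm v_log (K f) \<le> e"
    using compact_operator_small[OF is_weight_v_log K e] by blast
  have Kb: "bounded_operator v_log K"
    by (rule compact_imp_bounded_operator[OF is_weight_v_log K])
  note Tb = bounded_operator_sub[OF is_weight_v_log W_bounded Kb]
  have E0: "0 \<le> E"
    unfolding E_def by (rule operator_norm_nonneg[OF is_weight_v_log Tb])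
  show thesis
  proof (rule that[of "max s (1 / 2)" \<delta>])
    fix f z assume f: "f \<in> little_bloch v_log" "f 0 = 0" "bloch_norm v_log f \<le> 1"
      "\<forall>z. cmod z \<le> max s (1 / 2) \<longrightarrow> v_log z * cmod (deriv f z) \<le> \<delta>" and z: "z \<in> unit_disk"
    have fb: "f \<in> bloch v_log"
      using f by (simp add: little_bloch_def)
    have Kf: "K f \<in> bloch v_log"
      using Kb fb by (simp add: bounded_operator_def linear_operator_def)
    have 1: "bloch_norm v_log (K f) \<le> e"
      using f by (intro *) auto
    have "bloch_norm v_log (\<lambda>z. W_op u \<phi> f z - K f z) \<le> E * bloch_norm v_log f"
      unfolding E_def by (rule operator_norm_upper[OF is_weight_v_log Tb fb])
    also have "\<dots> \<le> E * 1"
      using E0 f by (intro mult_left_mono) auto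
    finally have 2: "bloch_norm v_log (\<lambda>z. W_op u \<phi> f z - K f z) \<le> E"
      by simp
    have "bloch_norm v_log (\<lambda>z. (W_op u \<phi> f z - K f z) + K f z)
        \<le> bloch_norm v_log (\<lambda>z. W_op u \<phi> f z - K f z) + bloch_norm v_log (K f)"
      by (intro bloch_add bloch_diff is_weight_v_log W_bloch fb Kf)
    then have "bloch_norm v_log (W_op u \<phi> f) \<le> E + e"
      using 1 2 by simp
    then show "v_log z * cmod (deriv (W_op u \<phi> f) z) \<le> E + e"
      using bloch_norm_ge_deriv[OF W_bloch[OF fb] z] by linarith
  qed (use s \<delta> in auto)
qed

text \<open>
The test functions are \<open>z\<^sup>n / \<mu>\<close>, where \<open>\<mu>\<close> is the norm of \<open>z\<^sup>n\<close>. Their values are at most \<open>1/\<mu>\<close>, which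
tends to \<open>0\<close>, so only the term with \<open>B\<close> survives in the derivative of the image.
\<close>

lemma lower_I:
  assumes K: "compact_linear_operator v_log v_log K" and e: "0 < e"
  defines "E \<equiv> operator_norm v_log v_log (\<lambda>f z. W_op u \<phi> f z - K f z)"
  shows "eventually (\<lambda>n. bloch_norm v_log (I_op u (\<lambda>z. \<phi> z ^ n)) / bloch_norm v_log (monomial n) \<le> E + e) sequentially"
proof -
  have "0 < e / 2"
    using e by simp
  then obtain s \<delta> where s: "0 < s" "s < 1" "0 < \<delta>" and
    *: "\<And>f z. f \<in> little_bloch v_log \<Longrightarrow> f 0 = 0 \<Longrightarrow> bloch_norm v_log f \<le> 1 \<Longrightarrow>
      (\<forall>z. cmod z \<le> s \<longrightarrow> v_log z * cmod (deriv f z) \<le> \<delta>) \<Longrightarrow> z \<in> unit_disk \<Longrightarrow>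
      v_log z * cmod (deriv (W_op u \<phi> f) z) \<le> E + e / 2"
    using W_small[OF K, folded E_def] by blast
  obtain C where C: "0 < C" "\<And>z. z \<in> unit_disk \<Longrightarrow> A z \<le> C" "\<And>z. z \<in> unit_disk \<Longrightarrow> B z \<le> C"
    using AB_bounded by blast
  have "(\<lambda>n. real n * s ^ n) \<longlonglongrightarrow> 0"
    using powser_times_n_limit_0[of s] s by simp
  moreover have "0 < \<delta> * s / 16"
    using s by simp
  ultimately have ev1: "eventually (\<lambda>n. real n * s ^ n < \<delta> * s / 16) sequentially"
    by (rule order_tendstoD(2))
  have "filterlim (\<lambda>n. ln (4 * real n)) at_top sequentially"
    by real_asymp
  then have ev2: "eventually (\<lambda>n. 8 * C / e \<le> ln (4 * real n)) sequentially"
    by (simp add: filterlim_at_top)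
  show ?thesis
    using ev1 ev2 eventually_ge_at_top[of 1]
  proof eventually_elim
    case (elim n)
    define \<mu> where "\<mu> = bloch_norm v_log (monomial n)"
    have \<mu>: "0 < \<mu>" "ln (4 * real n) / 4 \<le> \<mu>"
      unfolding \<mu>_def by (rule monomial_norm_v_pos[OF elim(3)] monomial_norm_v_ge_ln[OF elim(3)])+
    have "ln 4 \<le> ln (4 * real n)"
      using elim(3) by (intro ln_mono) auto
    then have \<mu>1: "1 / 4 \<le> \<mu>"
      using \<mu>(2) ln4_gt_1 by linarith
    have \<mu>2: "C / \<mu> \<le> e / 2"
    proof -
      have "8 * C / e \<le> 4 * \<mu>"
        using elim(2) \<mu>(2) by linarith
      then show ?thesis
        using e \<mu>(1) by (simp add: field_simps)
    qed
    define c :: complex where "c = of_real (1 / \<mu>)"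
    have c: "cmod c = 1 / \<mu>"
      unfolding c_def norm_of_real using \<mu>(1) by simp
    define f where "f z = c * monomial n z" for z
    have fh: "f \<in> hol_disk"
      unfolding f_def by (intro hol_disk_cmul monomial_deriv)
    have fd: "cmod (deriv f z) = real n * cmod z ^ (n - 1) / \<mu>" if "z \<in> unit_disk" for z
    proof -
      have "deriv f z = c * deriv (monomial n) z"
        unfolding f_def by (intro DERIV_imp_deriv DERIV_cmult hol_disk_DERIV monomial_deriv that)
      then show ?thesis
        by (simp add: norm_mult c norm_monomial_deriv[OF that])
    qed
    have fl: "f \<in> little_bloch v_log"
    proof (rule little_bloch_v_logI[OF fh])
      fix z :: complex assume z: "z \<in> unit_disk"
      show "cmod (deriv f z) \<le> real n * 1 / \<mu>"
        unfolding fd[OF z] using z \<mu>(1)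
        by (intro divide_right_mono mult_left_mono power_le_one) auto
    qed
    have f0: "f 0 = 0"
      using elim(3) by (simp add: f_def monomial_0)
    have f1: "bloch_norm v_log f \<le> 1"
      using bloch_cmul(2)[OF is_weight_v_log monomial_bloch, of c n] \<mu>(1)
      by (simp add: f_def[abs_def] c \<mu>_def)
    have fs: "v_log z * cmod (deriv f z) \<le> \<delta>" if z: "cmod z \<le> s" for z
    proof -
      have zD: "z \<in> unit_disk"
        using z s by simp
      have "sqrt (1 - cmod z) \<le> 1"
        by simp
      moreover have "log_weight (cmod z) \<le> 4 * sqrt (1 - cmod z)"
        using zD by (intro log_weight_le_sqrt) simp
      ultimately have v4: "v_log z \<le> 4"
        unfolding v_log_eq by linarith
      have "real n * cmod z ^ (n - 1) / \<mu> \<le> real n * s ^ (n - 1) / (1 / 4)"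
        using z s \<mu>1 by (intro frac_le mult_left_mono power_mono) auto
      also have "\<dots> = 4 * (real n * s ^ n) / s"
        using s elim(3) by (cases n) (auto simp: field_simps)
      also have "\<dots> \<le> 4 * (\<delta> * s / 16) / s"
        using elim(1) s by (intro divide_right_mono mult_left_mono) auto
      also have "\<dots> = \<delta> / 4"
        using s by simp
      finally have "cmod (deriv f z) \<le> \<delta> / 4"
        by (simp add: fd[OF zD])
      then have "v_log z * cmod (deriv f z) \<le> 4 * (\<delta> / 4)"
        using v4 s by (intro mult_mono) auto
      then show ?thesis
        by simp
    qed
    have "bloch_norm v_log (I_op u (\<lambda>z. \<phi> z ^ n)) \<le> (E + e) * \<mu>"
    proof (rule I_norm(2))
      fix z assume z: "z \<in> unit_disk"
      have \<phi>z: "\<phi> z \<in> unit_disk"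
        using \<phi>_disk[OF z] by simp
      have "A z * cmod (f (\<phi> z)) \<le> C * (1 / \<mu>)"
      proof (rule mult_mono)
        show "cmod (f (\<phi> z)) \<le> 1 / \<mu>"
          using \<phi>z \<mu>(1) by (simp add: f_def norm_mult c monomial_def on_disk_def norm_power power_le_one divide_right_mono)
      qed (use C z in auto)
      moreover have "v_log z * cmod (deriv (W_op u \<phi> f) z) \<le> E + e / 2"
        using fs by (intro *[OF fl f0 f1 _ z]) auto
      moreover have "C * (1 / \<mu>) \<le> e / 2"
        using \<mu>2 by simp
      ultimately have "B z * cmod (deriv f (\<phi> z)) \<le> E + e"
        using W_deriv_ge(1)[OF fh z] by linarith
      then show "B z * (real n * cmod (\<phi> z) ^ (n - 1)) \<le> (E + e) * \<mu>"
        unfolding fd[OF \<phi>z] using \<mu>(1) by (simp add: field_simps)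
    qed
    then show ?case
      using \<mu>(1) by (simp add: \<mu>_def[symmetric] field_simps)
  qed
qed

text \<open>
At a point with \<open>|\<phi>(z)|\<close> near \<open>1\<close> take the test function for \<open>a = \<phi>(z)\<close>. The term with \<open>B\<close> is bounded by
\<open>16 (E + e)\<close> because of \<open>lower_I\<close> and \<open>boundary_I\<close>, which leaves \<open>17 (E + e)\<close> for the term with \<open>A\<close>, and
the value of the test function turns this into a bound for \<open>A loglog |\<phi>|\<close>. The norm of \<open>z\<^sup>n\<^sup>+\<^sup>1\<close> is at
least \<open>(n+1) r\<^sup>n / loglog r\<close> for every \<open>r\<close>, so \<open>r = |\<phi>(z)|\<close> gives the bound for \<open>J\<close> at these points. At
the points with \<open>|\<phi>(z)| \<le> q\<close>, any \<open>p\<close> between \<open>q\<close> and \<open>1\<close> in the place of \<open>r\<close> gives geometric decay.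
\<close>

lemma lower_J:
  assumes K: "compact_linear_operator v_log v_log K" and e: "0 < e"
  defines "E \<equiv> operator_norm v_log v_log (\<lambda>f z. W_op u \<phi> f z - K f z)"
  shows "eventually (\<lambda>n. real (n + 1) * bloch_norm v_log (J_op u (\<lambda>z. \<phi> z ^ n))
      / bloch_norm w_log (monomial (n + 1)) \<le> 4080 * (E + e) + e) sequentially"
proof -
  obtain s \<delta> where s: "0 < s" "s < 1" "0 < \<delta>" and
    *: "\<And>f z. f \<in> little_bloch v_log \<Longrightarrow> f 0 = 0 \<Longrightarrow> bloch_norm v_log f \<le> 1 \<Longrightarrow>
      (\<forall>z. cmod z \<le> s \<longrightarrow> v_log z * cmod (deriv f z) \<le> \<delta>) \<Longrightarrow> z \<in> unit_disk \<Longrightarrow>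
      v_log z * cmod (deriv (W_op u \<phi> f) z) \<le> E + e"
    using W_small[OF K e, folded E_def] by blast
  obtain s0 where s0: "0 < s0" "s0 < 1"
    "\<And>z. z \<in> unit_disk \<Longrightarrow> s0 < cmod (\<phi> z) \<Longrightarrow> B z \<le> 16 * (E + e) * log_weight (cmod (\<phi> z))"
    using boundary_I[OF lower_I[OF K e, folded E_def]] by blast
  obtain t where t: "0 < t" "t < 1"
    "\<And>a. t < cmod a \<Longrightarrow> cmod a < 1 \<Longrightarrow> \<exists>f\<in>little_bloch v_log. f 0 = 0 \<and> bloch_norm v_log f \<le> 1 \<and>
      (\<forall>z. cmod z \<le> s \<longrightarrow> v_log z * cmod (deriv f z) \<le> \<delta>) \<and> loglog (cmod a) \<le> 240 * cmod (f a)"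
    using test_functions[OF less_imp_le[OF s(1)] s(2,3)] by blast
  obtain C where C: "0 < C" "\<And>z. z \<in> unit_disk \<Longrightarrow> A z \<le> C" "\<And>z. z \<in> unit_disk \<Longrightarrow> B z \<le> C"
    using AB_bounded by blast
  have Kb: "bounded_operator v_log K"
    by (rule compact_imp_bounded_operator[OF is_weight_v_log K])
  have E0: "0 \<le> E"
    unfolding E_def
    by (rule operator_norm_nonneg[OF is_weight_v_log bounded_operator_sub[OF is_weight_v_log W_bounded Kb]])
  define q where "q = max s0 t"
  have q: "0 < q" "q < 1"
    using s0 t by (auto simp: q_def)
  have far: "A z * loglog (cmod (\<phi> z)) \<le> 4080 * (E + e)" if z: "z \<in> unit_disk" and qz: "q < cmod (\<phi> z)" for z
  proof -
    have \<phi>z: "cmod (\<phi> z) < 1"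
      by (rule \<phi>_disk[OF z])
    obtain f where f: "f \<in> little_bloch v_log" "f 0 = 0" "bloch_norm v_log f \<le> 1"
      "\<forall>z. cmod z \<le> s \<longrightarrow> v_log z * cmod (deriv f z) \<le> \<delta>" "loglog (cmod (\<phi> z)) \<le> 240 * cmod (f (\<phi> z))"
      using t(3)[of "\<phi> z"] qz \<phi>z by (auto simp: q_def)
    have fb: "f \<in> bloch v_log"
      using f by (simp add: little_bloch_def)
    have V: "0 < log_weight (cmod (\<phi> z))"
      using \<phi>z by (intro log_weight_pos) auto
    have "B z * cmod (deriv f (\<phi> z)) \<le> (16 * (E + e) * log_weight (cmod (\<phi> z))) * (1 / log_weight (cmod (\<phi> z)))"
    proof (rule mult_mono)
      show "B z \<le> 16 * (E + e) * log_weight (cmod (\<phi> z))"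
        using s0(3)[OF z] qz by (simp add: q_def)
      have "cmod (deriv f (\<phi> z)) \<le> bloch_norm v_log f / log_weight (cmod (\<phi> z))"
        using \<phi>z by (intro bloch_deriv_bound fb) auto
      also have "\<dots> \<le> 1 / log_weight (cmod (\<phi> z))"
        using f V by (intro divide_right_mono) auto
      finally show "cmod (deriv f (\<phi> z)) \<le> 1 / log_weight (cmod (\<phi> z))" .
    qed (use E0 e V in auto)
    also have "\<dots> = 16 * (E + e)"
      using V by simp
    finally have "v_log z * cmod (deriv (W_op u \<phi> f) z) + B z * cmod (deriv f (\<phi> z))
        \<le> (E + e) + 16 * (E + e)"
      by (intro add_mono *[OF f(1-4) z])
    then have "A z * cmod (f (\<phi> z)) \<le> 17 * (E + e)"
      using W_deriv_ge(2)[OF bloch_imp_hol_disk[OF fb] z] by simp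
    moreover have "A z * loglog (cmod (\<phi> z)) \<le> A z * (240 * cmod (f (\<phi> z)))"
      using f(5) A_nonneg[OF z] by (intro mult_left_mono)
    ultimately show ?thesis
      by simp
  qed
  define p where "p = (1 + q) / 2"
  have p: "0 < p" "p < 1" "q < p"
    using q by (auto simp: p_def)
  define L where "L = loglog p"
  have L: "0 < L"
    unfolding L_def using p by (intro loglog_pos) auto
  have "(\<lambda>n. (q / p) ^ n) \<longlonglongrightarrow> 0"
    using p q by (intro LIMSEQ_power_zero) auto
  moreover have "0 < e / (C * L)"
    using e C L by simp
  ultimately have "eventually (\<lambda>n. (q / p) ^ n < e / (C * L)) sequentially"
    by (rule order_tendstoD(2))
  then show ?thesis
  proof eventually_elim
    case (elim n)
    define \<nu> where "\<nu> = bloch_norm w_log (monomial (n + 1))"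
    have \<nu>: "0 < \<nu>"
      unfolding \<nu>_def by (rule monomial_norm_w_pos)
    have \<nu>_ge: "real (n + 1) * r ^ n / \<nu> \<le> loglog r" if "0 \<le> r" "r < 1" for r
    proof -
      have "real (n + 1) * r ^ n / loglog r \<le> \<nu>"
        unfolding \<nu>_def by (rule monomial_norm_w_ge[OF that])
      then show ?thesis
        using loglog_pos[OF that] \<nu> by (simp add: field_simps)
    qed
    define c where "c = 4080 * (E + e) + e"
    have "bloch_norm v_log (J_op u (\<lambda>z. \<phi> z ^ n)) \<le> c * \<nu> / real (n + 1)"
    proof (rule J_norm(2))
      fix z assume z: "z \<in> unit_disk"
      have "A z * (real (n + 1) * cmod (\<phi> z) ^ n / \<nu>) \<le> c"
      proof (cases "q < cmod (\<phi> z)")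
        case True
        have "A z * (real (n + 1) * cmod (\<phi> z) ^ n / \<nu>) \<le> A z * loglog (cmod (\<phi> z))"
          using \<phi>_disk[OF z] A_nonneg[OF z] by (intro mult_left_mono \<nu>_ge) auto
        then show ?thesis
          using far[OF z True] e by (simp add: c_def)
      next
        case False
        have "real (n + 1) * cmod (\<phi> z) ^ n / \<nu> \<le> real (n + 1) * q ^ n / \<nu>"
          using False \<nu> by (intro divide_right_mono mult_left_mono power_mono) auto
        also have "\<dots> = (real (n + 1) * p ^ n / \<nu>) * (q / p) ^ n"
          using p by (simp add: power_divide)
        also have "\<dots> \<le> L * (e / (C * L))"
          using \<nu>_ge[of p] p q elim L by (intro mult_mono) (auto simp: L_def)
        also have "\<dots> = e / C"
          using L by simp
        finally have "A z * (real (n + 1) * cmod (\<phi> z) ^ n / \<nu>) \<le> C * (e / C)"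
          using C z \<nu> by (intro mult_mono) auto
        then show ?thesis
          using C(1) E0 e by (simp add: c_def)
      qed
      then show "A z * cmod (\<phi> z) ^ n \<le> c * \<nu> / real (n + 1)"
        using \<nu> by (simp add: pos_le_divide_eq pos_divide_le_eq mult_ac del: of_nat_add of_nat_Suc)
    qed
    then have "real (n + 1) * bloch_norm v_log (J_op u (\<lambda>z. \<phi> z ^ n)) \<le> c * \<nu>"
      by (simp add: pos_le_divide_eq mult_ac del: of_nat_add of_nat_Suc)
    then show ?case
      unfolding c_def[symmetric] \<nu>_def[symmetric] using \<nu> by (simp only: pos_divide_le_eq)
  qed
qed

lemma M_log_le_compact:
  assumes K: "compact_linear_operator v_log v_log K"
  shows "M_log u \<phi> \<le> ereal (4080 * operator_norm v_log v_log (\<lambda>f z. W_op u \<phi> f z - K f z))"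
proof -
  define E where "E = operator_norm v_log v_log (\<lambda>f z. W_op u \<phi> f z - K f z)"
  have Kb: "bounded_operator v_log K"
    by (rule compact_imp_bounded_operator[OF is_weight_v_log K])
  have E0: "0 \<le> E"
    unfolding E_def
    by (rule operator_norm_nonneg[OF is_weight_v_log bounded_operator_sub[OF is_weight_v_log W_bounded Kb]])
  have "M_log u \<phi> \<le> ereal (4080 * E) + ereal e" if e: "0 < e" for e
  proof -
    \<comment> \<open>Chosen so that \<open>4080 (E + d) + d = 4080 E + e\<close>.\<close>
    define d where "d = e / 4081"
    have d: "0 < d" "4080 * (E + d) + d = 4080 * E + e" "E + d \<le> 4080 * E + e"
      using e E0 by (auto simp: d_def)
    have "M_log u \<phi> \<le> ereal (4080 * E + e)"
      unfolding M_log_def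
    proof (intro max.boundedI Limsup_bounded)
      show "\<forall>\<^sub>F n in sequentially. ereal (real (n + 1) * bloch_norm v_log (J_op u (\<lambda>z. \<phi> z ^ n))
          / bloch_norm w_log (monomial (n + 1))) \<le> ereal (4080 * E + e)"
        using lower_J[OF K d(1)] unfolding E_def[symmetric] d(2) by simp
      show "\<forall>\<^sub>F n in sequentially. ereal (bloch_norm v_log (I_op u (\<lambda>z. \<phi> z ^ n))
          / bloch_norm v_log (monomial n)) \<le> ereal (4080 * E + e)"
        using lower_I[OF K d(1)] unfolding E_def[symmetric]
        by (rule eventually_mono) (use d(3) in simp)
    qed
    then show ?thesis
      by simp
  qed
  then show ?thesis
    unfolding E_def[symmetric] by (rule ereal_le_epsilon2)
qed

lemma essential_norm_le_M_log:
  assumes M: "M_log u \<phi> < ereal m"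
  defines "C \<equiv> (2 * pt_const + 4) * (16 + 2 * (1 + 4 / ln (ln 4)))"
  shows "essential_norm v_log v_log (W_op u \<phi>) \<le> C * m"
proof -
  define c where "c = 2 * (1 + 4 / ln (ln (4::real)))"
  have c: "0 < c"
    unfolding c_def using lnln4_pos by (simp add: add_pos_pos)
  have lt: "limsup (\<lambda>n. ereal (real (n + 1) * bloch_norm v_log (J_op u (\<lambda>z. \<phi> z ^ n))
      / bloch_norm w_log (monomial (n + 1)))) < ereal m"
    "limsup (\<lambda>n. ereal (bloch_norm v_log (I_op u (\<lambda>z. \<phi> z ^ n)) / bloch_norm v_log (monomial n))) < ereal m"
    using M unfolding M_log_def max_less_iff_conj by blast+
  have evJ: "eventually (\<lambda>n. real (n + 1) * bloch_norm v_log (J_op u (\<lambda>z. \<phi> z ^ n))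
      / bloch_norm w_log (monomial (n + 1)) \<le> m) sequentially"
    and evI: "eventually (\<lambda>n. bloch_norm v_log (I_op u (\<lambda>z. \<phi> z ^ n))
      / bloch_norm v_log (monomial n) \<le> m) sequentially"
    by (rule eventually_mono[OF Limsup_lessD[OF lt(1)]]; simp)
       (rule eventually_mono[OF Limsup_lessD[OF lt(2)]]; simp)
  obtain s where s: "0 < s" "s < 1"
    "\<And>z. z \<in> unit_disk \<Longrightarrow> s < cmod (\<phi> z) \<Longrightarrow> A z * loglog (cmod (\<phi> z)) \<le> c * m"
    using boundary_J[OF evJ] unfolding c_def by blast
  obtain t where t: "0 < t" "t < 1"
    "\<And>z. z \<in> unit_disk \<Longrightarrow> t < cmod (\<phi> z) \<Longrightarrow> B z \<le> 16 * m * log_weight (cmod (\<phi> z))"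
    using boundary_I[OF evI] by blast
  have m: "0 \<le> m"
  proof -
    obtain n where "bloch_norm v_log (I_op u (\<lambda>z. \<phi> z ^ n)) / bloch_norm v_log (monomial n) \<le> m" "1 \<le> n"
      using eventually_happens[OF eventually_conj[OF evI eventually_ge_at_top[of 1]]] by auto
    moreover have "0 \<le> bloch_norm v_log (I_op u (\<lambda>z. \<phi> z ^ n))"
      using I_norm(1)[of 0 n] B_nonneg[of 0]
      by (smt (verit) centre_in_ball mult_nonneg_nonneg norm_ge_zero of_nat_0_le_iff zero_le_power)
    ultimately show ?thesis
      using monomial_norm_v_pos[of n] by (smt (verit) divide_nonneg_pos)
  qed
  have "essential_norm v_log v_log (W_op u \<phi>) \<le> (2 * pt_const + 4) * ((16 + c) * m)"
  proof (rule essential_norm_upper[of "max s t"])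
    fix z assume z: "z \<in> unit_disk" "max s t < cmod (\<phi> z)"
    have V: "0 < log_weight (cmod (\<phi> z))"
      using \<phi>_disk[OF z(1)] by (intro log_weight_pos) auto
    have "A z * loglog (cmod (\<phi> z)) \<le> c * m"
      using s(3)[OF z(1)] z(2) by simp
    also have "\<dots> \<le> (16 + c) * m"
      using m by (intro mult_right_mono) auto
    finally have 1: "A z * loglog (cmod (\<phi> z)) \<le> (16 + c) * m" .
    have "B z \<le> 16 * m * log_weight (cmod (\<phi> z))"
      using t(3)[OF z(1)] z(2) by simp
    also have "\<dots> \<le> (16 + c) * m * log_weight (cmod (\<phi> z))"
      using m c V by (intro mult_right_mono) auto
    finally show "A z * loglog (cmod (\<phi> z)) \<le> (16 + c) * m \<and> B z \<le> (16 + c) * m * log_weight (cmod (\<phi> z))"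
      using 1 by simp
  qed (use s t m c in auto)
  then show ?thesis
    by (simp add: C_def c_def mult.assoc)
qed

lemma M_log_nonneg: "0 \<le> M_log u \<phi>"
proof (rule ccontr)
  assume "\<not> 0 \<le> M_log u \<phi>"
  then have "M_log u \<phi> < 0"
    by simp
  then have "limsup (\<lambda>n. ereal (bloch_norm v_log (I_op u (\<lambda>z. \<phi> z ^ n)) / bloch_norm v_log (monomial n))) < 0"
    unfolding M_log_def max_less_iff_conj by blast
  then have "eventually (\<lambda>n. ereal (bloch_norm v_log (I_op u (\<lambda>z. \<phi> z ^ n)) / bloch_norm v_log (monomial n)) < 0) sequentially"
    by (rule Limsup_lessD)
  then obtain n where "bloch_norm v_log (I_op u (\<lambda>z. \<phi> z ^ n)) / bloch_norm v_log (monomial n) < 0" "1 \<le> n"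
    using eventually_happens[OF eventually_conj[OF _ eventually_ge_at_top[of 1]]] by fastforce
  moreover have "0 \<le> bloch_norm v_log (I_op u (\<lambda>z. \<phi> z ^ n))"
    using I_norm(1)[of 0 n] B_nonneg[of 0]
    by (smt (verit) centre_in_ball mult_nonneg_nonneg norm_ge_zero of_nat_0_le_iff zero_le_power)
  ultimately show False
    using monomial_norm_v_pos[of n] by (smt (verit) divide_nonneg_pos)
qed

text \<open>
Dilation by \<open>0\<close> provides one compact operator, so that the infimum is over a nonempty set.
\<close>

lemma essential_norm_lower: "M_log u \<phi> \<le> ereal (4080 * essential_norm v_log v_log (W_op u \<phi>))"
proof -
  have ex: "compact_linear_operator v_log v_log (\<lambda>f. W_op u \<phi> (dilation 0 f))"
    by (rule W_dilation_compact) auto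
  have "M_log u \<phi> \<noteq> \<infinity>"
    using M_log_le_compact[OF ex] by auto
  then obtain m where m: "M_log u \<phi> = ereal m"
    using M_log_nonneg by (cases "M_log u \<phi>") auto
  have "m / 4080 \<le> essential_norm v_log v_log (W_op u \<phi>)"
    unfolding essential_norm_def
  proof (rule cInf_greatest)
    show "m / 4080 \<le> x"
      if "x \<in> {operator_norm v_log v_log (\<lambda>f z. W_op u \<phi> f z - K f z) |K. compact_linear_operator v_log v_log K}" for x
      using that M_log_le_compact m by (auto simp: field_simps)
  qed (use ex in auto)
  then show ?thesis
    by (simp add: m)
qed

lemma essential_norm_upper_M_log:
  "ereal (essential_norm v_log v_log (W_op u \<phi>))
    \<le> ereal ((2 * pt_const + 4) * (16 + 2 * (1 + 4 / ln (ln 4)))) * M_log u \<phi>"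
proof -
  define C where "C = (2 * pt_const + 4) * (16 + 2 * (1 + 4 / ln (ln (4::real))))"
  have C: "0 < C"
    unfolding C_def using pt_const_ge_1 lnln4_pos by (intro mult_pos_pos) (auto intro: add_pos_pos)
  show ?thesis
  proof (cases "M_log u \<phi>")
    case (real m)
    have "essential_norm v_log v_log (W_op u \<phi>) \<le> C * m"
    proof (rule field_le_epsilon)
      fix e :: real assume e: "0 < e"
      have "essential_norm v_log v_log (W_op u \<phi>) \<le> C * (m + e / C)"
        unfolding C_def by (rule essential_norm_le_M_log) (use real C e in \<open>simp add: C_def\<close>)
      then show "essential_norm v_log v_log (W_op u \<phi>) \<le> C * m + e"
        using C by (simp add: distrib_left)
    qed
    then show ?thesis
      unfolding C_def[symmetric] using real by simp
  next
    case PInf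
    then show ?thesis
      unfolding C_def[symmetric] using C by simp
  next
    case MInf
    then show ?thesis
      using M_log_nonneg by simp
  qed
qed

end

theorem theorem1p2:
  shows "\<exists>K::real. K > 0 \<and>
    (\<forall>u \<phi> :: complex \<Rightarrow> complex.
       u holomorphic_on unit_disk \<longrightarrow> \<phi> holomorphic_on unit_disk \<longrightarrow> \<phi> ` unit_disk \<subseteq> unit_disk \<longrightarrow>
       continuous_linear_operator v_log v_log (W_op u \<phi>) \<longrightarrow>
         ereal (1 / K) * M_log u \<phi> \<le> ereal (essential_norm v_log v_log (W_op u \<phi>)) \<and>
         ereal (essential_norm v_log v_log (W_op u \<phi>)) \<le> ereal K * M_log u \<phi>)"
proof -
  define C where "C = (2 * pt_const + 4) * (16 + 2 * (1 + 4 / ln (ln (4::real))))"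
  define K where "K = max 4080 C"
  have K: "0 < K" "4080 \<le> K" "C \<le> K"
    by (auto simp: K_def)
  show ?thesis
  proof (intro exI[of _ K] conjI allI impI K(1))
    fix u \<phi> :: "complex \<Rightarrow> complex"
    assume "u holomorphic_on unit_disk" "\<phi> holomorphic_on unit_disk" "\<phi> ` unit_disk \<subseteq> unit_disk"
      "continuous_linear_operator v_log v_log (W_op u \<phi>)"
    then interpret weighted_composition u \<phi>
      using continuous_imp_bounded_operator[OF is_weight_v_log] by unfold_locales auto
    define E where "E = essential_norm v_log v_log (W_op u \<phi>)"
    have low: "M_log u \<phi> \<le> ereal (4080 * E)"
      unfolding E_def by (rule essential_norm_lower)
    have up: "ereal E \<le> ereal C * M_log u \<phi>"
      unfolding E_def C_def by (rule essential_norm_upper_M_log)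
    obtain m where m: "M_log u \<phi> = ereal m" "0 \<le> m"
      using low M_log_nonneg by (cases "M_log u \<phi>") auto
    have "m \<le> 4080 * E"
      using low m by simp
    also have "\<dots> \<le> K * E"
      using K m \<open>m \<le> 4080 * E\<close> by (intro mult_right_mono) auto
    finally have "ereal (1 / K) * M_log u \<phi> \<le> ereal E"
      using K(1) m by (simp add: field_simps)
    then show "ereal (1 / K) * M_log u \<phi> \<le> ereal (essential_norm v_log v_log (W_op u \<phi>))"
      by (simp add: E_def)
    have "C * m \<le> K * m"
      using K m by (intro mult_right_mono)
    then have "ereal E \<le> ereal K * M_log u \<phi>"
      using up m by simp
    then show "ereal (essential_norm v_log v_log (W_op u \<phi>)) \<le> ereal K * M_log u \<phi>"
      by (simp add: E_def)
  qed
qed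

end
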